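(* Let $H_1,H_2$ be Hilbert spaces and let $\mathcal{A}\subset B(H_1)$, $\mathcal{B}\subset B(H_2)$ be unital reflexive algebras. Then $\mathcal{A}$ and $\mathcal{B}$ are TRO equivalent if and only if there exists a $*$-isomorphism $\theta:\Delta(\mathcal{A})'\to\Delta(\mathcal{B})'$ such that $\theta(\mathrm{Lat}(\mathcal{A}))=\mathrm{Lat}(\mathcal{B})$.
   Context: $B(H_1,H_2)$ denotes the bounded linear operators from $H_1$ to $H_2$. For sets of operators, $\mathcal{X}^*=\{X^*:X\in\mathcal{X}\}$, $\mathcal{X}\mathcal{Y}=\{XY: X\in\mathcal{X},Y\in\mathcal{Y}\}$, and $\mathrm{span}(\mathcal{X})^{-w^*}$ is the weak-$*$ closure of the linear span. An algebra is a subalgebra of $B(H)$ for some Hilbert space $H$; it is unital if it contains the identity operator of $H$. A ternary ring of operators (TRO) is a linear subspace $\mathcal{M}\subset B(H_1,H_2)$ with $\mathcal{M}\mathcal{M}^*\mathcal{M}\subset\mathcal{M}$. Two $w^*$-closed algebras $\mathcal{A}\subset B(H_1)$, $\mathcal{B}\subset B(H_2)$ are TRO equivalent if there is a TRO $\mathcal{M}\subset B(H_1,H_2)$ with $\mathcal{A}=\mathrm{span}(\mathcal{M}^*\mathcal{B}\mathcal{M})^{-w^*}$ and $\mathcal{B}=\mathrm{span}(\mathcal{M}\mathcal{A}\mathcal{M}^* )^{-w^*}$. $\Delta(\mathcal{A})=\mathcal{A}\cap\mathcal{A}^*$ is the diagonal, and $'$ denotes commutant. For an algebra $\mathcal{A}\subset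 B(H)$, $\mathrm{Lat}(\mathcal{A})$ is the set of orthogonal projections $L\in B(H)$ with $L^\perp\mathcal{A}L=0$, where $L^\perp=I-L$. For a set $\mathcal{L}$ of projections, $\mathrm{Alg}(\mathcal{L})=\{A\in B(H):L^\perp AL=0\ \forall L\in\mathcal{L}\}$. A unital algebra $\mathcal{A}$ is reflexive if $\mathcal{A}=\mathrm{Alg}(\mathrm{Lat}(\mathcal{A}))$. *)

theory Defs
  imports "HOL-Analysis.Analysis"
begin

section \<open>Complex Hilbert spaces\<close>

text \<open>HOL-Analysis only has real inner products. The class below is that of arbitrary complex
  Hilbert spaces (no separability or dimension assumption); completeness comes from
  \<^class>\<open>banach\<close>. The inner product is linear in its first argument.\<close>

class chilbert_space = banach +
  fixes scaleC :: "complex \<Rightarrow> 'a \<Rightarrow> 'a" (infixr \<open>*\<^sub>C\<close> 75)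
    and cinner :: "'a \<Rightarrow> 'a \<Rightarrow> complex"
  assumes scaleC_add_right: "c *\<^sub>C (x + y) = c *\<^sub>C x + c *\<^sub>C y"
    and scaleC_add_left: "(c + d) *\<^sub>C x = c *\<^sub>C x + d *\<^sub>C x"
    and scaleC_scaleC: "c *\<^sub>C (d *\<^sub>C x) = (c * d) *\<^sub>C x"
    and scaleC_of_real: "complex_of_real r *\<^sub>C x = r *\<^sub>R x"
    and cinner_commute: "cinner x y = cnj (cinner y x)"
    and cinner_add_left: "cinner (x + y) z = cinner x z + cinner y z"
    and cinner_scaleC_left: "cinner (c *\<^sub>C x) y = c * cinner x y"
    and cinner_self: "cinner x x = complex_of_real ((norm x)\<^sup>2)"

instantiation complex :: chilbert_space
begin

definition scaleC_complex :: "complex \<Rightarrow> complex \<Rightarrow> complex"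
  where "scaleC_complex c x = c * x"

definition cinner_complex :: "complex \<Rightarrow> complex \<Rightarrow> complex"
  where "cinner_complex x y = x * cnj y"

instance
  by standard
    (auto simp: scaleC_complex_def cinner_complex_def algebra_simps scaleR_conv_of_real
      complex_norm_square simp del: of_real_power)

end

lemma norm_scaleC: "norm (c *\<^sub>C x) = cmod c * norm (x :: 'a::chilbert_space)"
proof -
  have "complex_of_real ((norm (c *\<^sub>C x))\<^sup>2) = cinner (c *\<^sub>C x) (c *\<^sub>C x)"
    by (rule cinner_self [symmetric])
  also have "\<dots> = c * cnj (cinner (c *\<^sub>C x) x)"
    by (metis cinner_commute cinner_scaleC_left)
  also have "\<dots> = (c * cnj c) * cnj (cinner x x)"
    by (simp add: cinner_scaleC_left)
  also have "\<dots> = complex_of_real ((cmod c * norm x)\<^sup>2)"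
    by (simp add: cinner_self complex_norm_square [symmetric] power_mult_distrib)
  finally have "(norm (c *\<^sub>C x))\<^sup>2 = (cmod c * norm x)\<^sup>2"
    using of_real_eq_iff by blast
  then show ?thesis
    by (simp add: power2_eq_iff_nonneg)
qed

lemma scaleC_one: "1 *\<^sub>C x = (x :: 'a::chilbert_space)"
  using scaleC_of_real [of 1 x] by simp

lemma bounded_linear_scaleC: "bounded_linear (\<lambda>x :: 'a::chilbert_space. c *\<^sub>C x)"
proof (rule bounded_linear_intro)
  fix x y :: 'a and r :: real
  show "c *\<^sub>C (x + y) = c *\<^sub>C x + c *\<^sub>C y" by (rule scaleC_add_right)
  show "c *\<^sub>C (r *\<^sub>R x) = r *\<^sub>R (c *\<^sub>C x)"
    by (simp add: scaleC_of_real [symmetric] scaleC_scaleC mult.commute)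
  show "norm (c *\<^sub>C x) \<le> norm x * cmod c" by (simp add: norm_scaleC mult.commute)
qed

section \<open>Bounded complex-linear operators\<close>

text \<open>The library type \<^typ>\<open>'a \<Rightarrow>\<^sub>L 'b\<close> consists of the bounded real-linear maps;
  \<open>bop\<close> is the set B(H1,H2) of the complex-linear ones, and all the sets of operators below are
  subsets of it.\<close>

definition bop :: "('a::chilbert_space \<Rightarrow>\<^sub>L 'b::chilbert_space) set"
  where "bop = {T. \<forall>c x. blinfun_apply T (c *\<^sub>C x) = c *\<^sub>C blinfun_apply T x}"

lift_definition op_scale ::
    "complex \<Rightarrow> ('a::chilbert_space \<Rightarrow>\<^sub>L 'b::chilbert_space) \<Rightarrow> 'a \<Rightarrow>\<^sub>L 'b"
  is "\<lambda>c T x. c *\<^sub>C T x"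
  by (rule bounded_linear_compose [OF bounded_linear_scaleC])

text \<open>This provides complex subspaces \<open>op.subspace\<close> and complex linear spans \<open>op.span\<close>.\<close>

global_interpretation op: vector_space op_scale
proof
  fix a b :: complex and T U :: "'a::chilbert_space \<Rightarrow>\<^sub>L 'b::chilbert_space"
  show "op_scale a (T + U) = op_scale a T + op_scale a U"
    by transfer (simp add: scaleC_add_right)
  show "op_scale (a + b) T = op_scale a T + op_scale b T"
    by transfer (simp add: scaleC_add_left)
  show "op_scale a (op_scale b T) = op_scale (a * b) T"
    by transfer (simp add: scaleC_scaleC)
  show "op_scale 1 T = T"
    by transfer (simp add: scaleC_one)
qed

text \<open>The Hilbert space adjoint; existence is the Riesz representation theorem.\<close>

definition adj :: "('a::chilbert_space \<Rightarrow>\<^sub>L 'b::chilbert_space) \<Rightarrow> 'b \<Rightarrow>\<^sub>L 'a"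
  where "adj T = (THE S. S \<in> bop \<and>
    (\<forall>x y. cinner (blinfun_apply T x) y = cinner x (blinfun_apply S y)))"

definition op_mult ::
    "('b::chilbert_space \<Rightarrow>\<^sub>L 'c::chilbert_space) set \<Rightarrow> ('a::chilbert_space \<Rightarrow>\<^sub>L 'b) set
      \<Rightarrow> ('a \<Rightarrow>\<^sub>L 'c) set"  (infixl \<open>\<cdot>\<close> 70)
  where "X \<cdot> Y = {S o\<^sub>L T | S T. S \<in> X \<and> T \<in> Y}"

section \<open>The weak-* topology\<close>

text \<open>The predual of B(H1,H2) is the space of trace class operators from H2 to H1, and these are
  the sums \<open>\<Sum>n. \<langle>\<cdot>, y n\<rangle> x n\<close> with both sequences square summable in norm;
  under the trace pairing such an operator is the functional \<open>T \<mapsto> \<Sum>n. \<langle>T (x n), y n\<rangle>\<close>.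
  The weak-* (ultraweak) topology is the initial topology of these functionals.\<close>

definition square_summable :: "(nat \<Rightarrow> 'a::real_normed_vector) \<Rightarrow> bool"
  where "square_summable x \<longleftrightarrow> summable (\<lambda>n. (norm (x n))\<^sup>2)"

definition predual_pairing ::
    "(nat \<Rightarrow> 'a::chilbert_space) \<Rightarrow> (nat \<Rightarrow> 'b::chilbert_space) \<Rightarrow> ('a \<Rightarrow>\<^sub>L 'b) \<Rightarrow> complex"
  where "predual_pairing x y T = (\<Sum>n. cinner (blinfun_apply T (x n)) (y n))"

definition weak_star_topology :: "('a::chilbert_space \<Rightarrow>\<^sub>L 'b::chilbert_space) topology"
  where "weak_star_topology = topology_generated_by
    {{T \<in> bop. predual_pairing x y T \<in> U} | x y U.
      square_summable x \<and> square_summable y \<and> open U}"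

section \<open>Operator algebras and TRO equivalence\<close>

definition unital_algebra :: "('a::chilbert_space \<Rightarrow>\<^sub>L 'a) set \<Rightarrow> bool"
  where "unital_algebra A \<longleftrightarrow>
    A \<subseteq> bop \<and> op.subspace A \<and> A \<cdot> A \<subseteq> A \<and> id_blinfun \<in> A"

definition tro :: "('a::chilbert_space \<Rightarrow>\<^sub>L 'b::chilbert_space) set \<Rightarrow> bool"
  where "tro M \<longleftrightarrow> M \<subseteq> bop \<and> op.subspace M \<and> M \<cdot> (adj ` M) \<cdot> M \<subseteq> M"

text \<open>The two equations force \<open>A\<close> and \<open>B\<close> to be weak-* closed.\<close>

definition tro_equivalent ::
    "('a::chilbert_space \<Rightarrow>\<^sub>L 'a) set \<Rightarrow> ('b::chilbert_space \<Rightarrow>\<^sub>L 'b) set \<Rightarrow> bool"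
  where "tro_equivalent A B \<longleftrightarrow> (\<exists>M :: ('a \<Rightarrow>\<^sub>L 'b) set. tro M \<and>
    A = weak_star_topology closure_of op.span ((adj ` M) \<cdot> B \<cdot> M) \<and>
    B = weak_star_topology closure_of op.span (M \<cdot> A \<cdot> (adj ` M)))"

definition diagonal :: "('a::chilbert_space \<Rightarrow>\<^sub>L 'a) set \<Rightarrow> ('a \<Rightarrow>\<^sub>L 'a) set"
  where "diagonal A = A \<inter> adj ` A"

definition commutant :: "('a::chilbert_space \<Rightarrow>\<^sub>L 'a) set \<Rightarrow> ('a \<Rightarrow>\<^sub>L 'a) set"
  where "commutant X = {T \<in> bop. \<forall>S\<in>X. T o\<^sub>L S = S o\<^sub>L T}"

definition projections :: "('a::chilbert_space \<Rightarrow>\<^sub>L 'a) set"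
  where "projections = {P \<in> bop. P o\<^sub>L P = P \<and> adj P = P}"

definition Lat :: "('a::chilbert_space \<Rightarrow>\<^sub>L 'a) set \<Rightarrow> ('a \<Rightarrow>\<^sub>L 'a) set"
  where "Lat A = {L \<in> projections. \<forall>T\<in>A. (id_blinfun - L) o\<^sub>L T o\<^sub>L L = 0}"

definition Alg :: "('a::chilbert_space \<Rightarrow>\<^sub>L 'a) set \<Rightarrow> ('a \<Rightarrow>\<^sub>L 'a) set"
  where "Alg \<L> = {T \<in> bop. \<forall>L\<in>\<L>. (id_blinfun - L) o\<^sub>L T o\<^sub>L L = 0}"

definition reflexive :: "('a::chilbert_space \<Rightarrow>\<^sub>L 'a) set \<Rightarrow> bool"
  where "reflexive A \<longleftrightarrow> A = Alg (Lat A)"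

text \<open>As usual for *-algebras, a *-isomorphism is purely algebraic: no continuity is required.\<close>

definition star_isomorphism ::
    "(('a::chilbert_space \<Rightarrow>\<^sub>L 'a) \<Rightarrow> ('b::chilbert_space \<Rightarrow>\<^sub>L 'b))
      \<Rightarrow> ('a \<Rightarrow>\<^sub>L 'a) set \<Rightarrow> ('b \<Rightarrow>\<^sub>L 'b) set \<Rightarrow> bool"
  where "star_isomorphism \<theta> R S \<longleftrightarrow> bij_betw \<theta> R S \<and>
    (\<forall>X\<in>R. \<forall>Y\<in>R. \<theta> (X + Y) = \<theta> X + \<theta> Y) \<and>
    (\<forall>c. \<forall>X\<in>R. \<theta> (op_scale c X) = op_scale c (\<theta> X)) \<and>
    (\<forall>X\<in>R. \<forall>Y\<in>R. \<theta> (X o\<^sub>L Y) = \<theta> X o\<^sub>L \<theta> Y) \<and>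
    (\<forall>X\<in>R. \<theta> (adj X) = adj (\<theta> X))"

end

(*
  From M to theta: for T in Delta(A)' the map N h |-> N T h on span (M H1) is well defined and
  bounded, because T commutes with M^* M; its extension theta(T) satisfies theta(T) N = N T.

  From theta to M: let M be the space of all N with N X = theta(X) N. The point is that M separates
  the vectors of H1. Given h, choose k in the range of theta(support of h) with |k| > |h|. By Zorn's
  lemma there is a maximal operator X0 between 0 and the support projection P of h such that
  <theta(X0) k, k> <= <X0 h, h>; theta is compatible with suprema of chains, since positivity of T
  means invertibility of T + e for all e > 0 and is therefore preserved. For Z = P - X0 maximality
  gives |X Z h| <= |theta(X Z) k| for all X, so theta(X Z) k |-> X Z h defines a bounded intertwiner,
  whose adjoint is an element of M that does not annihilate h. Hence span (M^* M) is a nondegenerate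
  *-algebra, and by von Neumann's density argument on the space of square summable sequences it
  contains approximate units c, so that c^* T c, which lies in span (M^* B M), tends weak-* to T in A.
*)
theory Submission
  imports Defs
begin

section \<open>Inner product algebra, the Cauchy-Schwarz inequality and continuity\<close>

section \<open>Inner products\<close>

text \<open>The isomorphism is purely algebraic, so any order or continuity it has must be extracted
  from the ring structure. Hence positivity is characterised by invertibility, and suprema of
  chains, rather than general weak-* limits, are transported. A map prescribed on formal sums or on
  an orbit is not known to be well defined until a norm inequality is proved; operators are
  therefore built from bounded linear relations and extended by zero to the orthogonal complement of
  the domain. In the passage from M to theta, a termwise estimate bounds the image of a vector only
  with a constant that depends on how the vector is written as a sum; iterating T^* T and comparing
  moments removes that constant. Both constructions are symmetric: exchanging A and B replaces theta
  by its inverse and M by its adjoints, so each half is proved for one side and read again for the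
  other. Reflexivity enters where intertwiners are shown to carry A into B and B into A, since that
  is tested on invariant projections.\<close>

lemma cinner_add_right: "cinner x (y + z) = cinner x y + cinner x z"
  by (metis cinner_add_left cinner_commute complex_cnj_add)

lemma cinner_scaleC_right: "cinner x (c *\<^sub>C y) = cnj c * cinner x y"
  by (metis cinner_scaleC_left cinner_commute complex_cnj_mult)

lemma scaleC_minus_one: "(-1) *\<^sub>C x = - (x :: 'a::chilbert_space)"
  using scaleC_of_real [of "-1" x] by simp

lemma scaleC_zero_right: "c *\<^sub>C 0 = (0 :: 'a::chilbert_space)"
  by (metis add_cancel_right_right scaleC_add_right)

lemma cinner_minus_left: "cinner (- x) y = - cinner x y"
  by (metis scaleC_minus_one cinner_scaleC_left mult_minus1)

lemma cinner_minus_right: "cinner x (- y) = - cinner x y"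
  by (metis cinner_minus_left cinner_commute complex_cnj_minus)

lemma cinner_zero_left [simp]: "cinner 0 y = 0"
  using cinner_add_left [of 0 0 y] by simp

lemma cinner_zero_right [simp]: "cinner x 0 = 0"
  using cinner_add_right [of x 0 0] by simp

lemma cinner_diff_left: "cinner (x - y) z = cinner x z - cinner y z"
  by (metis cinner_add_left cinner_minus_left diff_conv_add_uminus)

lemma cinner_diff_right: "cinner x (y - z) = cinner x y - cinner x z"
  by (metis cinner_add_right cinner_minus_right diff_conv_add_uminus)

lemma Re_cinner_commute: "Re (cinner x y) = Re (cinner y x)"
  by (metis cinner_commute complex_cnj(1) complex.sel(1) complex.collapse)

lemma Re_cinner_self: "Re (cinner x x) = (norm x)\<^sup>2"
  by (simp add: cinner_self)

lemma norm_add_square: "(norm (x + y))\<^sup>2 = (norm x)\<^sup>2 + (norm y)\<^sup>2 + 2 * Re (cinner x y)"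
  for x y :: "'a::chilbert_space"
  using Re_cinner_commute [of x y]
  by (simp add: Re_cinner_self [symmetric] cinner_add_left cinner_add_right)

lemma norm_diff_square: "(norm (x - y))\<^sup>2 = (norm x)\<^sup>2 + (norm y)\<^sup>2 - 2 * Re (cinner x y)"
  for x y :: "'a::chilbert_space"
  using norm_add_square [of x "- y"] by (simp add: cinner_minus_right)

lemma cmod_square: "(cmod z)\<^sup>2 = Re (z * cnj z)"
  by (simp add: complex_norm_square [symmetric] del: of_real_power)

text \<open>Both the Cauchy--Schwarz inequality and the variational identity for a minimiser are read off
  from the perturbations \<open>a + t *\<^sub>C v\<close> with the optimal \<open>t\<close>.\<close>

lemma quadratic_perturbation:
  fixes z :: complex and n e :: real
  assumes "\<And>t. 2 * Re (t * z) + (cmod t)\<^sup>2 * n \<ge> - e" and "n \<ge> 0" and "e \<ge> 0"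
  shows "(cmod z)\<^sup>2 \<le> e * n"
proof (cases "n = 0")
  case True
  show ?thesis
  proof (rule ccontr)
    assume "\<not> ?thesis"
    then have z: "(cmod z)\<^sup>2 > 0" using True by simp
    have *: "Re (complex_of_real (- s) * cnj z * z) = - s * (cmod z)\<^sup>2" for s
      by (simp add: cmod_square algebra_simps)
    \<comment> \<open>For \<open>n = 0\<close> the expression is linear in \<open>t\<close>; this
      multiple of \<open>cnj z\<close> gives it the value \<open>- 2 * (e + 1)\<close>, which is
      below \<open>- e\<close>.\<close>
    have "2 * Re (complex_of_real (- ((e + 1) / (cmod z)\<^sup>2)) * cnj z * z) \<ge> - e"
      using assms(1) [of "complex_of_real (- ((e + 1) / (cmod z)\<^sup>2)) * cnj z"] True by simp
    then show False
      unfolding * using z assms(3) by simp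
  qed
next
  case False
  then have n: "n > 0" using assms by simp
  let ?t = "complex_of_real (- (1 / n)) * cnj z"
  have "Re (?t * z) = - (1 / n) * (cmod z)\<^sup>2"
    by (simp add: cmod_square)
  moreover have "(cmod ?t)\<^sup>2 = (1 / n)\<^sup>2 * (cmod z)\<^sup>2"
    by (simp add: norm_mult power_mult_distrib power_divide norm_divide)
  moreover have "2 * Re (?t * z) + (cmod ?t)\<^sup>2 * n \<ge> - e" by (rule assms(1))
  ultimately have "2 * (- (1 / n) * (cmod z)\<^sup>2) + (1 / n)\<^sup>2 * (cmod z)\<^sup>2 * n \<ge> - e"
    by (simp only:)
  moreover have "(1 / n)\<^sup>2 * (cmod z)\<^sup>2 * n = (1 / n) * (cmod z)\<^sup>2"
    using n by (simp add: power2_eq_square)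
  ultimately have "(cmod z)\<^sup>2 / n \<le> e" by simp
  then show ?thesis using n by (simp add: divide_le_eq)
qed

lemma norm_add_scaleC_square:
  "(norm (a + t *\<^sub>C v))\<^sup>2 = (norm a)\<^sup>2 + 2 * Re (t * cinner v a) + (cmod t)\<^sup>2 * (norm v)\<^sup>2"
  for a v :: "'a::chilbert_space"
  unfolding norm_add_square
  by (simp add: norm_scaleC power_mult_distrib Re_cinner_commute [of a] cinner_scaleC_left)

lemma cinner_bound: "cmod (cinner x y) \<le> norm x * norm y"
  for x y :: "'a::chilbert_space"
proof -
  have "2 * Re (t * cinner x y) + (cmod t)\<^sup>2 * (norm x)\<^sup>2 \<ge> - (norm y)\<^sup>2" for t
    using norm_add_scaleC_square [of y t x] zero_le_power2 [of "norm (y + t *\<^sub>C x)"] by linarith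
  then have "(cmod (cinner x y))\<^sup>2 \<le> (norm y)\<^sup>2 * (norm x)\<^sup>2"
    by (rule quadratic_perturbation) auto
  also have "\<dots> = (norm x * norm y)\<^sup>2" by (simp add: power_mult_distrib)
  finally show ?thesis by (rule power2_le_imp_le) simp
qed

text \<open>Conjugation in the second argument is invisible to real scalars, so the real notion
  applies and supplies continuity of the inner product.\<close>

lemma bounded_bilinear_cinner: "bounded_bilinear (cinner :: 'a::chilbert_space \<Rightarrow> _)"
proof
  show "cinner (r *\<^sub>R a) b = r *\<^sub>R cinner a b" for r and a b :: 'a
    unfolding scaleC_of_real [symmetric, of r a] cinner_scaleC_left by (simp add: scaleR_conv_of_real)
  show "cinner a (r *\<^sub>R b) = r *\<^sub>R cinner a b" for r and a b :: 'a
    unfolding scaleC_of_real [symmetric, of r b] cinner_scaleC_right by (simp add: scaleR_conv_of_real)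
  show "\<exists>K. \<forall>a b :: 'a. cmod (cinner a b) \<le> norm a * norm b * K"
    by (rule exI [of _ 1]) (simp add: cinner_bound)
qed (auto simp: cinner_add_left cinner_add_right)

lemmas tendsto_cinner = bounded_bilinear.tendsto [OF bounded_bilinear_cinner]

lemma tendsto_scaleC: "(f \<longlongrightarrow> x) F \<Longrightarrow> ((\<lambda>i. c *\<^sub>C f i) \<longlongrightarrow> c *\<^sub>C x) F"
  by (rule bounded_linear.tendsto [OF bounded_linear_scaleC])

lemma scaleC_diff_right: "c *\<^sub>C (x - y) = c *\<^sub>C x - c *\<^sub>C (y :: 'a::chilbert_space)"
  by (rule bounded_linear.linear [OF bounded_linear_scaleC, THEN linear_diff])

lemma cinner_eqI:
  assumes "\<And>z. cinner x z = cinner y z"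
  shows "x = y"
proof -
  have "cinner (x - y) (x - y) = 0" by (simp add: cinner_diff_left assms)
  then show ?thesis by (simp add: cinner_self)
qed

section \<open>Riesz representation on subspaces that need not be closed\<close>

section \<open>The Riesz representation theorem\<close>

definition csubspace :: "'a::chilbert_space set \<Rightarrow> bool"
  where "csubspace V \<longleftrightarrow> 0 \<in> V \<and> (\<forall>x\<in>V. \<forall>y\<in>V. x + y \<in> V) \<and> (\<forall>c. \<forall>x\<in>V. c *\<^sub>C x \<in> V)"

lemma csubspaceD:
  assumes "csubspace V"
  shows "0 \<in> V" and "x \<in> V \<Longrightarrow> y \<in> V \<Longrightarrow> x + y \<in> V" and "x \<in> V \<Longrightarrow> c *\<^sub>C x \<in> V"
  using assms by (auto simp: csubspace_def)

lemma csubspace_scaleR: "csubspace V \<Longrightarrow> x \<in> V \<Longrightarrow> r *\<^sub>R x \<in> V"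
  by (metis csubspaceD(3) scaleC_of_real)

lemma orthogonal_closure:
  assumes "x \<in> closure V" and "\<And>v. v \<in> V \<Longrightarrow> cinner v y = 0"
  shows "cinner x y = 0"
proof -
  obtain f where f: "\<And>n. f n \<in> V" "f \<longlonglongrightarrow> x"
    using assms(1) unfolding closure_sequential by auto
  have "(\<lambda>n. cinner (f n) y) \<longlonglongrightarrow> cinner x y"
    by (rule tendsto_cinner [OF f(2) tendsto_const])
  then show ?thesis
    by (simp add: assms(2) f(1) LIMSEQ_const_iff)
qed

lemma closure_orthogonal_eq_zero:
  assumes "x \<in> closure V" and "\<And>v. v \<in> V \<Longrightarrow> cinner v x = 0"
  shows "x = 0"
  using orthogonal_closure [OF assms] by (simp add: cinner_self)

text \<open>The representing vector minimises \<open>\<parallel>v\<parallel>\<^sup>2 - 2 Re (f v)\<close>.\<close>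

lemma riesz:
  fixes f :: "'a::chilbert_space \<Rightarrow> complex"
  assumes V: "csubspace V"
    and add: "\<And>x y. x \<in> V \<Longrightarrow> y \<in> V \<Longrightarrow> f (x + y) = f x + f y"
    and scale: "\<And>c x. x \<in> V \<Longrightarrow> f (c *\<^sub>C x) = c * f x"
    and bound: "\<And>x. x \<in> V \<Longrightarrow> cmod (f x) \<le> C * norm x"
  obtains p where "p \<in> closure V" and "\<And>v. v \<in> V \<Longrightarrow> cinner v p = f v"
proof -
  define J where "J v = (norm v)\<^sup>2 - 2 * Re (f v)" for v
  have J_lower: "J v \<ge> - C\<^sup>2" if "v \<in> V" for v
  proof -
    have "Re (f v) \<le> C * norm v"
      using bound [OF that] complex_Re_le_cmod [of "f v"] by linarith
    moreover have "(norm v - C)\<^sup>2 \<ge> 0" by simp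
    ultimately show ?thesis unfolding J_def power2_diff by (simp add: algebra_simps)
  qed
  define m where "m = Inf (J ` V)"
  have bdd: "bdd_below (J ` V)" using J_lower by (auto intro!: bdd_belowI2)
  have ne: "J ` V \<noteq> {}" using csubspaceD(1) [OF V] by auto
  have m_le: "m \<le> J v" if "v \<in> V" for v
    unfolding m_def using bdd that by (simp add: cInf_lower)
  have "\<exists>a\<in>V. J a < m + inverse (real (Suc n))" for n
  proof -
    have "m < m + inverse (real (Suc n))" by simp
    then show ?thesis unfolding m_def using cInf_lessD [OF ne] by (metis imageE)
  qed
  then obtain a where aV: "\<And>n. a n \<in> V" and aJ: "\<And>n. J (a n) < m + inverse (real (Suc n))"
    by metis
  \<comment> \<open>The parallelogram law, together with \<open>J \<ge> m\<close> at the midpoint,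
    forces nearly minimal vectors to be close to each other.\<close>
  have par: "(norm (x - y))\<^sup>2 \<le> 2 * (J x + J y - 2 * m)" if "x \<in> V" "y \<in> V" for x y
  proof -
    have z: "(1/2) *\<^sub>R (x + y) \<in> V"
      using csubspaceD(2) [OF V that] csubspace_scaleR [OF V] by blast
    have f: "f ((1/2) *\<^sub>R (x + y)) = (1/2) * (f x + f y)"
      using scale [of "x + y" "1/2"] csubspaceD(2) [OF V that] add [OF that]
        scaleC_of_real [of "1/2" "x + y"] by simp
    have "J ((1/2) *\<^sub>R (x + y)) = (norm (x + y))\<^sup>2 / 4 - Re (f x + f y)"
      unfolding J_def f by (simp add: power_divide add_divide_distrib)
    moreover have "(norm (x + y))\<^sup>2 = 2 * (norm x)\<^sup>2 + 2 * (norm y)\<^sup>2 - (norm (x - y))\<^sup>2"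
      unfolding norm_add_square norm_diff_square by simp
    ultimately show ?thesis using m_le [OF z] unfolding J_def plus_complex.sel by argo
  qed
  have cauchy: "Cauchy a"
  proof (rule metric_CauchyI)
    fix e :: real assume "e > 0"
    obtain N where N: "inverse (real (Suc N)) < e\<^sup>2 / 4"
      using reals_Archimedean [of "e\<^sup>2/4"] \<open>e > 0\<close> by auto
    show "\<exists>M. \<forall>i\<ge>M. \<forall>j\<ge>M. dist (a i) (a j) < e"
    proof (intro exI allI impI)
      fix i j assume ij: "i \<ge> N" "j \<ge> N"
      have "inverse (real (Suc i)) \<le> inverse (real (Suc N))"
        "inverse (real (Suc j)) \<le> inverse (real (Suc N))"
        using ij by (auto simp: field_simps)
      then have "J (a i) + J (a j) - 2 * m < e\<^sup>2 / 2"
        using aJ [of i] aJ [of j] N by argo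
      then have "(norm (a i - a j))\<^sup>2 < e\<^sup>2"
        using par [OF aV aV, of i j] by argo
      then show "dist (a i) (a j) < e"
        using \<open>e > 0\<close> by (simp add: dist_norm power_less_imp_less_base)
    qed
  qed
  then obtain p where p: "a \<longlonglongrightarrow> p" by (meson Cauchy_convergent convergent_def)
  have "p \<in> closure V" using aV p unfolding closure_sequential by auto
  moreover have "cinner v p = f v" if v: "v \<in> V" for v
  proof -
    \<comment> \<open>Since \<open>a n\<close> minimises \<open>J\<close> up to
      \<open>inverse (real (Suc n))\<close>, the first variation in direction \<open>v\<close> is
      small; in the limit it vanishes, which is the claimed identity.\<close>
    have est: "(cmod (cinner v (a n) - f v))\<^sup>2 \<le> inverse (real (Suc n)) * (norm v)\<^sup>2" for n
    proof (rule quadratic_perturbation)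
      fix t
      have tv: "t *\<^sub>C v \<in> V" using V v by (rule csubspaceD(3))
      then have "m \<le> J (a n + t *\<^sub>C v)" using m_le csubspaceD(2) [OF V aV] by blast
      moreover have "J (a n + t *\<^sub>C v) = J (a n) + 2 * Re (t * (cinner v (a n) - f v))
          + (cmod t)\<^sup>2 * (norm v)\<^sup>2"
        unfolding J_def norm_add_scaleC_square add [OF aV tv] scale [OF v]
        by (simp add: algebra_simps)
      ultimately show "- inverse (real (Suc n))
          \<le> 2 * Re (t * (cinner v (a n) - f v)) + (cmod t)\<^sup>2 * (norm v)\<^sup>2"
        using aJ [of n] by linarith
    qed auto
    have "(\<lambda>n. (cmod (cinner v (a n) - f v))\<^sup>2) \<longlonglongrightarrow> (cmod (cinner v p - f v))\<^sup>2"
      by (intro tendsto_intros tendsto_cinner p)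
    moreover have "(\<lambda>n. inverse (real (Suc n)) * (norm v)\<^sup>2) \<longlonglongrightarrow> 0 * (norm v)\<^sup>2"
      by (intro tendsto_intros LIMSEQ_inverse_real_of_nat)
    ultimately have "(cmod (cinner v p - f v))\<^sup>2 \<le> 0 * (norm v)\<^sup>2"
      using LIMSEQ_le est by blast
    then show ?thesis by simp
  qed
  ultimately show ?thesis by (rule that)
qed

section \<open>Operators from linear relations, adjoints and orthogonal projections\<close>

section \<open>Adjoints\<close>

lemma bopD: "T \<in> bop \<Longrightarrow> blinfun_apply T (c *\<^sub>C x) = c *\<^sub>C blinfun_apply T x"
  by (simp add: bop_def)

lemma csubspace_UNIV: "csubspace UNIV"
  by (simp add: csubspace_def)

lemma cinner_eqI_right:
  assumes "\<And>z. cinner z x = cinner z y"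
  shows "x = y"
  using assms by (metis cinner_commute cinner_eqI)

lemma adjoint_unique:
  assumes "\<And>x y. cinner (blinfun_apply T x) y = cinner x (blinfun_apply S y)"
    and "\<And>x y. cinner (blinfun_apply T x) y = cinner x (blinfun_apply S' y)"
  shows "S = S'"
  by (rule blinfun_eqI, rule cinner_eqI_right) (metis assms)

text \<open>Applying the Riesz theorem on the domain of the relation, which need not be closed, to the
  functionals \<open>x \<mapsto> \<langle>y, u\<rangle>\<close> for \<open>(x, y) \<in> G\<close> gives \<open>S u\<close>; then \<open>T\<close> is the adjoint of \<open>S\<close>.\<close>

lemma operator_of_relation:
  fixes G :: "('a::chilbert_space \<times> 'b::chilbert_space) set"
  assumes zero: "(0, 0) \<in> G"
    and add: "\<And>x y x' y'. (x, y) \<in> G \<Longrightarrow> (x', y') \<in> G \<Longrightarrow> (x + x', y + y') \<in> G"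
    and scale: "\<And>c x y. (x, y) \<in> G \<Longrightarrow> (c *\<^sub>C x, c *\<^sub>C y) \<in> G"
    and bound: "\<And>x y. (x, y) \<in> G \<Longrightarrow> norm y \<le> C * norm x"
    and "C \<ge> 0"
  obtains T :: "'a \<Rightarrow>\<^sub>L 'b" and S :: "'b \<Rightarrow>\<^sub>L 'a" where "T \<in> bop" and "S \<in> bop"
    and "\<And>x y. cinner (blinfun_apply T x) y = cinner x (blinfun_apply S y)"
    and "\<And>x y. (x, y) \<in> G \<Longrightarrow> blinfun_apply T x = y"
    and "\<And>z. (\<And>x y. (x, y) \<in> G \<Longrightarrow> cinner x z = 0) \<Longrightarrow> blinfun_apply T z = 0"
    and "\<And>z. blinfun_apply S z \<in> closure (Domain G)"
proof -
  have minus: "(x - x', y - y') \<in> G" if "(x, y) \<in> G" "(x', y') \<in> G" for x y x' y'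
    using add [OF that(1) scale [OF that(2), of "-1"]] by (simp add: scaleC_minus_one)
  have unique: "y = y'" if "(x, y) \<in> G" "(x, y') \<in> G" for x y y'
    using bound [OF minus [OF that]] by simp
  define g where "g x = (THE y. (x, y) \<in> G)" for x
  have g: "g x = y" if "(x, y) \<in> G" for x y
    unfolding g_def using that unique by blast
  have V: "csubspace (Domain G)"
    using zero add scale unfolding csubspace_def by (auto; blast)
  have "\<exists>p. p \<in> closure (Domain G) \<and> (\<forall>v\<in>Domain G. cinner v p = cinner (g v) u)" for u
  proof -
    obtain p where "p \<in> closure (Domain G)" "\<And>v. v \<in> Domain G \<Longrightarrow> cinner v p = cinner (g v) u"
    proof (rule riesz [OF V, of "\<lambda>v. cinner (g v) u" "C * norm u"])
      show "cinner (g (x + y)) u = cinner (g x) u + cinner (g y) u"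
        if "x \<in> Domain G" "y \<in> Domain G" for x y
        using that add by (auto simp: g cinner_add_left dest: g)
          (metis add cinner_add_left g)
      show "cinner (g (c *\<^sub>C x)) u = c * cinner (g x) u" if "x \<in> Domain G" for c x
        using that scale by (metis DomainE cinner_scaleC_left g)
      show "cmod (cinner (g x) u) \<le> C * norm u * norm x" if "x \<in> Domain G" for x
      proof -
        have "norm (g x) \<le> C * norm x" using that bound g by (metis DomainE)
        then show ?thesis
          using order_trans [OF cinner_bound [of "g x" u] mult_right_mono [of "norm (g x)" "C * norm x" "norm u"]]
          by (simp add: mult_ac)
      qed
    qed blast
    then show ?thesis by blast
  qed
  then obtain s where s: "\<And>u. s u \<in> closure (Domain G)"
    and s_eq: "\<And>u v. v \<in> Domain G \<Longrightarrow> cinner v (s u) = cinner (g v) u"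
    by metis
  \<comment> \<open>The representing vectors lie only in the closure of the domain, so sums and
    multiples of them have to stay there before uniqueness can be applied.\<close>
  have Vc: "x + y \<in> closure (Domain G)" "c *\<^sub>C x \<in> closure (Domain G)"
    if xy: "x \<in> closure (Domain G)" "y \<in> closure (Domain G)" for x y c
  proof -
    obtain e f where e: "\<And>n. e n \<in> Domain G" "e \<longlonglongrightarrow> x" and f: "\<And>n. f n \<in> Domain G" "f \<longlonglongrightarrow> y"
      using xy unfolding closure_sequential by blast
    show "x + y \<in> closure (Domain G)" unfolding closure_sequential
      by (rule exI [of _ "\<lambda>n. e n + f n"]) (simp add: tendsto_add e f csubspaceD(2) [OF V])
    show "c *\<^sub>C x \<in> closure (Domain G)" unfolding closure_sequential
      by (rule exI [of _ "\<lambda>n. c *\<^sub>C e n"]) (simp add: tendsto_scaleC e csubspaceD(3) [OF V])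
  qed
  \<comment> \<open>Inner products with the domain determine vectors of its closure; this uniqueness
    is what makes \<open>s\<close> linear.\<close>
  have eqI: "x = y" if "x \<in> closure (Domain G)" "y \<in> closure (Domain G)"
    "\<And>v. v \<in> Domain G \<Longrightarrow> cinner v x = cinner v y" for x y
  proof -
    have "x + (-1) *\<^sub>C y \<in> closure (Domain G)" using Vc that by blast
    then have "x - y \<in> closure (Domain G)" by (simp add: scaleC_minus_one)
    then have "x - y = 0"
      by (rule closure_orthogonal_eq_zero) (simp add: cinner_diff_right that(3))
    then show ?thesis by simp
  qed
  have s_add: "s (u + v) = s u + s v" for u v
    by (rule eqI) (auto simp: s Vc s_eq cinner_add_right)
  have s_scale: "s (c *\<^sub>C u) = c *\<^sub>C s u" for c u
    by (rule eqI) (auto simp: s Vc [OF s s] s_eq cinner_scaleC_right)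
  have cl_bound: "cmod (cinner v (s u)) \<le> C * norm v * norm u" if "v \<in> Domain G" for u v
  proof -
    have "norm (g v) \<le> C * norm v" using that bound g by (metis DomainE)
    then show ?thesis
      using order_trans [OF cinner_bound [of "g v" u] mult_right_mono [of "norm (g v)" "C * norm v" "norm u"]]
      by (simp add: s_eq that)
  qed
  \<comment> \<open>The bound is known against vectors of the domain only; approximating
    \<open>s u\<close> from the domain turns it into a bound for the inner product of
    \<open>s u\<close> with itself.\<close>
  have s_bound: "norm (s u) \<le> norm u * C" for u
  proof -
    obtain e where e: "\<And>n. e n \<in> Domain G" "e \<longlonglongrightarrow> s u"
      using s unfolding closure_sequential by blast
    have "(\<lambda>n. cmod (cinner (e n) (s u))) \<longlonglongrightarrow> cmod (cinner (s u) (s u))"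
      by (intro tendsto_norm tendsto_cinner e tendsto_const)
    moreover have "(\<lambda>n. C * norm (e n) * norm u) \<longlonglongrightarrow> C * norm (s u) * norm u"
      by (intro tendsto_intros e)
    ultimately have "cmod (cinner (s u) (s u)) \<le> C * norm (s u) * norm u"
      by (rule LIMSEQ_le) (use cl_bound e(1) in blast)
    then have "norm (s u) * norm (s u) \<le> norm (s u) * (norm u * C)"
      by (simp add: cinner_self power2_eq_square norm_mult mult_ac)
    then show ?thesis
      using \<open>C \<ge> 0\<close> by (cases "s u = 0") auto
  qed
  have s_lin: "bounded_linear s"
  proof (rule bounded_linear_intro [where K = C])
    show "s (r *\<^sub>R x) = r *\<^sub>R s x" for r x by (metis s_scale scaleC_of_real)
  qed (auto simp: s_add s_bound)
  \<comment> \<open>A second use of the Riesz theorem, now on the whole space, produces the adjoint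
    \<open>t\<close> of \<open>s\<close>.\<close>
  have "\<exists>p. \<forall>v. cinner v p = cinner (s v) z" for z
  proof -
    obtain p where "\<And>v. v \<in> UNIV \<Longrightarrow> cinner v p = cinner (s v) z"
    proof (rule riesz [OF csubspace_UNIV, of "\<lambda>v. cinner (s v) z" "C * norm z"])
      show "cmod (cinner (s x) z) \<le> C * norm z * norm x" for x
        using order_trans [OF cinner_bound [of "s x" z] mult_right_mono [OF s_bound [of x], of "norm z"]]
        by (simp add: mult_ac)
    qed (auto simp: s_add s_scale cinner_add_left cinner_scaleC_left)
    then show ?thesis by blast
  qed
  then obtain t where t': "\<And>v z. cinner v (t z) = cinner (s v) z" by metis
  have t: "cinner (t z) v = cinner z (s v)" for v z
    by (metis t' cinner_commute)
  have t_add: "t (u + v) = t u + t v" for u v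
    by (rule cinner_eqI) (simp add: t cinner_add_left)
  have t_scale: "t (c *\<^sub>C u) = c *\<^sub>C t u" for c u
    by (rule cinner_eqI) (simp add: t cinner_scaleC_left)
  have t_bound: "norm (t u) \<le> norm u * C" for u
  proof -
    have "(norm (t u))\<^sup>2 \<le> norm u * norm (s (t u))"
      using cinner_bound [of u "s (t u)"] by (simp add: t [symmetric] cinner_self norm_power)
    also have "\<dots> \<le> norm u * (norm (t u) * C)"
      by (rule mult_left_mono [OF s_bound]) simp
    finally have "norm (t u) * norm (t u) \<le> norm (t u) * (norm u * C)"
      by (simp add: power2_eq_square mult_ac)
    then show ?thesis
      using \<open>C \<ge> 0\<close> by (cases "t u = 0") auto
  qed
  have t_lin: "bounded_linear t"
  proof (rule bounded_linear_intro [where K = C])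
    show "t (r *\<^sub>R x) = r *\<^sub>R t x" for r x by (metis t_scale scaleC_of_real)
  qed (auto simp: t_add t_bound)
  show ?thesis
  proof (rule that [of "Blinfun t" "Blinfun s"])
    show "Blinfun t \<in> bop" by (simp add: bop_def bounded_linear_Blinfun_apply t_lin t_scale)
    show "Blinfun s \<in> bop" by (simp add: bop_def bounded_linear_Blinfun_apply s_lin s_scale)
    show "cinner (blinfun_apply (Blinfun t) x) y = cinner x (blinfun_apply (Blinfun s) y)" for x y
      by (simp add: bounded_linear_Blinfun_apply t_lin s_lin t)
    show "blinfun_apply (Blinfun t) x = y" if "(x, y) \<in> G" for x y
      by (rule cinner_eqI)
        (simp add: bounded_linear_Blinfun_apply t_lin t s_eq [OF DomainI [OF that]] g [OF that])
    \<comment> \<open>The range of \<open>s\<close> lies in the closure of the domain, so a vector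
      orthogonal to the domain is annihilated by the adjoint of \<open>s\<close>.\<close>
    show "blinfun_apply (Blinfun t) z = 0" if "\<And>x y. (x, y) \<in> G \<Longrightarrow> cinner x z = 0" for z
    proof -
      have sz: "cinner (s v) z = 0" for v
        by (rule orthogonal_closure [OF s], erule DomainE, erule that)
      have "t z = 0" by (rule cinner_eqI_right) (simp add: t' sz)
      then show ?thesis by (simp add: bounded_linear_Blinfun_apply t_lin)
    qed
    show "blinfun_apply (Blinfun s) z \<in> closure (Domain G)" for z
      by (simp add: bounded_linear_Blinfun_apply s_lin s)
  qed
qed

lemma bop_adjoint_ex:
  fixes T :: "'a::chilbert_space \<Rightarrow>\<^sub>L 'b::chilbert_space"
  assumes "T \<in> bop"
  shows "\<exists>S. S \<in> bop \<and> (\<forall>x y. cinner (blinfun_apply T x) y = cinner x (blinfun_apply S y))"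
proof -
  let ?G = "{(x, blinfun_apply T x) | x. True}"
  obtain T' :: "'a \<Rightarrow>\<^sub>L 'b" and S :: "'b \<Rightarrow>\<^sub>L 'a" where "T' \<in> bop" "S \<in> bop"
    "\<And>x y. cinner (blinfun_apply T' x) y = cinner x (blinfun_apply S y)"
    "\<And>x y. (x, y) \<in> ?G \<Longrightarrow> blinfun_apply T' x = y"
    by (rule operator_of_relation [of ?G "norm T"])
      (auto simp: blinfun.zero_right blinfun.add_right bopD assms norm_blinfun)
  then show ?thesis by auto
qed

lemma
  assumes "T \<in> bop"
  shows adj_bop [simp]: "adj T \<in> bop"
    and cinner_adj_right: "cinner x (blinfun_apply (adj T) y) = cinner (blinfun_apply T x) y"
proof -
  have "\<exists>!S. S \<in> bop \<and> (\<forall>x y. cinner (blinfun_apply T x) y = cinner x (blinfun_apply S y))"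
    using bop_adjoint_ex [OF assms] adjoint_unique by (intro ex_ex1I; blast)
  note adj = theI' [OF this, folded adj_def]
  show "adj T \<in> bop" by (rule conjunct1 [OF adj])
  show "cinner x (blinfun_apply (adj T) y) = cinner (blinfun_apply T x) y"
    by (rule conjunct2 [OF adj, rule_format, symmetric])
qed

lemma cinner_adj_left: "T \<in> bop \<Longrightarrow> cinner (blinfun_apply (adj T) y) x = cinner y (blinfun_apply T x)"
  by (metis cinner_adj_right cinner_commute)

lemma adj_eqI:
  assumes "T \<in> bop" and "\<And>x y. cinner (blinfun_apply T x) y = cinner x (blinfun_apply S y)"
  shows "adj T = S"
  by (rule adjoint_unique [of T]) (auto simp: assms cinner_adj_right)

lemma bop_compose [simp]: "S \<in> bop \<Longrightarrow> T \<in> bop \<Longrightarrow> S o\<^sub>L T \<in> bop"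
  by (simp add: bop_def)

lemma bop_id [simp]: "id_blinfun \<in> bop"
  by (simp add: bop_def)

lemma bop_zero [simp]: "0 \<in> bop"
  by (simp add: bop_def scaleC_zero_right)

lemma bop_add [simp]: "S \<in> bop \<Longrightarrow> T \<in> bop \<Longrightarrow> S + T \<in> bop"
  by (simp add: bop_def blinfun.add_left scaleC_add_right)

lemma bop_diff [simp]: "S \<in> bop \<Longrightarrow> T \<in> bop \<Longrightarrow> S - T \<in> bop"
  by (simp add: bop_def blinfun.diff_left scaleC_diff_right)

lemma op_scale_apply [simp]: "blinfun_apply (op_scale c T) x = c *\<^sub>C blinfun_apply T x"
  by (simp add: op_scale.rep_eq)

lemma bop_op_scale [simp]: "T \<in> bop \<Longrightarrow> op_scale c T \<in> bop"
  by (simp add: bop_def scaleC_scaleC mult.commute)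

lemma op_scale_of_real: "op_scale (complex_of_real r) T = r *\<^sub>R T"
  by (rule blinfun_eqI) (simp add: scaleC_of_real blinfun.scaleR_left)

lemma bop_scaleR [simp]: "T \<in> bop \<Longrightarrow> r *\<^sub>R T \<in> bop"
  unfolding op_scale_of_real [symmetric] by (rule bop_op_scale)

lemma op_scale_compose_left: "op_scale c S o\<^sub>L T = op_scale c (S o\<^sub>L T)"
  by (rule blinfun_eqI) simp

lemma op_scale_compose_right: "S \<in> bop \<Longrightarrow> S o\<^sub>L op_scale c T = op_scale c (S o\<^sub>L T)"
  by (rule blinfun_eqI) (simp add: bopD)

lemmas compose_add_left = bounded_bilinear.add_left [OF bounded_bilinear_blinfun_compose]
lemmas compose_add_right = bounded_bilinear.add_right [OF bounded_bilinear_blinfun_compose]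
lemmas compose_diff_left = bounded_bilinear.diff_left [OF bounded_bilinear_blinfun_compose]
lemmas compose_diff_right = bounded_bilinear.diff_right [OF bounded_bilinear_blinfun_compose]

lemma compose_assoc: "(R o\<^sub>L S) o\<^sub>L T = R o\<^sub>L (S o\<^sub>L T)"
  by (rule blinfun_eqI) simp

lemma compose_id [simp]: "T o\<^sub>L id_blinfun = T" "id_blinfun o\<^sub>L T = T"
  by (auto intro!: blinfun_eqI)

lemma op_subspace_bop: "op.subspace bop"
  by (rule op.subspaceI) auto

lemma adj_adj [simp]: "T \<in> bop \<Longrightarrow> adj (adj T) = T"
  by (rule adj_eqI) (auto simp: cinner_adj_left)

lemma adj_compose: "S \<in> bop \<Longrightarrow> T \<in> bop \<Longrightarrow> adj (S o\<^sub>L T) = adj T o\<^sub>L adj S"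
  by (rule adj_eqI) (auto simp: cinner_adj_right)

lemma adj_add: "S \<in> bop \<Longrightarrow> T \<in> bop \<Longrightarrow> adj (S + T) = adj S + adj T"
  by (rule adj_eqI) (auto simp: cinner_adj_right blinfun.add_left cinner_add_left cinner_add_right)

lemma adj_diff: "S \<in> bop \<Longrightarrow> T \<in> bop \<Longrightarrow> adj (S - T) = adj S - adj T"
  by (rule adj_eqI) (auto simp: cinner_adj_right blinfun.diff_left cinner_diff_left cinner_diff_right)

lemma adj_op_scale: "T \<in> bop \<Longrightarrow> adj (op_scale c T) = op_scale (cnj c) (adj T)"
  by (rule adj_eqI) (auto simp: cinner_adj_right cinner_scaleC_left cinner_scaleC_right)

lemma adj_scaleR: "T \<in> bop \<Longrightarrow> adj (r *\<^sub>R T) = r *\<^sub>R adj T"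
  unfolding op_scale_of_real [symmetric] by (simp add: adj_op_scale)

lemma adj_id [simp]: "adj id_blinfun = id_blinfun"
  by (rule adj_eqI) auto

lemma adj_zero [simp]: "adj 0 = 0"
  by (rule adj_eqI) auto

lemma norm_sq_adj_compose: "T \<in> bop \<Longrightarrow>
    Re (cinner (blinfun_apply (adj T) (blinfun_apply T x)) x) = (norm (blinfun_apply T x))\<^sup>2"
  by (simp add: cinner_adj_left Re_cinner_self)

text \<open>The relation is the identity of \<open>V\<close>, extended to \<open>T\<close> with
  adjoint \<open>S\<close>. For every \<open>z\<close> the vector \<open>z - S z\<close> is
  orthogonal to \<open>V\<close>, hence killed by \<open>T\<close>, while \<open>T\<close> fixes
  \<open>S z\<close>; thus \<open>T = S\<close>, which gives self-adjointness.\<close>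

lemma projection_onto_closure:
  fixes V :: "'a::chilbert_space set"
  assumes V: "csubspace V"
  obtains P where "P \<in> projections" and "\<And>v. v \<in> closure V \<Longrightarrow> blinfun_apply P v = v"
    and "\<And>z. blinfun_apply P z \<in> closure V"
    and "\<And>z. (\<And>v. v \<in> V \<Longrightarrow> cinner v z = 0) \<Longrightarrow> blinfun_apply P z = 0"
proof -
  let ?G = "(\<lambda>v. (v, v)) ` V"
  obtain T :: "'a \<Rightarrow>\<^sub>L 'a" and S where TS: "T \<in> bop" "S \<in> bop"
    "\<And>x y. cinner (blinfun_apply T x) y = cinner x (blinfun_apply S y)"
    and T: "\<And>x y. (x, y) \<in> ?G \<Longrightarrow> blinfun_apply T x = y"
      "\<And>z. (\<And>x y. (x, y) \<in> ?G \<Longrightarrow> cinner x z = 0) \<Longrightarrow> blinfun_apply T z = 0"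
    and S: "\<And>z. blinfun_apply S z \<in> closure (Domain ?G)"
    by (rule operator_of_relation [of ?G 1]) (use csubspaceD [OF V] in auto)
  have dom: "Domain ?G = V" by force
  have Tcl: "blinfun_apply T v = v" if "v \<in> closure V" for v
  proof -
    obtain f where f: "\<And>n. f n \<in> V" "f \<longlonglongrightarrow> v"
      using \<open>v \<in> closure V\<close> unfolding closure_sequential by auto
    have "(\<lambda>n. blinfun_apply T (f n)) \<longlonglongrightarrow> blinfun_apply T v"
      by (rule blinfun.tendsto [OF tendsto_const f(2)])
    moreover have "blinfun_apply T (f n) = f n" for n using T(1) f(1) by blast
    ultimately show ?thesis using f(2) LIMSEQ_unique by simp
  qed
  have Tperp: "blinfun_apply T z = 0" if "\<And>v. v \<in> V \<Longrightarrow> cinner v z = 0" for z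
    using that by (intro T(2)) auto
  have Scl: "blinfun_apply S z \<in> closure V" for z using S dom by simp
  have eq: "blinfun_apply T z = blinfun_apply S z" for z
  proof -
    have "blinfun_apply T (z - blinfun_apply S z) = 0"
    proof (rule Tperp)
      fix v assume "v \<in> V"
      then have "blinfun_apply T v = v" using T(1) by blast
      then show "cinner v (z - blinfun_apply S z) = 0"
        by (simp add: cinner_diff_right TS(3) [symmetric])
    qed
    then show ?thesis by (simp add: blinfun.diff_right Tcl [OF Scl])
  qed
  then have "T = S" by (intro blinfun_eqI)
  have "T \<in> projections"
    unfolding projections_def
    using TS(1) adj_eqI [OF TS(1,3)] \<open>T = S\<close> Tcl Scl by (auto intro!: blinfun_eqI)
  then show ?thesis
    by (rule that) (use Tcl Tperp Scl eq in auto)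
qed

text \<open>Invariance under \<open>T\<close> gives \<open>P T P = T P\<close>; invariance under
  \<open>adj T\<close> gives, after taking adjoints, \<open>P T P = P T\<close>.\<close>

lemma projection_commutes:
  assumes P: "P \<in> projections" "\<And>v. v \<in> closure V \<Longrightarrow> blinfun_apply P v = v"
    "\<And>z. blinfun_apply P z \<in> closure V"
    and T: "T \<in> bop" "\<And>v. v \<in> V \<Longrightarrow> blinfun_apply T v \<in> V" "\<And>v. v \<in> V \<Longrightarrow> blinfun_apply (adj T) v \<in> V"
  shows "P o\<^sub>L T = T o\<^sub>L P"
proof -
  have cl: "blinfun_apply X v \<in> closure V"
    if "\<And>v. v \<in> V \<Longrightarrow> blinfun_apply X v \<in> V" "v \<in> closure V" for X v
  proof -
    obtain f where f: "\<And>n. f n \<in> V" "f \<longlonglongrightarrow> v"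
      using \<open>v \<in> closure V\<close> unfolding closure_sequential by auto
    show ?thesis unfolding closure_sequential
      by (rule exI [of _ "\<lambda>n. blinfun_apply X (f n)"])
        (simp add: that(1) f(1) blinfun.tendsto [OF tendsto_const f(2)])
  qed
  have 1: "P o\<^sub>L (T o\<^sub>L P) = T o\<^sub>L P"
    by (rule blinfun_eqI) (simp add: P cl [OF T(2)])
  have "P o\<^sub>L (adj T o\<^sub>L P) = adj T o\<^sub>L P"
    by (rule blinfun_eqI) (simp add: P cl [OF T(3)])
  then have "adj (P o\<^sub>L (adj T o\<^sub>L P)) = adj (adj T o\<^sub>L P)" by simp
  then have "P o\<^sub>L (T o\<^sub>L P) = P o\<^sub>L T"
    using P(1) T(1) by (simp add: projections_def adj_compose compose_assoc)
  with 1 show ?thesis by simp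
qed

section \<open>Positivity, the operator order and their description by invertibility\<close>

section \<open>Positive operators\<close>

text \<open>Self-adjointness is part of the definition; it makes the quadratic form real, so
  comparing real parts loses nothing.\<close>

definition positive_op :: "('a::chilbert_space \<Rightarrow>\<^sub>L 'a) \<Rightarrow> bool"
  where "positive_op T \<longleftrightarrow> T \<in> bop \<and> adj T = T \<and> (\<forall>x. 0 \<le> Re (cinner (blinfun_apply T x) x))"

lemma positive_opD:
  assumes "positive_op T"
  shows "T \<in> bop" and "adj T = T" and "0 \<le> Re (cinner (blinfun_apply T x) x)"
  using assms by (auto simp: positive_op_def)

lemma positive_op_zero [simp]: "positive_op 0"
  by (simp add: positive_op_def)

lemma positive_op_add: "positive_op S \<Longrightarrow> positive_op T \<Longrightarrow> positive_op (S + T)"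
  by (simp add: positive_op_def adj_add blinfun.add_left cinner_add_left)

lemma cinner_scaleR_left: "cinner (r *\<^sub>R x) y = complex_of_real r * cinner x y"
  unfolding scaleC_of_real [symmetric] by (rule cinner_scaleC_left)

lemma positive_op_scaleR: "positive_op T \<Longrightarrow> 0 \<le> r \<Longrightarrow> positive_op (r *\<^sub>R T)"
  by (simp add: positive_op_def adj_scaleR blinfun.scaleR_left cinner_scaleR_left)

lemma positive_op_adj_compose: "T \<in> bop \<Longrightarrow> positive_op (adj T o\<^sub>L T)"
  by (simp add: positive_op_def adj_compose norm_sq_adj_compose)

lemma positive_op_cauchy_schwarz:
  assumes T: "positive_op T"
  shows "(cmod (cinner (blinfun_apply T x) y))\<^sup>2
    \<le> Re (cinner (blinfun_apply T y) y) * Re (cinner (blinfun_apply T x) x)"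
proof (rule quadratic_perturbation)
  fix t
  have "cinner (blinfun_apply T y) x = cnj (cinner (blinfun_apply T x) y)"
    using T by (metis cinner_adj_right cinner_commute positive_opD(1,2))
  then have "Re (cinner (blinfun_apply T (y + t *\<^sub>C x)) (y + t *\<^sub>C x))
    = Re (cinner (blinfun_apply T y) y) + 2 * Re (t * cinner (blinfun_apply T x) y)
      + Re (t * cnj t * cinner (blinfun_apply T x) x)"
    by (simp add: blinfun.add_right bopD positive_opD(1) [OF T] cinner_add_left cinner_add_right
        cinner_scaleC_left cinner_scaleC_right algebra_simps)
  moreover have "Re (t * cnj t * cinner (blinfun_apply T x) x)
      = (cmod t)\<^sup>2 * Re (cinner (blinfun_apply T x) x)"
    unfolding complex_norm_square [symmetric] by simp
  ultimately show "- Re (cinner (blinfun_apply T y) y)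
    \<le> 2 * Re (t * cinner (blinfun_apply T x) y) + (cmod t)\<^sup>2 * Re (cinner (blinfun_apply T x) x)"
    using positive_opD(3) [OF T, of "y + t *\<^sub>C x"] by linarith
qed (use positive_opD(3) [OF T] in auto)

text \<open>Cauchy-Schwarz for the form of \<open>T\<close> at \<open>x\<close> and
  \<open>T x\<close> bounds the fourth power of the norm of \<open>T x\<close>; one factor of its
  square cancels. In operator language this is the step from \<open>T \<le> C\<close> to
  \<open>T T \<le> C T\<close>.\<close>

lemma positive_op_norm_bound:
  assumes T: "positive_op T"
    and C: "\<And>x. Re (cinner (blinfun_apply T x) x) \<le> C * (norm x)\<^sup>2"
  shows "(norm (blinfun_apply T x))\<^sup>2 \<le> C * Re (cinner (blinfun_apply T x) x)"
proof (cases "blinfun_apply T x = 0")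
  case False
  let ?y = "blinfun_apply T x"
  have "((norm ?y)\<^sup>2)\<^sup>2 = (cmod (cinner ?y ?y))\<^sup>2"
    by (simp add: cinner_self norm_power)
  also have "\<dots> \<le> Re (cinner (blinfun_apply T ?y) ?y) * Re (cinner ?y x)"
    by (rule positive_op_cauchy_schwarz [OF T])
  also have "\<dots> \<le> C * (norm ?y)\<^sup>2 * Re (cinner ?y x)"
    by (rule mult_right_mono [OF C positive_opD(3) [OF T]])
  finally have "(norm ?y)\<^sup>2 * (norm ?y)\<^sup>2 \<le> (norm ?y)\<^sup>2 * (C * Re (cinner ?y x))"
    by (simp add: power2_eq_square mult_ac)
  then show ?thesis using False by (subst (asm) mult_le_cancel_left_pos) auto
qed simp

lemma positive_op_eq_zero:
  assumes T: "positive_op T" and "Re (cinner (blinfun_apply T x) x) = 0"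
  shows "blinfun_apply T x = 0"
proof -
  have "Re (cinner (blinfun_apply T x) x) \<le> norm T * (norm x)\<^sup>2" for x
    using complex_Re_le_cmod [of "cinner (blinfun_apply T x) x"] cinner_bound [of "blinfun_apply T x" x]
      mult_right_mono [OF norm_blinfun [of T x], of "norm x"]
    by (simp add: power2_eq_square mult_ac)
  from positive_op_norm_bound [OF T this, of x] assms(2) show ?thesis by simp
qed

definition op_le :: "('a::chilbert_space \<Rightarrow>\<^sub>L 'a) \<Rightarrow> ('a \<Rightarrow>\<^sub>L 'a) \<Rightarrow> bool"
  where "op_le S T \<longleftrightarrow> positive_op (T - S)"

lemma op_le_refl [simp]: "op_le T T"
  by (simp add: op_le_def)

lemma op_le_trans: "op_le R S \<Longrightarrow> op_le S T \<Longrightarrow> op_le R T"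
  using positive_op_add [of "S - R" "T - S"] by (simp add: op_le_def)

lemma op_leD: "op_le S T \<Longrightarrow>
    Re (cinner (blinfun_apply S x) x) \<le> Re (cinner (blinfun_apply T x) x)"
  using positive_opD(3) [of "T - S" x] by (simp add: op_le_def blinfun.diff_left cinner_diff_left)

lemma op_le_antisym:
  assumes "op_le S T" "op_le T S"
  shows "S = T"
proof (rule blinfun_eqI)
  fix x
  have "Re (cinner (blinfun_apply (T - S) x) x) = 0"
    using op_leD [OF assms(1), of x] op_leD [OF assms(2), of x]
    by (simp add: blinfun.diff_left cinner_diff_left)
  then have "blinfun_apply (T - S) x = 0"
    using assms(1) positive_op_eq_zero op_le_def by blast
  then show "blinfun_apply S x = blinfun_apply T x" by (simp add: blinfun.diff_left)
qed

lemma contraction_norm_bound: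
  assumes "positive_op T" "op_le T id_blinfun"
  shows "(norm (blinfun_apply T x))\<^sup>2 \<le> Re (cinner (blinfun_apply T x) x)"
    and "norm (blinfun_apply T x) \<le> norm x"
proof -
  have C: "Re (cinner (blinfun_apply T x) x) \<le> 1 * (norm x)\<^sup>2" for x
    using op_leD [OF assms(2), of x] by (simp add: Re_cinner_self)
  show *: "(norm (blinfun_apply T x))\<^sup>2 \<le> Re (cinner (blinfun_apply T x) x)"
    using positive_op_norm_bound [OF assms(1) C] by simp
  from order_trans [OF * C] have "(norm (blinfun_apply T x))\<^sup>2 \<le> (norm x)\<^sup>2" by simp
  then show "norm (blinfun_apply T x) \<le> norm x" by (rule power2_le_imp_le) simp
qed

text \<open>The relation sending \<open>U x\<close> to \<open>x\<close> is bounded by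
  \<open>1 / e\<close> and extends to a left inverse. As \<open>U\<close> is self-adjoint, the
  adjoint of the left inverse is a right inverse, and the two must coincide.\<close>

lemma inverse_of_bounded_below:
  fixes U :: "'a::chilbert_space \<Rightarrow>\<^sub>L 'a"
  assumes U: "U \<in> bop" "adj U = U" and "e > 0"
    and lower: "\<And>x. e * norm x \<le> norm (blinfun_apply U x)"
  obtains S where "S \<in> bop" "S o\<^sub>L U = id_blinfun" "U o\<^sub>L S = id_blinfun"
proof -
  let ?G = "(\<lambda>x. (blinfun_apply U x, x)) ` UNIV"
  obtain S :: "'a \<Rightarrow>\<^sub>L 'a" where S: "S \<in> bop" "\<And>x y. (x, y) \<in> ?G \<Longrightarrow> blinfun_apply S x = y"
  proof (rule operator_of_relation [of ?G "1 / e"])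
    show "(0, 0) \<in> ?G" by (rule image_eqI [of _ _ 0]) (auto simp: blinfun.zero_right)
    show "(x + x', y + y') \<in> ?G" if "(x, y) \<in> ?G" "(x', y') \<in> ?G" for x y x' y'
      using that by (auto simp: blinfun.add_right [symmetric])
    show "(c *\<^sub>C x, c *\<^sub>C y) \<in> ?G" if "(x, y) \<in> ?G" for c x y
      using that by (auto simp: bopD [OF U(1), symmetric])
    show "norm y \<le> 1 / e * norm x" if "(x, y) \<in> ?G" for x y
      using that lower [of y] \<open>e > 0\<close> by (auto simp: field_simps)
  qed (use \<open>e > 0\<close> in auto)
  have 1: "S o\<^sub>L U = id_blinfun"
    by (rule blinfun_eqI) (simp add: S(2))
  then have "adj (S o\<^sub>L U) = id_blinfun" by simp
  then have 2: "U o\<^sub>L adj S = id_blinfun" by (simp add: adj_compose S U)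
  have "S = S o\<^sub>L (U o\<^sub>L adj S)" by (simp add: 2)
  also have "\<dots> = adj S" by (simp add: compose_assoc [symmetric] 1)
  finally show ?thesis using that S(1) 1 2 by metis
qed

text \<open>This makes positivity visible to a map that respects only algebraic operations. If the
  infimum \<open>m\<close> of the Rayleigh quotients were negative, \<open>T - m\<close> would be
  positive and, by assumption, invertible; its form would then be bounded below by a positive
  multiple of the squared norm, pushing the quotients strictly above their infimum.\<close>

lemma positive_op_iff_invertible:
  assumes T: "T \<in> bop" "adj T = T"
  shows "positive_op T \<longleftrightarrow> (\<forall>e>0. \<exists>S\<in>bop. S o\<^sub>L (T + e *\<^sub>R id_blinfun) = id_blinfun \<and>
    (T + e *\<^sub>R id_blinfun) o\<^sub>L S = id_blinfun)" (is "?L \<longleftrightarrow> ?R")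
proof
  assume pos: ?L
  show ?R
  proof (intro allI impI)
    fix e :: real assume "e > 0"
    let ?U = "T + e *\<^sub>R id_blinfun"
    have "e * norm x \<le> norm (blinfun_apply ?U x)" for x
    proof (cases "x = 0")
      case False
      have "e * (norm x)\<^sup>2 \<le> Re (cinner (blinfun_apply ?U x) x)"
        using positive_opD(3) [OF pos, of x]
        by (simp add: blinfun.add_left blinfun.scaleR_left cinner_add_left cinner_scaleR_left Re_cinner_self)
      also have "\<dots> \<le> norm (blinfun_apply ?U x) * norm x"
        using complex_Re_le_cmod cinner_bound order_trans by blast
      finally show ?thesis using False by (simp add: power2_eq_square mult.assoc [symmetric])
    qed simp
    then show "\<exists>S\<in>bop. S o\<^sub>L ?U = id_blinfun \<and> ?U o\<^sub>L S = id_blinfun"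
      by (rule inverse_of_bounded_below [rotated 3]) (use T \<open>e > 0\<close> in \<open>auto simp: adj_add adj_scaleR\<close>)
  qed
next
  assume inv: ?R
  show ?L
  proof (rule ccontr)
    assume "\<not> ?L"
    then obtain x0 where x0: "Re (cinner (blinfun_apply T x0) x0) < 0"
      using T unfolding positive_op_def by (auto simp: not_le)
    define q where "q x = Re (cinner (blinfun_apply T x) x) / (norm x)\<^sup>2" for x
    have nz: "x0 \<noteq> 0" using x0 by (auto simp: blinfun.zero_right)
    have q_lower: "- norm T \<le> q x" if "x \<noteq> 0" for x
    proof -
      have "cmod (cinner (blinfun_apply T x) x) \<le> norm T * (norm x)\<^sup>2"
        using cinner_bound [of "blinfun_apply T x" x]
          mult_right_mono [OF norm_blinfun [of T x], of "norm x"]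
        by (simp add: power2_eq_square mult_ac)
      then have "- norm T * (norm x)\<^sup>2 \<le> Re (cinner (blinfun_apply T x) x)"
        using abs_Re_le_cmod [of "cinner (blinfun_apply T x) x"] by simp
      then show ?thesis using that unfolding q_def by (simp add: le_divide_eq)
    qed
    define m where "m = Inf (q ` (- {0}))"
    have bdd: "bdd_below (q ` (- {0}))" using q_lower by (intro bdd_belowI2) auto
    have m_le: "m \<le> q x" if "x \<noteq> 0" for x
      unfolding m_def using bdd that by (auto intro!: cInf_lower)
    have "q x0 < 0" using x0 nz by (simp add: q_def divide_less_0_iff)
    then have "m < 0" using m_le [OF nz] by simp
    \<comment> \<open>The hypothesis is used at \<open>e = - m\<close> alone.\<close>
    then obtain S where S: "S \<in> bop" "S o\<^sub>L (T + (- m) *\<^sub>R id_blinfun) = id_blinfun"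
      using inv by (metis neg_0_less_iff_less)
    define P where "P = T + (- m) *\<^sub>R id_blinfun"
    have P_form: "Re (cinner (blinfun_apply P x) x) = Re (cinner (blinfun_apply T x) x) - m * (norm x)\<^sup>2" for x
      by (simp add: P_def blinfun.add_left blinfun.diff_left blinfun.scaleR_left
          cinner_add_left cinner_diff_left cinner_scaleR_left Re_cinner_self)
    have P_pos: "positive_op P"
      unfolding positive_op_def
    proof (intro conjI allI)
      show "P \<in> bop" "adj P = P" by (auto simp: P_def T adj_add adj_diff adj_scaleR)
      show "0 \<le> Re (cinner (blinfun_apply P x) x)" for x
      proof (cases "x = 0")
        case False
        then show ?thesis using m_le [OF False] by (simp add: P_form q_def le_divide_eq)
      qed (simp add: blinfun.zero_right)
    qed
    have P_norm: "(norm (blinfun_apply P x))\<^sup>2 \<le> norm P * Re (cinner (blinfun_apply P x) x)" for x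
    proof (rule positive_op_norm_bound [OF P_pos])
      show "Re (cinner (blinfun_apply P x) x) \<le> norm P * (norm x)\<^sup>2" for x
        using complex_Re_le_cmod [of "cinner (blinfun_apply P x) x"] cinner_bound [of "blinfun_apply P x" x]
          mult_right_mono [OF norm_blinfun [of P x], of "norm x"]
        by (simp add: power2_eq_square mult_ac)
    qed
    \<comment> \<open>From \<open>x = S P x\<close> and \<open>P_norm\<close>, the squared norm of
      \<open>x\<close> is at most \<open>(norm S)\<^sup>2 * norm P\<close> times the form of
      \<open>P\<close>; the summand 1 makes the constant positive, so that it can be
      inverted.\<close>
    define C where "C = (norm S)\<^sup>2 * norm P + 1"
    have "C > 0" unfolding C_def by (simp add: add_nonneg_pos)
    have "m + 1 / C \<le> q x" if "x \<noteq> 0" for x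
    proof -
      have "x = blinfun_apply S (blinfun_apply P x)"
        using S(2) unfolding P_def by (metis blinfun_apply_blinfun_compose blinfun_apply_id_blinfun id_apply)
      then have "norm x \<le> norm S * norm (blinfun_apply P x)"
        using norm_blinfun [of S "blinfun_apply P x"] by simp
      then have "(norm x)\<^sup>2 \<le> (norm S)\<^sup>2 * (norm (blinfun_apply P x))\<^sup>2"
        unfolding power_mult_distrib [symmetric] by (rule power_mono) simp
      also have "\<dots> \<le> (norm S)\<^sup>2 * (norm P * Re (cinner (blinfun_apply P x) x))"
        by (rule mult_left_mono [OF P_norm]) simp
      also have "\<dots> \<le> C * Re (cinner (blinfun_apply P x) x)"
        unfolding C_def using positive_opD(3) [OF P_pos, of x] by (simp add: algebra_simps)
      finally have "1 / C * (norm x)\<^sup>2 \<le> Re (cinner (blinfun_apply T x) x) - m * (norm x)\<^sup>2"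
        using \<open>C > 0\<close> by (simp add: P_form field_simps)
      then show ?thesis using that by (simp add: q_def le_divide_eq algebra_simps)
    qed
    then have "m + 1 / C \<le> m"
      unfolding m_def [symmetric] using nz by (subst (2) m_def) (auto intro!: cInf_greatest)
    then show False using \<open>C > 0\<close> by simp
  qed
qed

section \<open>Commutants and their closure under algebraic operations\<close>

section \<open>Commutants\<close>

lemma commutantD:
  assumes "T \<in> commutant D"
  shows "T \<in> bop" and "S \<in> D \<Longrightarrow> T o\<^sub>L S = S o\<^sub>L T"
  using assms by (auto simp: commutant_def)

lemma commutantI: "T \<in> bop \<Longrightarrow> (\<And>S. S \<in> D \<Longrightarrow> T o\<^sub>L S = S o\<^sub>L T) \<Longrightarrow> T \<in> commutant D"
  by (auto simp: commutant_def)

lemma commutant_apply: "T \<in> commutant D \<Longrightarrow> S \<in> D \<Longrightarrow>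
    blinfun_apply T (blinfun_apply S x) = blinfun_apply S (blinfun_apply T x)"
  by (metis commutantD(2) blinfun_apply_blinfun_compose)

lemma commutant_id [simp]: "id_blinfun \<in> commutant D"
  by (simp add: commutant_def)

lemma commutant_zero [simp]: "0 \<in> commutant D"
  by (simp add: commutant_def bounded_bilinear.zero_left [OF bounded_bilinear_blinfun_compose]
      bounded_bilinear.zero_right [OF bounded_bilinear_blinfun_compose])

lemma commutant_add: "S \<in> commutant D \<Longrightarrow> T \<in> commutant D \<Longrightarrow> S + T \<in> commutant D"
  by (simp add: commutant_def compose_add_left compose_add_right)

lemma commutant_diff: "S \<in> commutant D \<Longrightarrow> T \<in> commutant D \<Longrightarrow> S - T \<in> commutant D"
  by (simp add: commutant_def compose_diff_left compose_diff_right)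

lemma commutant_compose: "S \<in> commutant D \<Longrightarrow> T \<in> commutant D \<Longrightarrow> S o\<^sub>L T \<in> commutant D"
  by (simp add: commutant_def) (metis compose_assoc)

lemma commutant_op_scale: "D \<subseteq> bop \<Longrightarrow> T \<in> commutant D \<Longrightarrow> op_scale c T \<in> commutant D"
  by (auto simp: commutant_def op_scale_compose_left op_scale_compose_right)

lemma commutant_scaleR: "D \<subseteq> bop \<Longrightarrow> T \<in> commutant D \<Longrightarrow> r *\<^sub>R T \<in> commutant D"
  unfolding op_scale_of_real [symmetric] by (rule commutant_op_scale)

lemma commutant_adj:
  assumes "D \<subseteq> bop" "adj ` D \<subseteq> D" "T \<in> commutant D"
  shows "adj T \<in> commutant D"
proof (rule commutantI)
  fix S assume "S \<in> D"
  then have S: "S \<in> bop" "adj S \<in> D" using assms by auto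
  have "adj (T o\<^sub>L adj S) = adj (adj S o\<^sub>L T)" using commutantD(2) [OF assms(3) S(2)] by simp
  then show "adj T o\<^sub>L S = S o\<^sub>L adj T"
    using S(1) commutantD(1) [OF assms(3)] by (simp add: adj_compose)
qed (use commutantD(1) [OF assms(3)] in simp)

text \<open>Because of this, the inverses in the criterion for positivity lie in the domain of a map
  given only on the commutant.\<close>

lemma commutant_inverse:
  assumes "T \<in> commutant D" "S \<in> bop" "S o\<^sub>L T = id_blinfun" "T o\<^sub>L S = id_blinfun"
  shows "S \<in> commutant D"
proof (rule commutantI)
  fix X assume "X \<in> D"
  have "S o\<^sub>L X = S o\<^sub>L (X o\<^sub>L (T o\<^sub>L S))" by (simp add: assms)
  also have "\<dots> = S o\<^sub>L ((X o\<^sub>L T) o\<^sub>L S)" by (simp add: compose_assoc)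
  also have "\<dots> = S o\<^sub>L ((T o\<^sub>L X) o\<^sub>L S)" by (simp add: commutantD(2) [OF assms(1) \<open>X \<in> D\<close>])
  also have "\<dots> = (S o\<^sub>L T) o\<^sub>L (X o\<^sub>L S)" by (simp only: compose_assoc)
  finally show "S o\<^sub>L X = X o\<^sub>L S" by (simp add: assms)
qed fact

section \<open>Strong convergence of bounded monotone chains\<close>

section \<open>Suprema of chains\<close>

text \<open>For \<open>S \<le> T\<close> in the chain, \<open>T - S\<close> is a positive
  contraction, so the squared norm of \<open>T x - S x\<close> is at most the increase of the form
  at \<open>x\<close>. The forms approach their supremum, hence the vectors \<open>T x\<close> are
  Cauchy along the chain, and the strong limit inherits positivity, commutation and all bounds on
  forms.\<close>

lemma chain_supremum:
  fixes K :: "('a::chilbert_space \<Rightarrow>\<^sub>L 'a) set"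
  assumes ne: "K \<noteq> {}" and total: "\<And>S T. S \<in> K \<Longrightarrow> T \<in> K \<Longrightarrow> op_le S T \<or> op_le T S"
    and pos: "\<And>T. T \<in> K \<Longrightarrow> positive_op T" and le: "\<And>T. T \<in> K \<Longrightarrow> op_le T id_blinfun"
    and comm: "K \<subseteq> commutant D"
  obtains X where "X \<in> commutant D" and "positive_op X" and "\<And>T. T \<in> K \<Longrightarrow> op_le T X"
    and "\<And>Y. Y \<in> bop \<Longrightarrow> (\<And>T. T \<in> K \<Longrightarrow> op_le T Y) \<Longrightarrow> op_le X Y"
    and "\<And>x c. (\<And>T. T \<in> K \<Longrightarrow> Re (cinner (blinfun_apply T x) x) \<le> c)
      \<Longrightarrow> Re (cinner (blinfun_apply X x) x) \<le> c"
proof -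
  \<comment> \<open>The filter of tails of the chain; totality of the order is what makes the tails
    a filter base.\<close>
  define F where "F = (INF S\<in>K. principal {T \<in> K. op_le S T})"
  have ev: "eventually P F \<longleftrightarrow> (\<exists>S\<in>K. \<forall>T\<in>K. op_le S T \<longrightarrow> P T)" for P
    unfolding F_def
  proof (subst eventually_INF_base)
    fix S T assume ST: "S \<in> K" "T \<in> K"
    show "\<exists>U\<in>K. principal {V \<in> K. op_le U V}
        \<le> inf (principal {V \<in> K. op_le S V}) (principal {V \<in> K. op_le T V})"
      using total [OF ST] ST by (auto intro: op_le_trans)
  qed (auto simp: ne eventually_principal)
  have F: "F \<noteq> bot"
    using ev [of "\<lambda>_. False"] by (auto simp: trivial_limit_def)
  have ev_K: "eventually (\<lambda>T. T \<in> K) F" using ne by (auto simp: ev)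
  have ev_ge: "eventually (op_le S) F" if "S \<in> K" for S using that by (auto simp: ev)
  have diff_bound: "(norm (blinfun_apply T x - blinfun_apply S x))\<^sup>2
      \<le> Re (cinner (blinfun_apply T x) x) - Re (cinner (blinfun_apply S x) x)"
    if "S \<in> K" "T \<in> K" "op_le S T" for S T x
  proof -
    \<comment> \<open>Here \<open>1 - (T - S)\<close> is the sum of the positive operators
      \<open>1 - T\<close> and \<open>S\<close>.\<close>
    have "op_le (T - S) id_blinfun"
      using positive_op_add [OF le [OF that(2), unfolded op_le_def] pos [OF that(1)]]
      by (simp add: op_le_def algebra_simps)
    then show ?thesis
      using contraction_norm_bound(1) [of "T - S" x] that(3)
      by (simp add: op_le_def blinfun.diff_left cinner_diff_left)
  qed
  have "\<exists>l. ((\<lambda>T. blinfun_apply T x) \<longlongrightarrow> l) F" for x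
  proof -
    define q where "q T = Re (cinner (blinfun_apply T x) x)" for T :: "'a \<Rightarrow>\<^sub>L 'a"
    have bdd: "bdd_above (q ` K)"
      using op_leD [OF le, of _ x] unfolding q_def by (intro bdd_aboveI2) auto
    have ex: "\<exists>S\<in>K. \<forall>T\<in>K. op_le S T \<longrightarrow> (norm (blinfun_apply T x - blinfun_apply S x))\<^sup>2 < e" if "e > 0" for e
    proof -
      obtain S where S: "S \<in> K" "Sup (q ` K) - e < q S"
        using less_cSupD [of "q ` K" "Sup (q ` K) - e"] ne \<open>e > 0\<close> by auto
      have "(norm (blinfun_apply T x - blinfun_apply S x))\<^sup>2 < e" if "T \<in> K" "op_le S T" for T
      proof -
        have "q T \<le> Sup (q ` K)" using bdd \<open>T \<in> K\<close> by (simp add: cSup_upper)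
        then show ?thesis using diff_bound [OF S(1) that, of x] S(2) unfolding q_def by linarith
      qed
      then show ?thesis using S(1) by blast
    qed
    have "cauchy_filter (filtermap (\<lambda>T. blinfun_apply T x) F)"
      unfolding cauchy_filter_metric_filtermap
    proof (intro allI impI)
      fix e :: real assume "e > 0"
      obtain S where S: "S \<in> K" "\<And>T. T \<in> K \<Longrightarrow> op_le S T \<Longrightarrow>
          (norm (blinfun_apply T x - blinfun_apply S x))\<^sup>2 < (e/2)\<^sup>2"
        using ex [of "(e/2)\<^sup>2"] \<open>e > 0\<close> by auto
      have near: "norm (blinfun_apply T x - blinfun_apply S x) < e/2" if "T \<in> K" "op_le S T" for T
        by (rule power_less_imp_less_base [OF S(2) [OF that]]) (use \<open>e > 0\<close> in simp)
      show "\<exists>P. eventually P F \<and> (\<forall>T T'. P T \<and> P T' \<longrightarrow> dist (blinfun_apply T x) (blinfun_apply T' x) < e)"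
      proof (intro exI conjI allI impI)
        show "eventually (\<lambda>T. T \<in> K \<and> op_le S T) F" using ev_K ev_ge [OF S(1)] by eventually_elim simp
        fix T T' assume "(T \<in> K \<and> op_le S T) \<and> (T' \<in> K \<and> op_le S T')"
        then show "dist (blinfun_apply T x) (blinfun_apply T' x) < e"
          using near [of T] near [of T'] dist_triangle_half_r [of "blinfun_apply S x" "blinfun_apply T x" e "blinfun_apply T' x"]
          by (simp add: dist_norm norm_minus_commute)
      qed
    qed
    moreover have "filtermap (\<lambda>T. blinfun_apply T x) F \<noteq> bot" using F by (simp add: filtermap_bot_iff)
    moreover have "complete (UNIV :: 'a set)" by (rule complete_UNIV)
    ultimately obtain l where "filtermap (\<lambda>T. blinfun_apply T x) F \<le> nhds l"
      unfolding complete_uniform by fastforce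
    then show ?thesis unfolding filterlim_def by blast
  qed
  then obtain f where f: "\<And>x. ((\<lambda>T. blinfun_apply T x) \<longlongrightarrow> f x) F" by metis
  have norm_le: "norm (f x) \<le> norm x" for x
  proof (rule tendsto_upperbound [OF tendsto_norm [OF f] _ F])
    show "eventually (\<lambda>T. norm (blinfun_apply T x) \<le> norm x) F"
      using ev_K by eventually_elim (rule contraction_norm_bound(2) [OF pos le])
  qed
  have f_add: "f (x + y) = f x + f y" for x y
    using tendsto_unique [OF F f [of "x + y"]] tendsto_add [OF f [of x] f [of y]]
    by (simp add: blinfun.add_right)
  have K_bop: "T \<in> bop" if "T \<in> K" for T using pos [OF that] positive_opD by blast
  have f_scale: "f (c *\<^sub>C x) = c *\<^sub>C f x" for c x
  proof (rule tendsto_unique [OF F f])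
    show "((\<lambda>T. blinfun_apply T (c *\<^sub>C x)) \<longlongrightarrow> c *\<^sub>C f x) F"
      by (rule Lim_transform_eventually [OF tendsto_scaleC [OF f]])
        (use ev_K in eventually_elim, simp add: bopD K_bop)
  qed
  have "bounded_linear f"
  proof (rule bounded_linear_intro [where K = 1])
    show "f (r *\<^sub>R x) = r *\<^sub>R f x" for r x by (metis f_scale scaleC_of_real)
  qed (auto simp: f_add norm_le)
  then obtain X where X: "\<And>x. blinfun_apply X x = f x"
    using bounded_linear_Blinfun_apply by metis
  note limX = f [folded X]
  have X_bop: "X \<in> bop" by (simp add: bop_def X f_scale)
  have X_adj: "adj X = X"
  proof (rule adj_eqI [OF X_bop])
    fix x y
    show "cinner (blinfun_apply X x) y = cinner x (blinfun_apply X y)"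
    proof (rule tendsto_unique [OF F tendsto_cinner [OF limX tendsto_const]])
      show "((\<lambda>T. cinner (blinfun_apply T x) y) \<longlongrightarrow> cinner x (blinfun_apply X y)) F"
        by (rule Lim_transform_eventually [OF tendsto_cinner [OF tendsto_const limX]])
          (use ev_K in eventually_elim, metis pos positive_opD(1,2) cinner_adj_right)
    qed
  qed
  have limq: "((\<lambda>T. Re (cinner (blinfun_apply T x) x)) \<longlongrightarrow> Re (cinner (blinfun_apply X x) x)) F" for x
    by (intro tendsto_Re tendsto_cinner limX tendsto_const)
  show ?thesis
  proof (rule that)
    show "X \<in> commutant D"
    proof (rule commutantI [OF X_bop], rule blinfun_eqI)
      fix S x assume S: "S \<in> D"
      have "((\<lambda>T. blinfun_apply T (blinfun_apply S x)) \<longlongrightarrow> blinfun_apply S (blinfun_apply X x)) F"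
        by (rule Lim_transform_eventually [OF blinfun.tendsto [OF tendsto_const limX]])
          (use ev_K in eventually_elim, use comm commutant_apply [OF _ S] in fastforce)
      from tendsto_unique [OF F limX this]
      show "blinfun_apply (X o\<^sub>L S) x = blinfun_apply (S o\<^sub>L X) x" by simp
    qed
    show upper: "Re (cinner (blinfun_apply X x) x) \<le> c"
      if "\<And>T. T \<in> K \<Longrightarrow> Re (cinner (blinfun_apply T x) x) \<le> c" for x c
      by (rule tendsto_upperbound [OF limq _ F]) (use ev_K in eventually_elim, rule that)
    have lower: "Re (cinner (blinfun_apply T x) x) \<le> Re (cinner (blinfun_apply X x) x)" if "T \<in> K" for T x
      by (rule tendsto_lowerbound [OF limq _ F]) (use ev_ge [OF that] in eventually_elim, rule op_leD)
    show "positive_op X"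
    proof -
      obtain T where "T \<in> K" using ne by blast
      then show ?thesis
        unfolding positive_op_def using X_bop X_adj lower positive_opD(3) [OF pos] order_trans by blast
    qed
    show "op_le T X" if "T \<in> K" for T
      using lower [OF that] positive_opD(1,2) [OF pos [OF that]] X_bop X_adj
      by (simp add: op_le_def positive_op_def adj_diff blinfun.diff_left cinner_diff_left)
    show "op_le X Y" if Y: "Y \<in> bop" "\<And>T. T \<in> K \<Longrightarrow> op_le T Y" for Y
    proof -
      obtain T where T: "T \<in> K" using ne by blast
      \<comment> \<open>Self-adjointness of the competitor \<open>Y\<close> is not among its
        hypotheses; it follows from being above one member of the chain.\<close>
      have "adj (Y - T) = Y - T" using Y(2) [OF T] by (simp add: op_le_def positive_op_def)
      then have "adj Y = Y" using Y(1) positive_opD(1,2) [OF pos [OF T]] by (simp add: adj_diff)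
      moreover have "Re (cinner (blinfun_apply X x) x) \<le> Re (cinner (blinfun_apply Y x) x)" for x
        by (rule upper) (rule op_leD [OF Y(2)])
      ultimately show ?thesis using Y(1) X_bop X_adj
        by (simp add: op_le_def positive_op_def adj_diff blinfun.diff_left cinner_diff_left)
    qed
  qed
qed

section \<open>Order continuity of algebraic isomorphisms and the existence of intertwiners\<close>

section \<open>Intertwiners of isomorphic commutants\<close>

text \<open>Each \<open>z\<close> splits into \<open>P z\<close>, a limit of vectors of
  \<open>V\<close>, and \<open>z - P z\<close>, which is orthogonal to \<open>V\<close>; continuity
  settles the first part.\<close>

lemma blinfun_eq_on_orthogonal_decomposition:
  fixes S T :: "'a::chilbert_space \<Rightarrow>\<^sub>L 'b::chilbert_space"
  assumes V: "csubspace V" and on: "\<And>v. v \<in> V \<Longrightarrow> blinfun_apply S v = blinfun_apply T v"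
    and perp: "\<And>z. (\<And>v. v \<in> V \<Longrightarrow> cinner v z = 0) \<Longrightarrow> blinfun_apply S z = blinfun_apply T z"
  shows "S = T"
proof (rule blinfun_eqI)
  fix z
  obtain P where P: "P \<in> projections" "\<And>v. v \<in> closure V \<Longrightarrow> blinfun_apply P v = v"
    "\<And>z. blinfun_apply P z \<in> closure V"
    by (rule projection_onto_closure [OF V], rule that)
  have "blinfun_apply S (z - blinfun_apply P z) = blinfun_apply T (z - blinfun_apply P z)"
  proof (rule perp)
    fix v assume "v \<in> V"
    then have "blinfun_apply P v = v" using P(2) closure_subset by blast
    moreover have "cinner v (blinfun_apply P z) = cinner (blinfun_apply P v) z"
      using P(1) cinner_adj_right [of P v z] by (simp add: projections_def)
    ultimately show "cinner v (z - blinfun_apply P z) = 0" by (simp add: cinner_diff_right)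
  qed
  moreover have "blinfun_apply S (blinfun_apply P z) = blinfun_apply T (blinfun_apply P z)"
  proof -
    obtain f where f: "\<And>n. f n \<in> V" "f \<longlonglongrightarrow> blinfun_apply P z"
      using P(3) [of z] unfolding closure_sequential by blast
    have "(\<lambda>n. blinfun_apply S (f n)) \<longlonglongrightarrow> blinfun_apply T (blinfun_apply P z)"
      by (simp add: on f(1) blinfun.tendsto [OF tendsto_const f(2)])
    with blinfun.tendsto [OF tendsto_const f(2)] show ?thesis by (rule LIMSEQ_unique)
  qed
  ultimately show "blinfun_apply S z = blinfun_apply T z" by (simp add: blinfun.diff_right)
qed

lemma projection_positive:
  assumes "P \<in> projections"
  shows "positive_op P" and "op_le P id_blinfun"
proof -
  have P: "P \<in> bop" "P o\<^sub>L P = P" "adj P = P" using assms by (auto simp: projections_def)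
  show "positive_op P" using positive_op_adj_compose [OF P(1)] P by simp
  have "adj (id_blinfun - P) o\<^sub>L (id_blinfun - P) = id_blinfun - P"
    using P by (simp add: adj_diff compose_diff_left compose_diff_right)
  then show "op_le P id_blinfun"
    using positive_op_adj_compose [of "id_blinfun - P"] P(1) by (simp add: op_le_def)
qed

lemma op_subspace_commutant: "D \<subseteq> bop \<Longrightarrow> op.subspace (commutant D)"
  by (rule op.subspaceI) (auto intro: commutant_add commutant_op_scale)

lemma csubspace_orbit:
  assumes "op.subspace R"
  shows "csubspace ((\<lambda>T. blinfun_apply T h) ` R)"
  unfolding csubspace_def
proof (intro conjI ballI allI)
  show "0 \<in> (\<lambda>T. blinfun_apply T h) ` R"
    by (rule image_eqI [of _ _ 0]) (auto intro: op.subspace_0 [OF assms])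
next
  fix x c assume "x \<in> (\<lambda>T. blinfun_apply T h) ` R"
  then obtain S where S: "S \<in> R" "x = blinfun_apply S h" by blast
  show "c *\<^sub>C x \<in> (\<lambda>T. blinfun_apply T h) ` R"
    by (rule image_eqI [OF _ op.subspace_scale [OF assms S(1)]]) (simp add: S)
next
  fix x y assume "x \<in> (\<lambda>T. blinfun_apply T h) ` R" "y \<in> (\<lambda>T. blinfun_apply T h) ` R"
  then obtain S T where S: "S \<in> R" "x = blinfun_apply S h" and T: "T \<in> R" "y = blinfun_apply T h" by blast
  show "x + y \<in> (\<lambda>T. blinfun_apply T h) ` R"
    by (rule image_eqI [OF _ op.subspace_add [OF assms S(1) T(1)]]) (simp add: S T blinfun.add_left)
qed

definition intertwiners ::
    "('a::chilbert_space \<Rightarrow>\<^sub>L 'a) set \<Rightarrow> (('a \<Rightarrow>\<^sub>L 'a) \<Rightarrow> ('b::chilbert_space \<Rightarrow>\<^sub>L 'b)) \<Rightarrow> ('a \<Rightarrow>\<^sub>L 'b) set"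
  where "intertwiners R \<theta> = {N \<in> bop. \<forall>X\<in>R. N o\<^sub>L X = \<theta> X o\<^sub>L N}"

text \<open>\<open>D\<close> and \<open>E\<close> stand for the two diagonals. The conditions are
  symmetric, so \<open>inverse_isomorphism\<close> makes every statement of this locale available
  for the inverse map.\<close>

locale commutant_isomorphism =
  fixes D :: "('a::chilbert_space \<Rightarrow>\<^sub>L 'a) set" and E :: "('b::chilbert_space \<Rightarrow>\<^sub>L 'b) set" and \<theta>
  assumes D: "D \<subseteq> bop" "adj ` D \<subseteq> D" and E: "E \<subseteq> bop" "adj ` E \<subseteq> E"
    and iso: "star_isomorphism \<theta> (commutant D) (commutant E)"
begin

lemma image_in: "X \<in> commutant D \<Longrightarrow> \<theta> X \<in> commutant E"
  using iso by (auto simp: star_isomorphism_def bij_betw_def)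

lemma image_bop: "X \<in> commutant D \<Longrightarrow> \<theta> X \<in> bop"
  using image_in commutantD(1) by blast

lemma image_commutant: "commutant E = \<theta> ` commutant D"
  using iso by (simp add: star_isomorphism_def bij_betw_def)

lemma surj: "Y \<in> commutant E \<Longrightarrow> \<exists>X\<in>commutant D. \<theta> X = Y"
  unfolding image_commutant by blast

lemma inj: "inj_on \<theta> (commutant D)"
  using iso by (auto simp: star_isomorphism_def bij_betw_def)

lemma hom_add: "X \<in> commutant D \<Longrightarrow> Y \<in> commutant D \<Longrightarrow> \<theta> (X + Y) = \<theta> X + \<theta> Y"
  and hom_op_scale: "X \<in> commutant D \<Longrightarrow> \<theta> (op_scale c X) = op_scale c (\<theta> X)"
  and hom_compose: "X \<in> commutant D \<Longrightarrow> Y \<in> commutant D \<Longrightarrow> \<theta> (X o\<^sub>L Y) = \<theta> X o\<^sub>L \<theta> Y"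
  and hom_adj: "X \<in> commutant D \<Longrightarrow> \<theta> (adj X) = adj (\<theta> X)"
  using iso by (auto simp: star_isomorphism_def)

lemma hom_diff: "X \<in> commutant D \<Longrightarrow> Y \<in> commutant D \<Longrightarrow> \<theta> (X - Y) = \<theta> X - \<theta> Y"
  using hom_add [of "X - Y" Y] by (simp add: commutant_diff)

lemma hom_scaleR: "X \<in> commutant D \<Longrightarrow> \<theta> (r *\<^sub>R X) = r *\<^sub>R \<theta> X"
  unfolding op_scale_of_real [symmetric] by (rule hom_op_scale)

lemma hom_zero: "\<theta> 0 = 0"
  using hom_diff [of 0 0] by simp

text \<open>A preimage \<open>X\<close> of the identity gives
  \<open>\<theta> 1 = \<theta> 1 \<theta> X = \<theta> X = 1\<close>.\<close>

lemma hom_id: "\<theta> id_blinfun = id_blinfun"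
proof -
  obtain X where X: "X \<in> commutant D" "\<theta> X = id_blinfun" using surj by (metis commutant_id)
  show ?thesis using hom_compose [OF commutant_id X(1)] X(2) by simp
qed

lemma inverse_isomorphism: "commutant_isomorphism E D (inv_into (commutant D) \<theta>)"
proof
  let ?i = "inv_into (commutant D) \<theta>"
  have inv: "?i (\<theta> X) = X" if "X \<in> commutant D" for X
    using inj that by simp
  have bij: "bij_betw ?i (commutant E) (commutant D)"
    using iso by (simp add: star_isomorphism_def bij_betw_inv_into)
  show "star_isomorphism ?i (commutant E) (commutant D)"
    unfolding star_isomorphism_def
  proof (intro conjI bij ballI allI)
    fix Y Z c assume "Y \<in> commutant E" "Z \<in> commutant E"
    then obtain X W where X: "X \<in> commutant D" "Y = \<theta> X" and W: "W \<in> commutant D" "Z = \<theta> W"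
      unfolding image_commutant by blast
    show "?i (Y + Z) = ?i Y + ?i Z"
      using inv [OF commutant_add [OF X(1) W(1)]] by (simp add: X W hom_add inv)
    show "?i (Y o\<^sub>L Z) = ?i Y o\<^sub>L ?i Z"
      using inv [OF commutant_compose [OF X(1) W(1)]] by (simp add: X W hom_compose inv)
  next
    fix Y c assume "Y \<in> commutant E"
    then obtain X where X: "X \<in> commutant D" "Y = \<theta> X"
      unfolding image_commutant by blast
    show "?i (op_scale c Y) = op_scale c (?i Y)"
      using inv [OF commutant_op_scale [OF D(1) X(1)], of c] by (simp add: X hom_op_scale inv)
    show "?i (adj Y) = adj (?i Y)"
      using inv [OF commutant_adj [OF D X(1)]] by (simp add: X hom_adj inv)
  qed
qed (use D E in auto)

lemma positive_image:
  assumes X: "X \<in> commutant D" and pos: "positive_op X"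
  shows "positive_op (\<theta> X)"
proof -
  have adj: "adj (\<theta> X) = \<theta> X"
    using hom_adj [OF X] positive_opD(2) [OF pos] by simp
  have "\<exists>S\<in>bop. S o\<^sub>L (\<theta> X + e *\<^sub>R id_blinfun) = id_blinfun \<and> (\<theta> X + e *\<^sub>R id_blinfun) o\<^sub>L S = id_blinfun"
    if "e > 0" for e
  proof -
    obtain Y where Y: "Y \<in> bop" "Y o\<^sub>L (X + e *\<^sub>R id_blinfun) = id_blinfun"
      "(X + e *\<^sub>R id_blinfun) o\<^sub>L Y = id_blinfun"
      using pos positive_op_iff_invertible [OF positive_opD(1) [OF pos] positive_opD(2) [OF pos]] \<open>e > 0\<close> by blast
    have e: "e *\<^sub>R id_blinfun \<in> commutant D" by (rule commutant_scaleR [OF D(1) commutant_id])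
    have Xe: "X + e *\<^sub>R id_blinfun \<in> commutant D" by (rule commutant_add [OF X e])
    have YD: "Y \<in> commutant D" by (rule commutant_inverse [OF Xe Y])
    have eq: "\<theta> (X + e *\<^sub>R id_blinfun) = \<theta> X + e *\<^sub>R id_blinfun"
      by (simp add: hom_add X e hom_scaleR hom_id)
    have "\<theta> Y o\<^sub>L (\<theta> X + e *\<^sub>R id_blinfun) = id_blinfun"
      using hom_compose [OF YD Xe] by (simp add: Y eq hom_id)
    moreover have "(\<theta> X + e *\<^sub>R id_blinfun) o\<^sub>L \<theta> Y = id_blinfun"
      using hom_compose [OF Xe YD] by (simp add: Y eq hom_id)
    ultimately show ?thesis using image_bop [OF YD] by blast
  qed
  then show ?thesis using positive_op_iff_invertible [OF image_bop [OF X] adj] by blast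
qed

lemma op_le_image:
  assumes "X \<in> commutant D" "Y \<in> commutant D"
  shows "op_le (\<theta> X) (\<theta> Y) \<longleftrightarrow> op_le X Y"
proof
  assume "op_le X Y"
  then show "op_le (\<theta> X) (\<theta> Y)"
    using positive_image [OF commutant_diff [OF assms(2,1)]] assms by (simp add: op_le_def hom_diff)
next
  assume le: "op_le (\<theta> X) (\<theta> Y)"
  interpret inv: commutant_isomorphism E D "inv_into (commutant D) \<theta>"
    by (rule inverse_isomorphism)
  have "\<theta> Y - \<theta> X = \<theta> (Y - X)" using assms by (simp add: hom_diff)
  then show "op_le X Y"
    using le inv.positive_image [of "\<theta> (Y - X)"] image_in [OF commutant_diff [OF assms(2,1)]]
      inv_into_f_f [OF inj commutant_diff [OF assms(2,1)]]
    by (simp add: op_le_def)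
qed

text \<open>The point is that \<open>\<theta> X\<close> is no larger than the strong limit
  \<open>X'\<close> of the image chain. By surjectivity \<open>X' = \<theta> W\<close>; since order
  is reflected, \<open>W\<close> is an upper bound of the chain, so \<open>X \<le> W\<close> and
  \<open>\<theta> X \<le> X'\<close>. Bounds on the forms of the image chain therefore pass to
  \<open>\<theta> X\<close>.\<close>

lemma chain_supremum_image:
  assumes ne: "K \<noteq> {}" and total: "\<And>S T. S \<in> K \<Longrightarrow> T \<in> K \<Longrightarrow> op_le S T \<or> op_le T S"
    and pos: "\<And>T. T \<in> K \<Longrightarrow> positive_op T" and le: "\<And>T. T \<in> K \<Longrightarrow> op_le T id_blinfun"
    and K: "K \<subseteq> commutant D"
  obtains X where "X \<in> commutant D" and "positive_op X" and "\<And>T. T \<in> K \<Longrightarrow> op_le T X"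
    and "\<And>Y. Y \<in> bop \<Longrightarrow> (\<And>T. T \<in> K \<Longrightarrow> op_le T Y) \<Longrightarrow> op_le X Y"
    and "\<And>k c. (\<And>T. T \<in> K \<Longrightarrow> Re (cinner (blinfun_apply (\<theta> T) k) k) \<le> c)
      \<Longrightarrow> Re (cinner (blinfun_apply (\<theta> X) k) k) \<le> c"
proof -
  obtain X where X: "X \<in> commutant D" "positive_op X" "\<And>T. T \<in> K \<Longrightarrow> op_le T X"
    and least: "\<And>Y. Y \<in> bop \<Longrightarrow> (\<And>T. T \<in> K \<Longrightarrow> op_le T Y) \<Longrightarrow> op_le X Y"
    using chain_supremum [OF ne total pos le K] by metis
  have KD: "T \<in> commutant D" if "T \<in> K" for T using K that by blast
  obtain X' where X': "X' \<in> commutant E" "\<And>T. T \<in> \<theta> ` K \<Longrightarrow> op_le T X'"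
    and form: "\<And>k c. (\<And>T. T \<in> \<theta> ` K \<Longrightarrow> Re (cinner (blinfun_apply T k) k) \<le> c)
      \<Longrightarrow> Re (cinner (blinfun_apply X' k) k) \<le> c"
  proof (rule chain_supremum [of "\<theta> ` K" E])
    show "op_le S T \<or> op_le T S" if "S \<in> \<theta> ` K" "T \<in> \<theta> ` K" for S T
      using that total KD op_le_image by fast
    show "positive_op T" if "T \<in> \<theta> ` K" for T using that pos KD positive_image by auto
    show "op_le T id_blinfun" if "T \<in> \<theta> ` K" for T
      using that le KD op_le_image [OF _ commutant_id] by (auto simp: hom_id)
  qed (use ne KD image_in in auto)
  obtain W where W: "W \<in> commutant D" "\<theta> W = X'" using surj X'(1) by blast
  have "op_le T W" if "T \<in> K" for T
    using X'(2) [of "\<theta> T"] that op_le_image [OF KD [OF that] W(1)] W(2) by auto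
  then have "op_le X W" by (rule least [OF commutantD(1) [OF W(1)]])
  then have "op_le (\<theta> X) X'" using op_le_image [OF X(1) W(1)] W(2) by simp
  then have "Re (cinner (blinfun_apply (\<theta> X) k) k) \<le> c"
    if "\<And>T. T \<in> K \<Longrightarrow> Re (cinner (blinfun_apply (\<theta> T) k) k) \<le> c" for k c
    using form [of k c] that op_leD order_trans by blast
  with X least show ?thesis by (rule that)
qed

end

text \<open>\<open>P\<close> projects onto the closure of the orbit of \<open>h\<close> under the
  bicommutant. Operators of \<open>D\<close> leave the orbit invariant, which puts \<open>P\<close>
  into the commutant; an \<open>X\<close> in the commutant that kills \<open>h\<close> kills the
  orbit, because it commutes with the bicommutant.\<close>

lemma support_projection:
  fixes h :: "'a::chilbert_space"
  assumes D: "D \<subseteq> bop" "adj ` D \<subseteq> D"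
  obtains P where "P \<in> projections" "P \<in> commutant D" "blinfun_apply P h = h"
    and "\<And>X. X \<in> commutant D \<Longrightarrow> blinfun_apply X h = 0 \<Longrightarrow> X o\<^sub>L P = 0"
proof -
  define V where "V = (\<lambda>T. blinfun_apply T h) ` commutant (commutant D)"
  have R: "commutant D \<subseteq> bop" "adj ` commutant D \<subseteq> commutant D"
    using commutantD(1) commutant_adj [OF D] by auto
  have V: "csubspace V"
    unfolding V_def by (rule csubspace_orbit [OF op_subspace_commutant [OF R(1)]])
  obtain P where P: "P \<in> projections" "\<And>v. v \<in> closure V \<Longrightarrow> blinfun_apply P v = v"
    "\<And>z. blinfun_apply P z \<in> closure V"
    by (rule projection_onto_closure [OF V], rule that)
  have inv: "blinfun_apply X v \<in> V" if "X \<in> D" "v \<in> V" for X v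
  proof -
    have "X \<in> commutant (commutant D)"
      using \<open>X \<in> D\<close> D(1) by (intro commutantI) (auto simp: commutantD(2) [symmetric])
    moreover obtain T where "T \<in> commutant (commutant D)" "v = blinfun_apply T h"
      using \<open>v \<in> V\<close> unfolding V_def by blast
    ultimately show ?thesis
      unfolding V_def by (intro image_eqI [of _ _ "X o\<^sub>L T"]) (auto intro: commutant_compose)
  qed
  have "h \<in> V" unfolding V_def by (rule image_eqI [of _ _ id_blinfun]) auto
  show ?thesis
  proof (rule that [OF P(1)])
    show "P \<in> commutant D"
    proof (rule commutantI)
      show "P o\<^sub>L X = X o\<^sub>L P" if "X \<in> D" for X
        by (rule projection_commutes [OF P]) (use that D inv in auto)
    qed (use P(1) in \<open>simp add: projections_def\<close>)
    show "blinfun_apply P h = h" using P(2) \<open>h \<in> V\<close> closure_subset by blast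
    show "X o\<^sub>L P = 0" if X: "X \<in> commutant D" "blinfun_apply X h = 0" for X
    proof (rule blinfun_eqI)
      fix z
      have on_V: "blinfun_apply X v = 0" if "v \<in> V" for v
      proof -
        obtain T where T: "T \<in> commutant (commutant D)" "v = blinfun_apply T h"
          using \<open>v \<in> V\<close> unfolding V_def by blast
        have "blinfun_apply X v = blinfun_apply T (blinfun_apply X h)"
          using commutant_apply [OF T(1) X(1)] T(2) by simp
        then show ?thesis by (simp add: X(2) blinfun.zero_right)
      qed
      obtain f where f: "\<And>n. f n \<in> V" "f \<longlonglongrightarrow> blinfun_apply P z"
        using P(3) [of z] unfolding closure_sequential by blast
      have "(\<lambda>n. blinfun_apply X (f n)) \<longlonglongrightarrow> blinfun_apply X (blinfun_apply P z)"
        by (rule blinfun.tendsto [OF tendsto_const f(2)])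
      then show "blinfun_apply (X o\<^sub>L P) z = blinfun_apply 0 z"
        by (simp add: on_V f(1) LIMSEQ_const_iff)
    qed
  qed
qed

context commutant_isomorphism
begin

text \<open>Zorn's lemma takes the place of the spectral theorem: above a maximal operator on which the
  comparison of the two vector states fails, it holds for all positive operators.\<close>

lemma vector_state_comparison:
  assumes "h \<noteq> 0"
  obtains Z k where "Z \<in> commutant D" and "blinfun_apply Z h \<noteq> 0"
    and "\<And>X. X \<in> commutant D \<Longrightarrow> norm (blinfun_apply X (blinfun_apply Z h))
      \<le> norm (blinfun_apply (\<theta> X) (blinfun_apply (\<theta> Z) k))"
proof -
  obtain P where P: "P \<in> projections" "P \<in> commutant D" "blinfun_apply P h = h"
    and supp: "\<And>X. X \<in> commutant D \<Longrightarrow> blinfun_apply X h = 0 \<Longrightarrow> X o\<^sub>L P = 0"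
    by (rule support_projection [OF D, of h], rule that)
  have P2: "P \<in> bop" "P o\<^sub>L P = P" "adj P = P" using P(1) by (auto simp: projections_def)
  have \<theta>P: "\<theta> P o\<^sub>L \<theta> P = \<theta> P" using hom_compose [OF P(2) P(2)] P2 by simp
  have "P \<noteq> 0" using P(3) \<open>h \<noteq> 0\<close> by auto
  then have "\<theta> P \<noteq> 0"
    using inj_onD [OF inj _ P(2) commutant_zero] hom_zero by auto
  then obtain k0 where k0: "blinfun_apply (\<theta> P) k0 \<noteq> 0"
    by (metis blinfun_eqI zero_blinfun.rep_eq)
  \<comment> \<open>Scaling to length \<open>norm h + 1\<close> makes \<open>P\<close> itself
    violate the last condition in \<open>\<A>\<close> below, so that a maximal element of
    \<open>\<A>\<close> cannot be \<open>P\<close>.\<close>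
  define k where "k = ((norm h + 1) / norm (blinfun_apply (\<theta> P) k0)) *\<^sub>R blinfun_apply (\<theta> P) k0"
  have k_norm: "norm k = norm h + 1" using k0 by (simp add: k_def)
  have k_P: "blinfun_apply (\<theta> P) k = k"
    unfolding k_def by (simp add: blinfun.scaleR_right blinfun_apply_blinfun_compose [symmetric] \<theta>P
        del: blinfun_apply_blinfun_compose)
  define \<A> where "\<A> = {X \<in> commutant D. positive_op X \<and> op_le X P \<and>
    Re (cinner (blinfun_apply (\<theta> X) k) k) \<le> Re (cinner (blinfun_apply X h) h)}"
  have po: "partial_order_on \<A> (relation_of op_le \<A>)"
    by (rule partial_order_on_relation_ofI) (auto intro: op_le_trans op_le_antisym)
  have zero: "0 \<in> \<A>"
    using projection_positive(1) [OF P(1)] by (simp add: \<A>_def hom_zero op_le_def)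
  have "\<exists>M\<in>\<A>. \<forall>X\<in>\<A>. op_le M X \<longrightarrow> X = M"
  proof (rule predicate_Zorn [OF po])
    fix C assume C: "C \<in> Chains (relation_of op_le \<A>)"
    have total: "op_le S T \<or> op_le T S" if "S \<in> C" "T \<in> C" for S T
      using C that unfolding Chains_def relation_of_def by blast
    have sub: "C \<subseteq> \<A>" by (rule Chains_relation_of [OF C])
    show "\<exists>u\<in>\<A>. \<forall>a\<in>C. op_le a u"
    proof (cases "C = {}")
      case True
      then show ?thesis using zero by blast
    next
      case False
      have le: "op_le T id_blinfun" if "T \<in> C" for T
        using that sub op_le_trans [OF _ projection_positive(2) [OF P(1)]] by (auto simp: \<A>_def)
      obtain X where X: "X \<in> commutant D" "positive_op X" "\<And>T. T \<in> C \<Longrightarrow> op_le T X"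
        "\<And>Y. Y \<in> bop \<Longrightarrow> (\<And>T. T \<in> C \<Longrightarrow> op_le T Y) \<Longrightarrow> op_le X Y"
        "\<And>k c. (\<And>T. T \<in> C \<Longrightarrow> Re (cinner (blinfun_apply (\<theta> T) k) k) \<le> c)
          \<Longrightarrow> Re (cinner (blinfun_apply (\<theta> X) k) k) \<le> c"
        by (rule chain_supremum_image [OF False total _ le]) (use sub in \<open>auto simp: \<A>_def\<close>)
      have "op_le X P" by (rule X(4) [OF P2(1)]) (use sub in \<open>auto simp: \<A>_def\<close>)
      moreover have "Re (cinner (blinfun_apply (\<theta> X) k) k) \<le> Re (cinner (blinfun_apply X h) h)"
      proof (rule X(5))
        fix T assume "T \<in> C"
        then have "Re (cinner (blinfun_apply (\<theta> T) k) k) \<le> Re (cinner (blinfun_apply T h) h)"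
          using sub by (auto simp: \<A>_def)
        also have "\<dots> \<le> Re (cinner (blinfun_apply X h) h)" by (rule op_leD [OF X(3) [OF \<open>T \<in> C\<close>]])
        finally show "Re (cinner (blinfun_apply (\<theta> T) k) k) \<le> Re (cinner (blinfun_apply X h) h)" .
      qed
      ultimately show ?thesis using X by (auto simp: \<A>_def)
    qed
  qed
  then obtain M where M: "M \<in> commutant D" "positive_op M" "op_le M P"
      "Re (cinner (blinfun_apply (\<theta> M) k) k) \<le> Re (cinner (blinfun_apply M h) h)"
    and max: "\<And>X. X \<in> \<A> \<Longrightarrow> op_le M X \<Longrightarrow> X = M"
    unfolding \<A>_def by blast
  define Z where "Z = P - M"
  have Z: "Z \<in> commutant D" "positive_op Z" "op_le Z P"
    using M P(2) by (auto simp: Z_def op_le_def commutant_diff)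
  have Z_id: "op_le Z id_blinfun" by (rule op_le_trans [OF Z(3) projection_positive(2) [OF P(1)]])
  have "Z \<noteq> 0"
  proof
    assume "Z = 0"
    then have "M = P" by (simp add: Z_def)
    then have "(norm h + 1)\<^sup>2 \<le> (norm h)\<^sup>2"
      using M(4) by (simp add: P(3) k_P Re_cinner_self k_norm)
    then have "norm h + 1 \<le> norm h" by (rule power2_le_imp_le) simp
    then show False by simp
  qed
  \<comment> \<open>If \<open>Z\<close> killed \<open>h\<close>, the support property would give
    \<open>Z P = 0\<close>; as \<open>0 \<le> Z \<le> P\<close>, \<open>Z\<close> also vanishes on
    the kernel of \<open>P\<close>, so \<open>Z\<close> would be 0.\<close>
  have Zh: "blinfun_apply Z h \<noteq> 0"
  proof
    assume "blinfun_apply Z h = 0"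
    then have ZP: "Z o\<^sub>L P = 0" by (rule supp [OF Z(1)])
    have "blinfun_apply Z x = 0" for x
    proof -
      let ?w = "x - blinfun_apply P x"
      have "blinfun_apply P ?w = 0"
        by (metis P2(2) blinfun.diff_right blinfun_apply_blinfun_compose right_minus_eq)
      then have "Re (cinner (blinfun_apply Z ?w) ?w) \<le> 0" using op_leD [OF Z(3), of ?w] by simp
      then have "blinfun_apply Z ?w = 0"
        using positive_op_eq_zero [OF Z(2)] positive_opD(3) [OF Z(2), of ?w] by (simp add: order_antisym)
      moreover have "blinfun_apply Z (blinfun_apply P x) = 0"
        by (metis ZP blinfun_apply_blinfun_compose zero_blinfun.rep_eq)
      ultimately show ?thesis by (simp add: blinfun.diff_right)
    qed
    then have "Z = 0" by (intro blinfun_eqI) simp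
    with \<open>Z \<noteq> 0\<close> show False by simp
  qed
  have "norm (blinfun_apply X (blinfun_apply Z h)) \<le> norm (blinfun_apply (\<theta> X) (blinfun_apply (\<theta> Z) k))"
    if X: "X \<in> commutant D" for X
  proof -
    \<comment> \<open>The scale makes \<open>Y\<close>, the multiple by \<open>c\<close> of the
      square of \<open>X Z\<close>, satisfy \<open>Y \<le> Z Z \<le> Z\<close>, and hence
      \<open>M + Y \<le> P\<close>.\<close>
    define c where "c = 1 / ((norm X)\<^sup>2 + 1)"
    have c: "c > 0" "c * (norm X)\<^sup>2 \<le> 1"
      unfolding c_def by (auto simp: add_nonneg_pos divide_le_eq)
    let ?XZ = "X o\<^sub>L Z"
    have XZ: "?XZ \<in> commutant D" "?XZ \<in> bop"
      using commutant_compose [OF X Z(1)] commutantD(1) by auto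
    define Y where "Y = c *\<^sub>R (adj ?XZ o\<^sub>L ?XZ)"
    have XXD: "adj ?XZ o\<^sub>L ?XZ \<in> commutant D" by (rule commutant_compose [OF commutant_adj [OF D XZ(1)] XZ(1)])
    have YD: "Y \<in> commutant D" unfolding Y_def by (rule commutant_scaleR [OF D(1) XXD])
    have Y_pos: "positive_op Y"
      unfolding Y_def using c(1) by (simp add: positive_op_scaleR positive_op_adj_compose XZ)
    have Y_form: "Re (cinner (blinfun_apply Y v) v) = c * (norm (blinfun_apply X (blinfun_apply Z v)))\<^sup>2" for v
      using norm_sq_adj_compose [OF XZ(2), of v]
      by (simp add: Y_def blinfun.scaleR_left cinner_scaleR_left)
    have \<theta>Y: "\<theta> Y = c *\<^sub>R (adj (\<theta> ?XZ) o\<^sub>L \<theta> ?XZ)"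
      unfolding Y_def by (simp add: hom_scaleR [OF XXD] hom_compose [OF commutant_adj [OF D XZ(1)] XZ(1)]
          hom_adj [OF XZ(1)])
    have \<theta>Y_form: "Re (cinner (blinfun_apply (\<theta> Y) k) k)
        = c * (norm (blinfun_apply (\<theta> X) (blinfun_apply (\<theta> Z) k)))\<^sup>2"
      using norm_sq_adj_compose [OF image_bop [OF XZ(1)], of k]
      by (simp add: \<theta>Y blinfun.scaleR_left cinner_scaleR_left hom_compose [OF X Z(1)])
    have YZ: "op_le Y Z"
      unfolding op_le_def positive_op_def
    proof (intro conjI allI)
      show "Z - Y \<in> bop" "adj (Z - Y) = Z - Y"
        using positive_opD(1,2) [OF Y_pos] positive_opD(1,2) [OF Z(2)] by (simp_all add: adj_diff)
      fix v
      have "(norm (blinfun_apply X (blinfun_apply Z v)))\<^sup>2 \<le> (norm X)\<^sup>2 * (norm (blinfun_apply Z v))\<^sup>2"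
        unfolding power_mult_distrib [symmetric] by (rule power_mono [OF norm_blinfun]) simp
      then have "c * (norm (blinfun_apply X (blinfun_apply Z v)))\<^sup>2
          \<le> c * (norm X)\<^sup>2 * (norm (blinfun_apply Z v))\<^sup>2"
        using c(1) by simp
      also have "\<dots> \<le> 1 * (norm (blinfun_apply Z v))\<^sup>2"
        by (rule mult_right_mono [OF c(2)]) simp
      also have "\<dots> \<le> Re (cinner (blinfun_apply Z v) v)"
        using contraction_norm_bound(1) [OF Z(2) Z_id] by simp
      finally show "0 \<le> Re (cinner (blinfun_apply (Z - Y) v) v)"
        by (simp add: blinfun.diff_left cinner_diff_left Y_form)
    qed
    have "Re (cinner (blinfun_apply Y h) h) \<le> Re (cinner (blinfun_apply (\<theta> Y) k) k)"
    proof (rule ccontr)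
      assume less: "\<not> ?thesis"
      \<comment> \<open>A failure of the comparison at \<open>Y\<close> adds to the inequality
        defining membership of \<open>M\<close>, so \<open>M + Y\<close> is admissible; maximality
        then gives \<open>Y = 0\<close>, where the comparison cannot fail.\<close>
      have "M + Y \<in> \<A>"
        using M YD Y_pos YZ less
        by (simp add: \<A>_def commutant_add positive_op_add op_le_def Z_def hom_add blinfun.add_left
            cinner_add_left diff_diff_eq)
      moreover have "op_le M (M + Y)" using Y_pos by (simp add: op_le_def)
      ultimately have "Y = 0" using max by fastforce
      then show False using less by (simp add: hom_zero)
    qed
    then have "(norm (blinfun_apply X (blinfun_apply Z h)))\<^sup>2
        \<le> (norm (blinfun_apply (\<theta> X) (blinfun_apply (\<theta> Z) k)))\<^sup>2"
      using c(1) by (simp add: Y_form \<theta>Y_form)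
    then show ?thesis by (rule power2_le_imp_le) simp
  qed
  with Z(1) Zh show ?thesis by (rule that)
qed

lemma intertwiners_separating:
  assumes "h \<noteq> 0"
  shows "\<exists>N\<in>intertwiners (commutant D) \<theta>. blinfun_apply N h \<noteq> 0"
proof -
  obtain Z k0 where Z: "Z \<in> commutant D" "blinfun_apply Z h \<noteq> 0"
    and bound: "\<And>X. X \<in> commutant D \<Longrightarrow> norm (blinfun_apply X (blinfun_apply Z h))
      \<le> norm (blinfun_apply (\<theta> X) (blinfun_apply (\<theta> Z) k0))"
    using vector_state_comparison [OF assms] by metis
  define g where "g = blinfun_apply Z h"
  define k where "k = blinfun_apply (\<theta> Z) k0"
  \<comment> \<open>The comparison of vector states says exactly that this relation is contractive;
    in particular it is single valued.\<close>
  let ?G = "(\<lambda>X. (blinfun_apply (\<theta> X) k, blinfun_apply X g)) ` commutant D"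
  have G_add: "(x + x', y + y') \<in> ?G" if "(x, y) \<in> ?G" "(x', y') \<in> ?G" for x y x' y'
  proof -
    obtain X X' where "X \<in> commutant D" "x = blinfun_apply (\<theta> X) k" "y = blinfun_apply X g"
      "X' \<in> commutant D" "x' = blinfun_apply (\<theta> X') k" "y' = blinfun_apply X' g"
      using \<open>(x, y) \<in> ?G\<close> \<open>(x', y') \<in> ?G\<close> by blast
    then show ?thesis
      by (intro image_eqI [of _ _ "X + X'"]) (auto simp: hom_add blinfun.add_left commutant_add)
  qed
  have G_scale: "(c *\<^sub>C x, c *\<^sub>C y) \<in> ?G" if "(x, y) \<in> ?G" for c x y
  proof -
    obtain X where "X \<in> commutant D" "x = blinfun_apply (\<theta> X) k" "y = blinfun_apply X g"
      using \<open>(x, y) \<in> ?G\<close> by blast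
    then show ?thesis
      by (intro image_eqI [of _ _ "op_scale c X"]) (auto simp: hom_op_scale commutant_op_scale [OF D(1)])
  qed
  have G_zero: "(0, 0) \<in> ?G" by (rule image_eqI [of _ _ 0]) (auto simp: hom_zero)
  obtain T :: "'b \<Rightarrow>\<^sub>L 'a" where T: "T \<in> bop" "\<And>x y. (x, y) \<in> ?G \<Longrightarrow> blinfun_apply T x = y"
    "\<And>z. (\<And>x y. (x, y) \<in> ?G \<Longrightarrow> cinner x z = 0) \<Longrightarrow> blinfun_apply T z = 0"
    by (rule operator_of_relation [of ?G 1])
      (use G_add G_scale G_zero bound in \<open>auto simp: g_def k_def\<close>)
  have T_on: "blinfun_apply T (blinfun_apply (\<theta> X) k) = blinfun_apply X g" if "X \<in> commutant D" for X
    using T(2) that by blast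
  have T_perp: "blinfun_apply T z = 0"
    if "\<And>X. X \<in> commutant D \<Longrightarrow> cinner (blinfun_apply (\<theta> X) k) z = 0" for z
    using that by (intro T(3)) blast
  have V: "csubspace ((\<lambda>X. blinfun_apply (\<theta> X) k) ` commutant D)"
    using csubspace_orbit [OF op_subspace_commutant [OF E(1)], of k]
    by (simp add: image_commutant image_image)
  have T_inter: "T o\<^sub>L \<theta> X = X o\<^sub>L T" if X: "X \<in> commutant D" for X
  proof (rule blinfun_eq_on_orthogonal_decomposition [OF V])
    fix v assume "v \<in> (\<lambda>X. blinfun_apply (\<theta> X) k) ` commutant D"
    then obtain Y where Y: "Y \<in> commutant D" "v = blinfun_apply (\<theta> Y) k" by blast
    have "blinfun_apply (\<theta> X) v = blinfun_apply (\<theta> (X o\<^sub>L Y)) k" by (simp add: hom_compose X Y)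
    then show "blinfun_apply (T o\<^sub>L \<theta> X) v = blinfun_apply (X o\<^sub>L T) v"
      using T_on [OF commutant_compose [OF X Y(1)]] T_on [OF Y(1)] Y(2) by simp
  next
    \<comment> \<open>The image of the commutant is closed under adjoints, so
      \<open>\<theta> X\<close> preserves the orthogonal complement of the orbit of
      \<open>k\<close>, and \<open>T\<close> vanishes there.\<close>
    fix z assume z: "\<And>v. v \<in> (\<lambda>X. blinfun_apply (\<theta> X) k) ` commutant D \<Longrightarrow> cinner v z = 0"
    have "cinner (blinfun_apply (\<theta> Y) k) (blinfun_apply (\<theta> X) z) = 0" if Y: "Y \<in> commutant D" for Y
    proof -
      have "cinner (blinfun_apply (\<theta> Y) k) (blinfun_apply (\<theta> X) z)
          = cinner (blinfun_apply (\<theta> (adj X o\<^sub>L Y)) k) z"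
        using cinner_adj_left [OF image_bop [OF X]]
        by (simp add: hom_compose [OF commutant_adj [OF D X] Y] hom_adj [OF X])
      then show ?thesis using z commutant_compose [OF commutant_adj [OF D X] Y] by simp
    qed
    then have "blinfun_apply T (blinfun_apply (\<theta> X) z) = 0" by (rule T_perp)
    moreover have "blinfun_apply T z = 0" by (rule T_perp) (use z in blast)
    ultimately show "blinfun_apply (T o\<^sub>L \<theta> X) z = blinfun_apply (X o\<^sub>L T) z"
      by (simp add: blinfun.zero_right)
  qed
  have N: "adj T \<in> intertwiners (commutant D) \<theta>"
    unfolding intertwiners_def
  proof (intro CollectI conjI ballI)
    fix X assume X: "X \<in> commutant D"
    have "adj (T o\<^sub>L \<theta> (adj X)) = adj (adj X o\<^sub>L T)" by (simp add: T_inter commutant_adj [OF D X])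
    then show "adj T o\<^sub>L X = \<theta> X o\<^sub>L adj T"
      using X T(1) commutantD(1) [OF X] image_bop [OF X] by (simp add: hom_adj adj_compose)
  qed (simp add: T(1))
  \<comment> \<open>\<open>T k = g\<close> shows that \<open>adj T\<close> does not kill
    \<open>g = Z h\<close>; moving \<open>Z\<close> through the intertwiner shows that it does not
    kill \<open>h\<close> either.\<close>
  have "cinner (blinfun_apply (adj T) g) k = cinner g g"
    using T_on [OF commutant_id] by (simp add: cinner_adj_left T(1) hom_id)
  then have "blinfun_apply (adj T) g \<noteq> 0" using Z(2) by (auto simp: g_def cinner_self)
  moreover have "blinfun_apply (adj T) g = blinfun_apply (\<theta> Z) (blinfun_apply (adj T) h)"
    unfolding g_def blinfun_apply_blinfun_compose [symmetric] using N Z(1) by (simp add: intertwiners_def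
        del: blinfun_apply_blinfun_compose)
  ultimately have "blinfun_apply (adj T) h \<noteq> 0" by (auto simp: blinfun.zero_right)
  with N show ?thesis by blast
qed

end

section \<open>The Hilbert space of square summable sequences and amplified operators\<close>

section \<open>Square summable sequences\<close>

lemma square_summable_add:
  fixes x y :: "nat \<Rightarrow> 'a::real_normed_vector"
  assumes "square_summable x" "square_summable y"
  shows "square_summable (\<lambda>n. x n + y n)"
  unfolding square_summable_def
proof (rule summable_comparison_test')
  show "summable (\<lambda>n. 2 * (norm (x n))\<^sup>2 + 2 * (norm (y n))\<^sup>2)"
    using assms unfolding square_summable_def by (intro summable_add summable_mult)
  show "norm ((norm (x n + y n))\<^sup>2) \<le> 2 * (norm (x n))\<^sup>2 + 2 * (norm (y n))\<^sup>2" if "n \<ge> 0" for n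
  proof -
    have "(norm (x n + y n))\<^sup>2 \<le> (norm (x n) + norm (y n))\<^sup>2"
      by (rule power_mono [OF norm_triangle_ineq]) simp
    also have "\<dots> \<le> 2 * (norm (x n))\<^sup>2 + 2 * (norm (y n))\<^sup>2"
      using sum_squares_bound [of "norm (x n)" "norm (y n)"] by (simp add: power2_sum)
    finally show ?thesis by simp
  qed
qed

lemma square_summable_bounded:
  assumes "square_summable x" and "\<And>n. norm (y n) \<le> c * norm (x n)"
  shows "square_summable y"
  unfolding square_summable_def
proof (rule summable_comparison_test')
  show "summable (\<lambda>n. c\<^sup>2 * (norm (x n))\<^sup>2)"
    using assms unfolding square_summable_def by (intro summable_mult)
  show "norm ((norm (y n))\<^sup>2) \<le> c\<^sup>2 * (norm (x n))\<^sup>2" if "n \<ge> 0" for n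
    using power_mono [OF assms(2), of n 2] by (simp add: power_mult_distrib)
qed

lemma square_summable_zero: "square_summable (\<lambda>n. 0)"
  by (simp add: square_summable_def)

lemma square_summable_scaleC: "square_summable x \<Longrightarrow> square_summable (\<lambda>n. c *\<^sub>C x n)"
  by (rule square_summable_bounded) (auto simp: norm_scaleC)

lemma square_summable_scaleR: "square_summable x \<Longrightarrow> square_summable (\<lambda>n. r *\<^sub>R x n)"
  by (rule square_summable_bounded) auto

lemma square_summable_blinfun: "square_summable x \<Longrightarrow> square_summable (\<lambda>n. blinfun_apply T (x n))"
  by (rule square_summable_bounded [OF _ norm_blinfun])

lemma square_summable_minus: "square_summable x \<Longrightarrow> square_summable (\<lambda>n. - x n)"
  by (simp add: square_summable_def)

lemma square_summable_diff:
  "square_summable x \<Longrightarrow> square_summable y \<Longrightarrow> square_summable (\<lambda>n. x n - y n)"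
  using square_summable_add [OF _ square_summable_minus, of x y] by simp

lemma summable_cinner:
  assumes "square_summable x" "square_summable y"
  shows "summable (\<lambda>n. cinner (x n) (y n))"
proof (rule summable_comparison_test')
  show "summable (\<lambda>n. (norm (x n))\<^sup>2 + (norm (y n))\<^sup>2)"
    using assms unfolding square_summable_def by (intro summable_add)
  show "norm (cinner (x n) (y n)) \<le> (norm (x n))\<^sup>2 + (norm (y n))\<^sup>2" if "n \<ge> 0" for n
  proof -
    have "0 \<le> norm (x n) * norm (y n)" by simp
    then show ?thesis
      using cinner_bound [of "x n" "y n"] sum_squares_bound [of "norm (x n)" "norm (y n)"] by linarith
  qed
qed

text \<open>Minkowski's inequality for partial sums, with a bound that does not depend on their
  length.\<close>

lemma sqrt_suminf_triangle:
  fixes x y :: "nat \<Rightarrow> 'a::real_normed_vector"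
  assumes x: "square_summable x" and y: "square_summable y"
  shows "sqrt (\<Sum>n. (norm (x n + y n))\<^sup>2) \<le> sqrt (\<Sum>n. (norm (x n))\<^sup>2) + sqrt (\<Sum>n. (norm (y n))\<^sup>2)"
    (is "_ \<le> ?c")
proof -
  have part: "L2_set (\<lambda>n. norm (z n)) {..<N} \<le> sqrt (\<Sum>n. (norm (z n))\<^sup>2)"
    if "square_summable z" for z :: "nat \<Rightarrow> 'a" and N
    using that sum_le_suminf [of "\<lambda>n. (norm (z n))\<^sup>2" "{..<N}"]
    by (simp add: L2_set_def square_summable_def)
  have c0: "?c \<ge> 0"
    using x y by (intro add_nonneg_nonneg real_sqrt_ge_zero suminf_nonneg) (auto simp: square_summable_def)
  have "(\<Sum>n<N. (norm (x n + y n))\<^sup>2) \<le> ?c\<^sup>2" for N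
  proof -
    have "L2_set (\<lambda>n. norm (x n + y n)) {..<N} \<le> L2_set (\<lambda>n. norm (x n) + norm (y n)) {..<N}"
      by (rule L2_set_mono) (auto intro: norm_triangle_ineq)
    also have "\<dots> \<le> L2_set (\<lambda>n. norm (x n)) {..<N} + L2_set (\<lambda>n. norm (y n)) {..<N}"
      by (rule L2_set_triangle_ineq)
    also have "\<dots> \<le> ?c" by (intro add_mono part x y)
    finally have "(L2_set (\<lambda>n. norm (x n + y n)) {..<N})\<^sup>2 \<le> ?c\<^sup>2"
      by (rule power_mono) (rule L2_set_nonneg)
    then show ?thesis by (simp add: L2_set_def sum_nonneg)
  qed
  then have "(\<Sum>n. (norm (x n + y n))\<^sup>2) \<le> ?c\<^sup>2"
    using square_summable_add [OF x y] by (intro suminf_le_const) (auto simp: square_summable_def)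
  then show ?thesis using c0 by (rule real_le_lsqrt [rotated -1]) 
qed

text \<open>The Hilbert sum of countably many copies of one space. Being a type of class
  \<open>chilbert_space\<close>, it admits the whole operator theory above, and the construction can
  be iterated.\<close>

typedef (overloaded) 'a l2 = "{x :: nat \<Rightarrow> 'a::chilbert_space. square_summable x}"
  morphisms l2_seq to_l2
  by (rule exI [of _ "\<lambda>n. 0"]) (simp add: square_summable_zero)

setup_lifting type_definition_l2

lemma square_summable_l2_seq [simp]: "square_summable (l2_seq x)"
  using l2_seq by simp

instantiation l2 :: (chilbert_space) real_normed_vector
begin

lift_definition zero_l2 :: "'a l2" is "\<lambda>n. 0" by (rule square_summable_zero)
lift_definition plus_l2 :: "'a l2 \<Rightarrow> 'a l2 \<Rightarrow> 'a l2" is "\<lambda>x y n. x n + y n"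
  by (rule square_summable_add)
lift_definition uminus_l2 :: "'a l2 \<Rightarrow> 'a l2" is "\<lambda>x n. - x n" by (rule square_summable_minus)
lift_definition minus_l2 :: "'a l2 \<Rightarrow> 'a l2 \<Rightarrow> 'a l2" is "\<lambda>x y n. x n - y n"
  by (rule square_summable_diff)
lift_definition scaleR_l2 :: "real \<Rightarrow> 'a l2 \<Rightarrow> 'a l2" is "\<lambda>r x n. r *\<^sub>R x n"
  by (rule square_summable_scaleR)
lift_definition norm_l2 :: "'a l2 \<Rightarrow> real" is "\<lambda>x. sqrt (\<Sum>n. (norm (x n))\<^sup>2)" .
definition dist_l2 :: "'a l2 \<Rightarrow> 'a l2 \<Rightarrow> real" where "dist_l2 x y = norm (x - y)"
definition sgn_l2 :: "'a l2 \<Rightarrow> 'a l2" where "sgn_l2 x = inverse (norm x) *\<^sub>R x"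
definition uniformity_l2 :: "('a l2 \<times> 'a l2) filter"
  where "uniformity_l2 = (INF e\<in>{0<..}. principal {(x, y). dist x y < e})"
definition open_l2 :: "'a l2 set \<Rightarrow> bool"
  where "open_l2 U = (\<forall>x\<in>U. \<forall>\<^sub>F (x', y) in uniformity. x' = x \<longrightarrow> y \<in> U)"

instance
proof
  fix a b c :: "'a l2" and r s :: real and U :: "'a l2 set"
  show "a + b + c = a + (b + c)" by transfer (simp add: add.assoc)
  show "a + b = b + a" by transfer (simp add: add.commute)
  show "0 + a = a" by transfer simp
  show "- a + a = 0" by transfer simp
  show "a - b = a + - b" by transfer simp
  show "r *\<^sub>R (a + b) = r *\<^sub>R a + r *\<^sub>R b" by transfer (simp add: scaleR_add_right)
  show "(r + s) *\<^sub>R a = r *\<^sub>R a + s *\<^sub>R a" by transfer (simp add: scaleR_add_left)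
  show "r *\<^sub>R s *\<^sub>R a = (r * s) *\<^sub>R a" by transfer simp
  show "1 *\<^sub>R a = a" by transfer simp
  show "dist a b = norm (a - b)" by (simp add: dist_l2_def)
  show "sgn a = inverse (norm a) *\<^sub>R a" by (simp add: sgn_l2_def)
  show "uniformity = (INF e\<in>{0<..}. principal {(x :: 'a l2, y). dist x y < e})"
    by (simp add: uniformity_l2_def)
  show "open U = (\<forall>x\<in>U. \<forall>\<^sub>F (x', y) in uniformity. x' = x \<longrightarrow> y \<in> U)"
    by (simp add: open_l2_def)
  show "norm (a + b) \<le> norm a + norm b" by transfer (rule sqrt_suminf_triangle)
  show "(norm a = 0) = (a = 0)"
    by transfer (auto simp: square_summable_def suminf_eq_zero_iff)
  show "norm (r *\<^sub>R a) = \<bar>r\<bar> * norm a"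
    by transfer (simp add: power_mult_distrib square_summable_def suminf_mult real_sqrt_mult)
qed

end

lemma l2_eqI: "(\<And>n. l2_seq x n = l2_seq y n) \<Longrightarrow> x = y"
  by (metis l2_seq_inject ext)

lemma norm_l2_square: "(norm x)\<^sup>2 = (\<Sum>n. (norm (l2_seq x n))\<^sup>2)"
  using square_summable_l2_seq [of x]
  by (simp add: norm_l2.rep_eq square_summable_def suminf_nonneg)

lemma sum_norm_l2_seq_le: "(\<Sum>n<N. (norm (l2_seq x n))\<^sup>2) \<le> (norm x)\<^sup>2"
  unfolding norm_l2_square using square_summable_l2_seq [of x]
  by (intro sum_le_suminf) (auto simp: square_summable_def)

lemma norm_l2_seq_le: "norm (l2_seq x n) \<le> norm x"
proof (rule power2_le_imp_le)
  have "(norm (l2_seq x n))\<^sup>2 \<le> (\<Sum>n<Suc n. (norm (l2_seq x n))\<^sup>2)"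
    by (rule member_le_sum) auto
  also have "\<dots> \<le> (norm x)\<^sup>2" by (rule sum_norm_l2_seq_le)
  finally show "(norm (l2_seq x n))\<^sup>2 \<le> (norm x)\<^sup>2" .
qed simp

instantiation l2 :: (chilbert_space) chilbert_space
begin

lift_definition scaleC_l2 :: "complex \<Rightarrow> 'a l2 \<Rightarrow> 'a l2" is "\<lambda>c x n. c *\<^sub>C x n"
  by (rule square_summable_scaleC)
lift_definition cinner_l2 :: "'a l2 \<Rightarrow> 'a l2 \<Rightarrow> complex" is "\<lambda>x y. \<Sum>n. cinner (x n) (y n)" .

instance
proof
  fix a b c :: "'a l2" and r :: real and z w :: complex
  show "z *\<^sub>C (a + b) = z *\<^sub>C a + z *\<^sub>C b" by transfer (simp add: scaleC_add_right)
  show "(z + w) *\<^sub>C a = z *\<^sub>C a + w *\<^sub>C a" by transfer (simp add: scaleC_add_left)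
  show "z *\<^sub>C w *\<^sub>C a = (z * w) *\<^sub>C a" by transfer (simp add: scaleC_scaleC)
  show "complex_of_real r *\<^sub>C a = r *\<^sub>R a" by transfer (simp add: scaleC_of_real)
  show "cinner a b = cnj (cinner b a)"
  proof transfer
    fix a b :: "nat \<Rightarrow> 'a" assume "square_summable a" "square_summable b"
    then have "(\<lambda>n. cinner (b n) (a n)) sums (\<Sum>n. cinner (b n) (a n))"
      by (intro summable_sums summable_cinner)
    then have "(\<lambda>n. cnj (cinner (b n) (a n))) sums cnj (\<Sum>n. cinner (b n) (a n))"
      by (simp add: sums_cnj)
    then have "(\<lambda>n. cinner (a n) (b n)) sums cnj (\<Sum>n. cinner (b n) (a n))"
      by (simp add: cinner_commute [symmetric])
    then show "(\<Sum>n. cinner (a n) (b n)) = cnj (\<Sum>n. cinner (b n) (a n))"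
      by (rule sums_unique [symmetric])
  qed
  show "cinner (a + b) c = cinner a c + cinner b c"
    by transfer (simp add: cinner_add_left suminf_add [OF summable_cinner summable_cinner])
  show "cinner (z *\<^sub>C a) b = z * cinner a b"
    by transfer (simp add: cinner_scaleC_left suminf_mult [OF summable_cinner])
  show "cinner a a = complex_of_real ((norm a)\<^sup>2)"
  proof transfer
    fix a :: "nat \<Rightarrow> 'a" assume a: "square_summable a"
    then have "(\<lambda>n. complex_of_real ((norm (a n))\<^sup>2)) sums complex_of_real (\<Sum>n. (norm (a n))\<^sup>2)"
      unfolding square_summable_def by (intro sums_of_real summable_sums)
    then have "(\<Sum>n. cinner (a n) (a n)) = complex_of_real (\<Sum>n. (norm (a n))\<^sup>2)"
      unfolding cinner_self by (rule sums_unique [symmetric])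
    moreover have "(\<Sum>n. (norm (a n))\<^sup>2) \<ge> 0"
      using a unfolding square_summable_def by (intro suminf_nonneg) auto
    ultimately show "(\<Sum>n. cinner (a n) (a n)) = complex_of_real ((sqrt (\<Sum>n. (norm (a n))\<^sup>2))\<^sup>2)"
      by simp
  qed
next
  fix X :: "nat \<Rightarrow> 'a l2" assume "Cauchy X"
  then have cauchy: "\<exists>M. \<forall>i\<ge>M. \<forall>j\<ge>M. norm (X i - X j) < e" if "e > 0" for e
    using that unfolding Cauchy_def dist_norm by blast
  have part: "(\<Sum>n<N. (norm (l2_seq x n - l2_seq y n))\<^sup>2) \<le> (norm (x - y))\<^sup>2" for N and x y :: "'a l2"
    using sum_norm_l2_seq_le [where x = "x - y"] by (simp add: minus_l2.rep_eq)
  have coord: "norm (l2_seq x n - l2_seq y n) \<le> norm (x - y)" for n and x y :: "'a l2"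
    using norm_l2_seq_le [where x = "x - y"] by (simp add: minus_l2.rep_eq)
  have "\<exists>l. (\<lambda>i. l2_seq (X i) n) \<longlonglongrightarrow> l" for n
  proof -
    have "Cauchy (\<lambda>i. l2_seq (X i) n)"
      unfolding Cauchy_def dist_norm by (metis cauchy coord order_le_less_trans)
    then show ?thesis by (simp add: Cauchy_convergent_iff convergent_def)
  qed
  then obtain l where l: "\<And>n. (\<lambda>i. l2_seq (X i) n) \<longlonglongrightarrow> l n" by metis
  \<comment> \<open>Only finitely many coordinates occur, so coordinatewise convergence suffices to
    let \<open>j\<close> tend to infinity in the Cauchy estimate; the result is uniform in
    \<open>N\<close>.\<close>
  have bound: "(\<Sum>n<N. (norm (l2_seq (X i) n - l n))\<^sup>2) \<le> e\<^sup>2"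
    if "e > 0" "\<And>i j. i \<ge> M \<Longrightarrow> j \<ge> M \<Longrightarrow> norm (X i - X j) < e" "i \<ge> M" for i e M N
  proof (rule LIMSEQ_le_const2)
    show "(\<lambda>j. \<Sum>n<N. (norm (l2_seq (X i) n - l2_seq (X j) n))\<^sup>2) \<longlonglongrightarrow> (\<Sum>n<N. (norm (l2_seq (X i) n - l n))\<^sup>2)"
      by (intro tendsto_intros l)
    show "\<exists>J. \<forall>j\<ge>J. (\<Sum>n<N. (norm (l2_seq (X i) n - l2_seq (X j) n))\<^sup>2) \<le> e\<^sup>2"
    proof (intro exI allI impI)
      fix j assume "j \<ge> M"
      have "(norm (X i - X j))\<^sup>2 \<le> e\<^sup>2"
        using that(2) [OF that(3) \<open>j \<ge> M\<close>] by (intro power_mono) auto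
      then show "(\<Sum>n<N. (norm (l2_seq (X i) n - l2_seq (X j) n))\<^sup>2) \<le> e\<^sup>2"
        using part [of "X i" "X j" N] by linarith
    qed
  qed
  have diff_ss: "square_summable (\<lambda>n. l2_seq (X i) n - l n)"
    if "e > 0" "\<And>i j. i \<ge> M \<Longrightarrow> j \<ge> M \<Longrightarrow> norm (X i - X j) < e" "i \<ge> M" for i e M
    unfolding square_summable_def
    by (rule bounded_imp_summable [of _ "e\<^sup>2"])
      (simp, unfold lessThan_Suc_atMost [symmetric], rule bound [OF that])
  obtain M1 where M1: "\<And>i j. i \<ge> M1 \<Longrightarrow> j \<ge> M1 \<Longrightarrow> norm (X i - X j) < 1"
    using cauchy [of 1] by auto
  \<comment> \<open>The limit is written as a difference of two square summable sequences: one term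
    of \<open>X\<close>, and its distance to the limit.\<close>
  have "square_summable (\<lambda>n. l2_seq (X M1) n - (l2_seq (X M1) n - l n))"
    by (intro square_summable_diff square_summable_l2_seq diff_ss [of 1 M1] M1) auto
  then have lss: "square_summable l" by simp
  have "X \<longlonglongrightarrow> to_l2 l"
    unfolding lim_sequentially
  proof (intro allI impI)
    fix e :: real assume "e > 0"
    then have e2: "e / 2 > 0" by simp
    obtain M where M: "\<And>i j. i \<ge> M \<Longrightarrow> j \<ge> M \<Longrightarrow> norm (X i - X j) < e / 2"
      using cauchy [OF e2] by auto
    show "\<exists>M. \<forall>i\<ge>M. dist (X i) (to_l2 l) < e"
    proof (intro exI allI impI)
      fix i assume i: "i \<ge> M"
      have "norm (X i - to_l2 l) = sqrt (\<Sum>n. (norm (l2_seq (X i) n - l n))\<^sup>2)"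
        using lss by (simp add: norm_l2.rep_eq minus_l2.rep_eq to_l2_inverse)
      also have "\<dots> \<le> sqrt ((e / 2)\<^sup>2)"
        by (intro real_sqrt_le_mono suminf_le_const diff_ss [OF e2 M i, unfolded square_summable_def]
            bound [OF e2 M i])
      also have "\<dots> < e" using \<open>e > 0\<close> by simp
      finally show "dist (X i) (to_l2 l) < e" by (simp add: dist_norm)
    qed
  qed
  then show "convergent X" by (rule convergentI)
qed

end

text \<open>This is the operator \<open>T \<otimes> 1\<close>, acting in each coordinate.\<close>

definition amplification ::
    "('a::chilbert_space \<Rightarrow>\<^sub>L 'b::chilbert_space) \<Rightarrow> 'a l2 \<Rightarrow>\<^sub>L 'b l2"
  where "amplification T = Blinfun (\<lambda>x. to_l2 (\<lambda>n. blinfun_apply T (l2_seq x n)))"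

lemma l2_seq_amplification [simp]:
  fixes T :: "'a::chilbert_space \<Rightarrow>\<^sub>L 'b::chilbert_space"
  shows "l2_seq (blinfun_apply (amplification T) x) n = blinfun_apply T (l2_seq x n)"
proof -
  define f where "f x = to_l2 (\<lambda>n. blinfun_apply T (l2_seq x n))" for x
  have seq: "l2_seq (f x) n = blinfun_apply T (l2_seq x n)" for x n
    by (simp add: f_def to_l2_inverse square_summable_blinfun)
  have "bounded_linear f"
  proof (rule bounded_linear_intro [where K = "norm T"])
    fix x y :: "'a l2" and r :: real
    show "f (x + y) = f x + f y"
      by (rule l2_eqI) (simp add: seq plus_l2.rep_eq blinfun.add_right)
    show "f (r *\<^sub>R x) = r *\<^sub>R f x"
      by (rule l2_eqI) (simp add: seq scaleR_l2.rep_eq blinfun.scaleR_right)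
    have s: "summable (\<lambda>n. (norm (l2_seq x n))\<^sup>2)" "summable (\<lambda>n. (norm (blinfun_apply T (l2_seq x n)))\<^sup>2)"
      using square_summable_l2_seq [of x] square_summable_blinfun [OF square_summable_l2_seq [of x], of T]
      by (auto simp: square_summable_def)
    have "(norm (f x))\<^sup>2 \<le> (\<Sum>n. (norm T)\<^sup>2 * (norm (l2_seq x n))\<^sup>2)"
      unfolding norm_l2_square seq
      by (intro suminf_le s summable_mult)
        (simp add: power_mult_distrib [symmetric] power_mono norm_blinfun)
    also have "\<dots> = (norm x * norm T)\<^sup>2"
      by (simp add: suminf_mult s norm_l2_square power_mult_distrib)
    finally show "norm (f x) \<le> norm x * norm T" by (rule power2_le_imp_le) simp
  qed
  then show ?thesis
    by (simp add: amplification_def bounded_linear_Blinfun_apply seq flip: f_def)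
qed

lemma amplification_bop [simp]: "T \<in> bop \<Longrightarrow> amplification T \<in> bop"
  by (auto simp: bop_def scaleC_l2.rep_eq intro!: l2_eqI)

lemma amplification_add: "amplification (S + T) = amplification S + amplification T"
  by (rule blinfun_eqI, rule l2_eqI) (simp add: blinfun.add_left plus_l2.rep_eq)

lemma amplification_op_scale: "amplification (op_scale c T) = op_scale c (amplification T)"
  by (rule blinfun_eqI, rule l2_eqI) (simp add: scaleC_l2.rep_eq)

lemma amplification_compose: "amplification (S o\<^sub>L T) = amplification S o\<^sub>L amplification T"
  by (rule blinfun_eqI, rule l2_eqI) simp

lemma amplification_adj: "T \<in> bop \<Longrightarrow> adj (amplification T) = amplification (adj T)"
  by (rule adj_eqI) (auto simp: cinner_l2.rep_eq cinner_adj_right)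

section \<open>Von Neumann's density argument\<close>

section \<open>The density theorem\<close>

text \<open>Nondegeneracy stands in for the identity, which the span of the products
  \<open>adj N1 N2\<close> need not contain.\<close>

definition nondegenerate_star_algebra :: "('a::chilbert_space \<Rightarrow>\<^sub>L 'a) set \<Rightarrow> bool"
  where "nondegenerate_star_algebra W \<longleftrightarrow> W \<subseteq> bop \<and> op.subspace W \<and>
    (\<forall>S\<in>W. \<forall>T\<in>W. S o\<^sub>L T \<in> W) \<and> (\<forall>T\<in>W. adj T \<in> W) \<and>
    (\<forall>h. (\<forall>T\<in>W. blinfun_apply T h = 0) \<longrightarrow> h = 0)"

lemma nondegenerate_star_algebra_amplification:
  assumes W: "nondegenerate_star_algebra W"
  shows "nondegenerate_star_algebra (amplification ` W)"
  unfolding nondegenerate_star_algebra_def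
proof (intro conjI ballI allI impI)
  show "amplification ` W \<subseteq> bop" using W by (auto simp: nondegenerate_star_algebra_def)
  have sub: "op.subspace W" using W by (simp add: nondegenerate_star_algebra_def)
  show "op.subspace (amplification ` W)"
  proof (rule op.subspaceI)
    have "amplification 0 = (0 :: 'a l2 \<Rightarrow>\<^sub>L 'a l2)"
      using amplification_op_scale [of 0 "0 :: 'a \<Rightarrow>\<^sub>L 'a"] by simp
    then show "0 \<in> amplification ` W" using op.subspace_0 [OF sub] by (metis imageI)
    show "x + y \<in> amplification ` W" if "x \<in> amplification ` W" "y \<in> amplification ` W" for x y
      using that op.subspace_add [OF sub] by (auto simp: amplification_add [symmetric])
    show "op_scale c x \<in> amplification ` W" if "x \<in> amplification ` W" for c x
      using that op.subspace_scale [OF sub] by (auto simp: amplification_op_scale [symmetric])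
  qed
  show "S o\<^sub>L T \<in> amplification ` W" if "S \<in> amplification ` W" "T \<in> amplification ` W" for S T
    using that W by (auto simp: nondegenerate_star_algebra_def amplification_compose [symmetric])
  show "adj T \<in> amplification ` W" if "T \<in> amplification ` W" for T
    using that W by (auto simp: nondegenerate_star_algebra_def amplification_adj subset_iff)
  fix h assume h: "\<forall>T\<in>amplification ` W. blinfun_apply T h = 0"
  show "h = 0"
  proof (rule l2_eqI)
    fix n
    have "blinfun_apply T (l2_seq h n) = 0" if "T \<in> W" for T
      using h that l2_seq_amplification [of T h n] by (simp add: zero_l2.rep_eq)
    then have "l2_seq h n = 0" using W unfolding nondegenerate_star_algebra_def by blast
    then show "l2_seq h n = l2_seq 0 n" by (simp add: zero_l2.rep_eq)
  qed
qed

text \<open>Let \<open>r\<close> be the component of \<open>x\<close> orthogonal to the orbit.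
  Closure under adjoints and products makes \<open>T r\<close> orthogonal to the orbit as well.
  Since \<open>r = x - P x\<close>, both \<open>T x\<close> and \<open>T (P x)\<close> are then
  orthogonal to \<open>T r\<close>, so \<open>T r\<close> is orthogonal to itself; nondegeneracy
  gives \<open>r = 0\<close>.\<close>

lemma nondegenerate_star_algebra_cyclic:
  fixes x :: "'a::chilbert_space"
  assumes W: "nondegenerate_star_algebra W"
  shows "x \<in> closure ((\<lambda>T. blinfun_apply T x) ` W)"
proof -
  let ?V = "(\<lambda>T. blinfun_apply T x) ` W"
  have sub: "op.subspace W" and bop: "T \<in> W \<Longrightarrow> T \<in> bop" and mult: "S \<in> W \<Longrightarrow> T \<in> W \<Longrightarrow> S o\<^sub>L T \<in> W"
    and adj: "T \<in> W \<Longrightarrow> adj T \<in> W" and nondeg: "(\<And>T. T \<in> W \<Longrightarrow> blinfun_apply T h = 0) \<Longrightarrow> h = 0"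
    for S T h
    using W by (auto simp: nondegenerate_star_algebra_def)
  have V: "csubspace ?V" by (rule csubspace_orbit [OF sub])
  obtain P where P: "P \<in> projections" "\<And>v. v \<in> closure ?V \<Longrightarrow> blinfun_apply P v = v"
    "\<And>z. blinfun_apply P z \<in> closure ?V"
    by (rule projection_onto_closure [OF V], rule that)
  define r where "r = x - blinfun_apply P x"
  have r_perp: "cinner v r = 0" if "v \<in> ?V" for v
  proof -
    have "blinfun_apply P v = v" using that P(2) closure_subset by blast
    moreover have "cinner v (blinfun_apply P x) = cinner (blinfun_apply P v) x"
      using P(1) cinner_adj_right [of P v x] by (simp add: projections_def)
    ultimately show ?thesis by (simp add: r_def cinner_diff_right)
  qed
  have Tr_perp: "cinner v (blinfun_apply T r) = 0" if T: "T \<in> W" and v: "v \<in> ?V" for T v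
  proof -
    obtain S where S: "S \<in> W" "v = blinfun_apply S x" using v by blast
    have "cinner v (blinfun_apply T r) = cinner (blinfun_apply (adj T o\<^sub>L S) x) r"
      by (simp add: S cinner_adj_left bop T)
    also have "\<dots> = 0" by (rule r_perp) (use mult adj S T in blast)
    finally show ?thesis .
  qed
  have "blinfun_apply T r = 0" if T: "T \<in> W" for T
  proof -
    have 1: "cinner (blinfun_apply T x) (blinfun_apply T r) = 0" using T by (intro Tr_perp) auto
    have "cinner (blinfun_apply P x) (blinfun_apply (adj T o\<^sub>L T) r) = 0"
      by (rule orthogonal_closure [OF P(3)]) (rule Tr_perp [OF mult [OF adj [OF T] T]])
    then have 2: "cinner (blinfun_apply T (blinfun_apply P x)) (blinfun_apply T r) = 0"
      by (simp add: cinner_adj_right bop T)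
    have "cinner (blinfun_apply T r) (blinfun_apply T r) = 0"
      using 1 2 by (subst (1) r_def) (simp add: blinfun.diff_right cinner_diff_left)
    then show ?thesis by (simp add: cinner_self)
  qed
  then have "r = 0" by (rule nondeg)
  then show ?thesis using P(3) [of x] by (simp add: r_def)
qed

text \<open>Simultaneous approximation of finitely many vectors is approximation of one vector of
  the iterated sequence space, so cyclicity is applied to the algebra amplified twice.\<close>

lemma approximate_unit_amplification:
  fixes xs :: "'a::chilbert_space l2 list"
  assumes W: "nondegenerate_star_algebra W" and "\<delta> > 0"
  obtains T where "T \<in> W" and "\<And>x. x \<in> set xs \<Longrightarrow> norm (blinfun_apply (amplification T) x - x) < \<delta>"
proof -
  \<comment> \<open>The list is padded with 0 to a sequence; its entries are the coordinates of one
    vector, and no coordinate exceeds the whole in norm.\<close>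
  define X where "X = to_l2 (\<lambda>n. if n < length xs then xs ! n else 0)"
  have "square_summable (\<lambda>n. if n < length xs then xs ! n else 0)"
    unfolding square_summable_def by (rule summable_finite [of "{..<length xs}"]) auto
  then have X: "l2_seq X n = xs ! n" if "n < length xs" for n
    using that by (simp add: X_def to_l2_inverse)
  have "X \<in> closure ((\<lambda>T. blinfun_apply T X) ` amplification ` amplification ` W)"
    by (intro nondegenerate_star_algebra_cyclic nondegenerate_star_algebra_amplification W)
  then obtain T where T: "T \<in> W" "dist (blinfun_apply (amplification (amplification T)) X) X < \<delta>"
    using \<open>\<delta> > 0\<close> unfolding closure_approachable by blast
  have "norm (blinfun_apply (amplification T) x - x) < \<delta>" if "x \<in> set xs" for x
  proof -
    obtain n where n: "n < length xs" "x = xs ! n" using \<open>x \<in> set xs\<close> by (metis in_set_conv_nth)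
    have "norm (l2_seq (blinfun_apply (amplification (amplification T)) X - X) n) < \<delta>"
      using norm_l2_seq_le T(2) order_le_less_trans unfolding dist_norm by blast
    then show ?thesis by (simp add: minus_l2.rep_eq X n)
  qed
  with T(1) show ?thesis by (rule that)
qed

section \<open>Weak-* neighbourhoods described by vector functionals of amplifications\<close>

section \<open>The weak-* topology\<close>

text \<open>Through this identity, weak-* approximation of \<open>T\<close> reduces to estimates for
  vectors in the sequence space.\<close>

lemma predual_pairing_amplification:
  "predual_pairing (l2_seq x) (l2_seq y) T = cinner (blinfun_apply (amplification T) x) y"
  by (simp add: predual_pairing_def cinner_l2.rep_eq)

lemma weak_star_subbasis:
  assumes "square_summable x" "square_summable y" "open U"
  shows "openin weak_star_topology {T \<in> bop. predual_pairing x y T \<in> U}"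
  unfolding weak_star_topology_def
  by (rule topology_generated_by_Basis) (use assms in blast)

lemma topspace_weak_star [simp]: "topspace weak_star_topology = bop"
proof
  show "topspace weak_star_topology \<subseteq> (bop :: ('a \<Rightarrow>\<^sub>L 'b) set)"
    unfolding weak_star_topology_def topology_generated_by_topspace by blast
  \<comment> \<open>The zero functional with \<open>U = UNIV\<close> shows that \<open>bop\<close>
    itself belongs to the subbasis.\<close>
  have "openin weak_star_topology (bop :: ('a \<Rightarrow>\<^sub>L 'b) set)"
    using weak_star_subbasis [OF square_summable_zero square_summable_zero open_UNIV] by simp
  then show "bop \<subseteq> topspace (weak_star_topology :: ('a \<Rightarrow>\<^sub>L 'b) topology)"
    by (rule openin_subset)
qed

text \<open>Induction over the generation of the topology, for all points of the open set at once:
  an intersection concatenates the two lists of functionals and takes the smaller radius.\<close>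

lemma weak_star_neighbourhood:
  fixes T :: "'a::chilbert_space \<Rightarrow>\<^sub>L 'b::chilbert_space"
  assumes "openin weak_star_topology U" and "T \<in> U"
  shows "\<exists>ps \<epsilon>. \<epsilon> > 0 \<and> (\<forall>S\<in>bop. (\<forall>(x, y)\<in>set ps.
    cmod (cinner (blinfun_apply (amplification (T - S)) x) y) < \<epsilon>) \<longrightarrow> S \<in> U)"
proof -
  have "generate_topology_on {{T \<in> bop. predual_pairing x y T \<in> U} | x y U.
      square_summable x \<and> square_summable y \<and> open U} U"
    using assms(1) unfolding weak_star_topology_def openin_topology_generated_by_iff .
  then have "\<forall>T\<in>U. \<exists>ps \<epsilon>. \<epsilon> > 0 \<and> (\<forall>S\<in>bop. (\<forall>(x, y)\<in>set ps.
      cmod (cinner (blinfun_apply (amplification (T - S)) x) y) < \<epsilon>) \<longrightarrow> S \<in> U)"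
  proof induction
    case Empty
    then show ?case by simp
  next
    case (Int a b)
    show ?case
    proof
      fix T assume T: "T \<in> a \<inter> b"
      obtain ps \<epsilon> qs \<delta> where "\<epsilon> > 0" "\<forall>S\<in>bop. (\<forall>(x, y)\<in>set ps.
          cmod (cinner (blinfun_apply (amplification (T - S)) x) y) < \<epsilon>) \<longrightarrow> S \<in> a"
        and "\<delta> > 0" "\<forall>S\<in>bop. (\<forall>(x, y)\<in>set qs.
          cmod (cinner (blinfun_apply (amplification (T - S)) x) y) < \<delta>) \<longrightarrow> S \<in> b"
        using Int.IH T by blast
      then show "\<exists>ps \<epsilon>. \<epsilon> > 0 \<and> (\<forall>S\<in>bop. (\<forall>(x, y)\<in>set ps.
          cmod (cinner (blinfun_apply (amplification (T - S)) x) y) < \<epsilon>) \<longrightarrow> S \<in> a \<inter> b)"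
        by (intro exI [of _ "ps @ qs"] exI [of _ "min \<epsilon> \<delta>"]) fastforce
    qed
  next
    case (UN K)
    show ?case
    proof
      fix T assume "T \<in> \<Union> K"
      then obtain k where "k \<in> K" "T \<in> k" by blast
      then show "\<exists>ps \<epsilon>. \<epsilon> > 0 \<and> (\<forall>S\<in>bop. (\<forall>(x, y)\<in>set ps.
          cmod (cinner (blinfun_apply (amplification (T - S)) x) y) < \<epsilon>) \<longrightarrow> S \<in> \<Union> K)"
        using UN.IH by (meson UnionI)
    qed
  next
    case (Basis s)
    then obtain x y V where s: "s = {T \<in> bop. predual_pairing x y T \<in> V}"
      "square_summable x" "square_summable y" "open V" by blast
    have pair: "predual_pairing x y S = cinner (blinfun_apply (amplification S) (to_l2 x)) (to_l2 y)" for S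
      using predual_pairing_amplification [of "to_l2 x" "to_l2 y" S] s by (simp add: to_l2_inverse)
    show ?case
    proof
      fix T assume "T \<in> s"
      then obtain \<epsilon> where \<epsilon>: "\<epsilon> > 0" "\<And>z. dist z (predual_pairing x y T) < \<epsilon> \<Longrightarrow> z \<in> V"
        using s by (auto simp: open_dist)
      have "S \<in> s" if "S \<in> bop" "cmod (cinner (blinfun_apply (amplification (T - S)) (to_l2 x)) (to_l2 y)) < \<epsilon>" for S
      proof -
        have "amplification T = amplification (T - S) + amplification S"
          using amplification_add [of "T - S" S] by simp
        then have "predual_pairing x y T - predual_pairing x y S
            = cinner (blinfun_apply (amplification (T - S)) (to_l2 x)) (to_l2 y)"
          by (simp add: pair blinfun.add_left cinner_add_left)
        then have "dist (predual_pairing x y S) (predual_pairing x y T) < \<epsilon>"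
          using that(2) by (simp add: dist_norm norm_minus_commute [of "predual_pairing x y S"])
        then show ?thesis using \<epsilon>(2) that(1) s(1) by blast
      qed
      then show "\<exists>ps \<epsilon>. \<epsilon> > 0 \<and> (\<forall>S\<in>bop. (\<forall>(x, y)\<in>set ps.
          cmod (cinner (blinfun_apply (amplification (T - S)) x) y) < \<epsilon>) \<longrightarrow> S \<in> s)"
        using \<epsilon>(1) by (intro exI [of _ "[(to_l2 x, to_l2 y)]"] exI [of _ \<epsilon>]) auto
    qed
  qed
  then show ?thesis using assms(2) by blast
qed

lemma weak_star_closure_bop: "T \<in> weak_star_topology closure_of S \<Longrightarrow> T \<in> bop"
  using in_closure_of topspace_weak_star by metis

text \<open>A vector functional is the pairing with two sequences supported at index 0, so its
  kernel is weak-* closed.\<close>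

lemma weak_star_closure_vector_functional:
  assumes T: "T \<in> weak_star_topology closure_of S"
    and zero: "\<And>X. X \<in> S \<Longrightarrow> cinner (blinfun_apply X v) w = 0"
  shows "cinner (blinfun_apply T v) w = 0"
proof (rule ccontr)
  assume nz: "\<not> ?thesis"
  have ss: "square_summable (\<lambda>n. if n = (0::nat) then u else 0)" for u :: "'c::real_normed_vector"
    unfolding square_summable_def by (rule summable_finite [of "{0}"]) simp_all
  have pair: "predual_pairing (\<lambda>n. if n = 0 then v else 0) (\<lambda>n. if n = 0 then w else 0) X
      = cinner (blinfun_apply X v) w" for X
    unfolding predual_pairing_def by (subst suminf_finite [of "{0}"]) auto
  define U where "U = {X \<in> bop. predual_pairing (\<lambda>n. if n = 0 then v else 0) (\<lambda>n. if n = 0 then w else 0) X \<in> - {0}}"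
  have "openin weak_star_topology U"
    unfolding U_def by (rule weak_star_subbasis [OF ss ss]) auto
  moreover have "T \<in> U"
    using nz weak_star_closure_bop [OF T] by (simp add: U_def pair)
  ultimately obtain X where "X \<in> S" "X \<in> U"
    using T unfolding in_closure_of by blast
  then show False using zero by (simp add: U_def pair)
qed

section \<open>Weak-* closedness of \<open>Alg\<close> and the place of \<open>Lat\<close> in the
  commutant\<close>

section \<open>Algebras of operators leaving projections invariant\<close>

lemmas compose_zero_left [simp] = bounded_bilinear.zero_left [OF bounded_bilinear_blinfun_compose]
lemmas compose_zero_right [simp] = bounded_bilinear.zero_right [OF bounded_bilinear_blinfun_compose]

lemma op_subspace_compose:
  assumes "op.subspace W" "W \<subseteq> bop" "R \<in> bop"
  shows "op.subspace {X \<in> bop. R o\<^sub>L X o\<^sub>L S \<in> W}"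
  by (rule op.subspaceI)
    (auto simp: assms compose_add_left compose_add_right op_scale_compose_left op_scale_compose_right
      op.subspace_0 [OF assms(1)] op.subspace_add [OF assms(1)] op.subspace_scale [OF assms(1)])

lemma op_subspace_Alg: "\<L> \<subseteq> bop \<Longrightarrow> op.subspace (Alg \<L>)"
  unfolding Alg_def
  by (rule op.subspaceI)
    (auto simp: compose_add_left compose_add_right op_scale_compose_left op_scale_compose_right subset_iff)

lemma projections_bop: "P \<in> projections \<Longrightarrow> P \<in> bop"
  by (simp add: projections_def)

lemma AlgI:
  "T \<in> bop \<Longrightarrow> (\<And>L. L \<in> \<L> \<Longrightarrow> (id_blinfun - L) o\<^sub>L T o\<^sub>L L = 0) \<Longrightarrow> T \<in> Alg \<L>"
  by (simp add: Alg_def)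

lemma Alg_compl: "T \<in> Alg \<L> \<Longrightarrow> L \<in> \<L> \<Longrightarrow> (id_blinfun - L) o\<^sub>L T o\<^sub>L L = 0"
  by (simp add: Alg_def)

text \<open>Invariance of the range of \<open>L\<close> says that the vector functionals at
  \<open>L v\<close> and \<open>(1 - L) w\<close> vanish, and such conditions pass to the weak-*
  closure.\<close>

lemma weak_star_closure_Alg:
  assumes "S \<subseteq> Alg \<L>" and \<L>: "\<L> \<subseteq> projections"
  shows "weak_star_topology closure_of S \<subseteq> Alg \<L>"
proof
  fix T assume T: "T \<in> weak_star_topology closure_of S"
  show "T \<in> Alg \<L>"
  proof (rule AlgI)
    fix L assume L: "L \<in> \<L>"
    then have Lbop: "id_blinfun - L \<in> bop" and Ladj: "adj (id_blinfun - L) = id_blinfun - L"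
      using \<L> by (auto simp: projections_def adj_diff)
    have move: "cinner (blinfun_apply ((id_blinfun - L) o\<^sub>L X o\<^sub>L L) v) w
        = cinner (blinfun_apply X (blinfun_apply L v)) (blinfun_apply (id_blinfun - L) w)" for X v w
      using cinner_adj_right [OF Lbop, of "blinfun_apply X (blinfun_apply L v)" w] Ladj by simp
    have zero: "cinner (blinfun_apply T (blinfun_apply L v)) (blinfun_apply (id_blinfun - L) w) = 0" for v w
    proof (rule weak_star_closure_vector_functional [OF T])
      fix X assume "X \<in> S"
      then have "(id_blinfun - L) o\<^sub>L X o\<^sub>L L = 0" using assms(1) L Alg_compl by blast
      then show "cinner (blinfun_apply X (blinfun_apply L v)) (blinfun_apply (id_blinfun - L) w) = 0"
        unfolding move [symmetric] by simp
    qed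
    show "(id_blinfun - L) o\<^sub>L T o\<^sub>L L = 0"
      by (rule blinfun_eqI, rule cinner_eqI) (simp only: move zero zero_blinfun.rep_eq cinner_zero_left)
  qed (rule weak_star_closure_bop [OF T])
qed

lemma Lat_subset_projections: "Lat A \<subseteq> projections"
  by (auto simp: Lat_def)

lemma diagonal_bop: "A \<subseteq> bop \<Longrightarrow> diagonal A \<subseteq> bop"
  by (auto simp: diagonal_def)

lemma diagonalI: "T \<in> A \<Longrightarrow> T \<in> bop \<Longrightarrow> adj T \<in> A \<Longrightarrow> T \<in> diagonal A"
  unfolding diagonal_def by (metis IntI adj_adj imageI)

lemma diagonal_adj: "A \<subseteq> bop \<Longrightarrow> adj ` diagonal A \<subseteq> diagonal A"
  by (auto simp: diagonal_def subset_iff)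

text \<open>Both \<open>T\<close> and \<open>adj T\<close> leave the range of \<open>L\<close>
  invariant, so \<open>T L = L T L = L T\<close>. The inclusion places the lattice in the domain of
  the isomorphism.\<close>

lemma Lat_subset_commutant_diagonal:
  assumes "A \<subseteq> bop"
  shows "Lat A \<subseteq> commutant (diagonal A)"
proof
  fix L assume L: "L \<in> Lat A"
  then have Lp: "L \<in> bop" "adj L = L" by (auto simp: Lat_def projections_def)
  have inv: "T o\<^sub>L L = L o\<^sub>L (T o\<^sub>L L)" if "T \<in> A" for T
    using that L by (auto simp: Lat_def compose_diff_left compose_assoc)
  show "L \<in> commutant (diagonal A)"
  proof (rule commutantI [OF Lp(1)])
    fix T assume "T \<in> diagonal A"
    then have T: "T \<in> A" "adj T \<in> A" "T \<in> bop"
      using assms by (auto simp: diagonal_def subset_iff)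
    have "adj (adj T o\<^sub>L L) = adj (L o\<^sub>L (adj T o\<^sub>L L))" using inv [OF T(2)] by simp
    then have "L o\<^sub>L T = L o\<^sub>L (T o\<^sub>L L)"
      using T(3) Lp by (simp add: adj_compose compose_assoc)
    with inv [OF T(1)] show "L o\<^sub>L T = T o\<^sub>L L" by simp
  qed
qed

section \<open>Weak-* generation of an algebra by a separating TRO, and the TRO of
  intertwiners\<close>

section \<open>Ternary rings of operators that separate vectors\<close>

lemma op_mult_tripleE:
  assumes "Z \<in> X \<cdot> Y \<cdot> W"
  obtains R S T where "R \<in> X" "S \<in> Y" "T \<in> W" "Z = R o\<^sub>L S o\<^sub>L T"
  using assms by (auto simp: op_mult_def)

lemma op_mult_tripleI: "R \<in> X \<Longrightarrow> S \<in> Y \<Longrightarrow> T \<in> W \<Longrightarrow> R o\<^sub>L S o\<^sub>L T \<in> X \<cdot> Y \<cdot> W"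
  by (auto simp: op_mult_def)

text \<open>Linear extension in one factor at a time. The fixed middle factor \<open>R\<close> lets
  one statement serve both products within a span, with \<open>R\<close> the identity, and operators
  of the algebra placed between two spans.\<close>

lemma span_bilinear_induct:
  assumes S: "S \<in> op.span X" and T: "T \<in> op.span Y" and X: "X \<subseteq> bop" and Y: "Y \<subseteq> bop"
    and W: "op.subspace W" "W \<subseteq> bop" and R: "R \<in> bop"
    and base: "\<And>S T. S \<in> X \<Longrightarrow> T \<in> Y \<Longrightarrow> S o\<^sub>L R o\<^sub>L T \<in> W"
  shows "S o\<^sub>L R o\<^sub>L T \<in> W"
proof -
  have right: "S o\<^sub>L R o\<^sub>L T \<in> W" if "S \<in> X" for S
  proof -
    have SR: "S o\<^sub>L R \<in> bop" using that X R by auto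
    have "op.span Y \<subseteq> {T \<in> bop. S o\<^sub>L R o\<^sub>L T o\<^sub>L id_blinfun \<in> W}"
      by (rule op.span_minimal [OF _ op_subspace_compose [OF W SR]]) (use base that Y in auto)
    then show ?thesis using T by auto
  qed
  have Tb: "T \<in> bop" using T op.span_minimal [OF Y op_subspace_bop] by blast
  have "op.span X \<subseteq> {S \<in> bop. id_blinfun o\<^sub>L S o\<^sub>L (R o\<^sub>L T) \<in> W}"
    by (rule op.span_minimal [OF _ op_subspace_compose [OF W bop_id]])
      (use right X in \<open>auto simp: compose_assoc\<close>)
  then show ?thesis using S by (auto simp: compose_assoc)
qed

text \<open>In a product of two generators the last three factors form a triple product, which lies
  in \<open>M\<close> again. If \<open>adj N N\<close> kills \<open>h\<close>, then
  \<open>N h\<close> has norm 0, so separation of vectors becomes nondegeneracy.\<close>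

lemma tro_nondegenerate_star_algebra:
  fixes M :: "('a::chilbert_space \<Rightarrow>\<^sub>L 'b::chilbert_space) set"
  assumes M: "tro M" and sep: "\<And>h. (\<And>N. N \<in> M \<Longrightarrow> blinfun_apply N h = 0) \<Longrightarrow> h = 0"
  shows "nondegenerate_star_algebra (op.span (adj ` M \<cdot> M))"
  unfolding nondegenerate_star_algebra_def
proof (intro conjI ballI allI impI)
  let ?W = "op.span (adj ` M \<cdot> M)"
  have triple: "N1 o\<^sub>L adj N2 o\<^sub>L N3 \<in> M" if "N1 \<in> M" "N2 \<in> M" "N3 \<in> M" for N1 N2 N3
    using M that op_mult_tripleI [of N1 M "adj N2" "adj ` M" N3 M] by (auto simp: tro_def)
  have Mb: "M \<subseteq> bop" using M by (simp add: tro_def)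
  have gen: "adj ` M \<cdot> M \<subseteq> bop" using Mb by (auto simp: op_mult_def subset_iff)
  show Wb: "?W \<subseteq> bop" by (rule op.span_minimal [OF gen op_subspace_bop])
  show W: "op.subspace ?W" by (rule op.subspace_span)
  have gen_adj: "adj T \<in> ?W" if "T \<in> adj ` M \<cdot> M" for T
  proof -
    obtain N1 N2 where N: "N1 \<in> M" "N2 \<in> M" "T = adj N1 o\<^sub>L N2" using \<open>T \<in> adj ` M \<cdot> M\<close> by (auto simp: op_mult_def)
    have "adj T = adj N2 o\<^sub>L N1" using N Mb by (auto simp: adj_compose subset_iff)
    then have "adj T \<in> adj ` M \<cdot> M" using N by (auto simp: op_mult_def)
    then show ?thesis by (rule op.span_base)
  qed
  show "adj T \<in> ?W" if "T \<in> ?W" for T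
  proof -
    have "op.subspace {T \<in> bop. adj T \<in> ?W}"
      by (rule op.subspaceI) (auto simp: adj_add adj_op_scale op.span_zero intro: op.span_add op.span_scale)
    then have "?W \<subseteq> {T \<in> bop. adj T \<in> ?W}"
      using gen gen_adj by (intro op.span_minimal) auto
    then show ?thesis using that by blast
  qed
  show "S o\<^sub>L T \<in> ?W" if "S \<in> ?W" "T \<in> ?W" for S T
  proof -
    have "S o\<^sub>L id_blinfun o\<^sub>L T \<in> ?W"
    proof (rule span_bilinear_induct [OF that gen gen W Wb bop_id])
      fix S T assume "S \<in> adj ` M \<cdot> M" "T \<in> adj ` M \<cdot> M"
      then obtain N1 N2 N3 N4 where N: "N1 \<in> M" "N2 \<in> M" "N3 \<in> M" "N4 \<in> M"
        "S = adj N1 o\<^sub>L N2" "T = adj N3 o\<^sub>L N4" by (auto simp: op_mult_def)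
      have "S o\<^sub>L id_blinfun o\<^sub>L T = adj N1 o\<^sub>L (N2 o\<^sub>L adj N3 o\<^sub>L N4)" by (simp add: N compose_assoc)
      also have "\<dots> \<in> adj ` M \<cdot> M" using triple [OF N(2-4)] N(1) by (auto simp: op_mult_def)
      finally show "S o\<^sub>L id_blinfun o\<^sub>L T \<in> ?W" by (rule op.span_base)
    qed
    then show ?thesis by simp
  qed
  show "h = 0" if h: "\<forall>T\<in>?W. blinfun_apply T h = 0" for h
  proof (rule sep)
    fix N assume N: "N \<in> M"
    then have "adj N o\<^sub>L N \<in> ?W" by (intro op.span_base) (auto simp: op_mult_def)
    then have "blinfun_apply (adj N) (blinfun_apply N h) = 0" using h by fastforce
    then have "(norm (blinfun_apply N h))\<^sup>2 = 0"
      using norm_sq_adj_compose [of N h] N Mb by auto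
    then show "blinfun_apply N h = 0" by simp
  qed
qed

lemma subset_weak_star_closure_tro:
  fixes M :: "('a::chilbert_space \<Rightarrow>\<^sub>L 'b::chilbert_space) set"
  assumes M: "tro M" and sep: "\<And>h. (\<And>N. N \<in> M \<Longrightarrow> blinfun_apply N h = 0) \<Longrightarrow> h = 0"
    and A: "A \<subseteq> bop" and B: "B \<subseteq> bop"
    and MAM: "\<And>N1 N2 T. N1 \<in> M \<Longrightarrow> N2 \<in> M \<Longrightarrow> T \<in> A \<Longrightarrow> N1 o\<^sub>L T o\<^sub>L adj N2 \<in> B"
  shows "A \<subseteq> weak_star_topology closure_of op.span (adj ` M \<cdot> B \<cdot> M)"
proof
  fix T assume T: "T \<in> A"
  let ?W = "op.span (adj ` M \<cdot> M)" and ?V = "op.span (adj ` M \<cdot> B \<cdot> M)"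
  have Mb: "M \<subseteq> bop" using M by (simp add: tro_def)
  have Tb: "T \<in> bop" using T A by blast
  have gen: "adj ` M \<cdot> M \<subseteq> bop" using Mb by (auto simp: op_mult_def subset_iff)
  have "adj ` M \<cdot> B \<cdot> M \<subseteq> bop" using Mb B by (auto simp: op_mult_def subset_iff)
  then have Vb: "?V \<subseteq> bop" by (rule op.span_minimal [OF _ op_subspace_bop])
  have W: "nondegenerate_star_algebra ?W" by (rule tro_nondegenerate_star_algebra [OF M sep])
  \<comment> \<open>After regrouping, the inner factor is \<open>N2 T (adj N3)\<close>, which lies
    in \<open>B\<close>.\<close>
  have WTW: "S o\<^sub>L T o\<^sub>L S' \<in> ?V" if "S \<in> ?W" "S' \<in> ?W" for S S'
  proof (rule span_bilinear_induct [OF that gen gen op.subspace_span Vb Tb])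
    fix S S' assume "S \<in> adj ` M \<cdot> M" "S' \<in> adj ` M \<cdot> M"
    then obtain N1 N2 N3 N4 where N: "N1 \<in> M" "N2 \<in> M" "N3 \<in> M" "N4 \<in> M"
      "S = adj N1 o\<^sub>L N2" "S' = adj N3 o\<^sub>L N4" by (auto simp: op_mult_def)
    have "S o\<^sub>L T o\<^sub>L S' = adj N1 o\<^sub>L (N2 o\<^sub>L T o\<^sub>L adj N3) o\<^sub>L N4" by (simp add: N compose_assoc)
    also have "\<dots> \<in> adj ` M \<cdot> B \<cdot> M" by (intro op_mult_tripleI imageI MAM N T)
    finally show "S o\<^sub>L T o\<^sub>L S' \<in> ?V" by (rule op.span_base)
  qed
  show "T \<in> weak_star_topology closure_of ?V"
    unfolding in_closure_of topspace_weak_star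
  proof (intro conjI Tb allI impI, elim conjE)
    fix U assume TU: "T \<in> U" and oU: "openin weak_star_topology U"
    from weak_star_neighbourhood [OF oU TU]
    obtain ps \<epsilon> where "\<epsilon> > 0" and U: "\<forall>S\<in>bop. (\<forall>(x, y)\<in>set ps.
      cmod (cinner (blinfun_apply (amplification (T - S)) x) y) < \<epsilon>) \<longrightarrow> S \<in> U" by blast
    define K where "K = norm (amplification T)"
    define b where "b = sum_list (map (\<lambda>(x, y). norm x + norm y) ps)"
    have b: "norm x + norm y \<le> b" if "(x, y) \<in> set ps" for x y
      unfolding b_def using member_le_sum_list [of "norm x + norm y" "map (\<lambda>(x, y). norm x + norm y) ps"] that
      by force
    \<comment> \<open>The cap 1 yields \<open>norm ?y \<le> norm y + 1\<close>; the total error is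
      then at most \<open>K * (b + 1) * d\<close>, and the extra 1 in the denominator covers
      \<open>K = 0\<close> and makes the final inequality strict.\<close>
    define d where "d = min 1 (\<epsilon> / (K * (b + 1) + 1))"
    have b0: "b \<ge> 0" unfolding b_def by (rule sum_list_nonneg) auto
    have K0: "K \<ge> 0" by (simp add: K_def)
    have "d > 0" unfolding d_def using \<open>\<epsilon> > 0\<close> b0 K0 by (simp add: add_nonneg_pos)
    have "K * (b + 1) * d < \<epsilon>"
    proof -
      have pos: "K * (b + 1) + 1 > 0" using b0 K0 by (simp add: add_nonneg_pos)
      have "K * (b + 1) * d < (K * (b + 1) + 1) * d" using \<open>d > 0\<close> by simp
      also have "\<dots> \<le> (K * (b + 1) + 1) * (\<epsilon> / (K * (b + 1) + 1))"
        using pos by (intro mult_left_mono) (auto simp: d_def)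
      also have "\<dots> = \<epsilon>" using pos by simp
      finally show ?thesis .
    qed
    obtain S where S: "S \<in> ?W" "\<And>x. x \<in> set (map fst ps @ map snd ps) \<Longrightarrow>
        norm (blinfun_apply (amplification S) x - x) < d"
      using approximate_unit_amplification [OF W \<open>d > 0\<close>] by metis
    have Sb: "S \<in> bop" and adjS: "adj S \<in> ?W"
      using W S(1) by (auto simp: nondegenerate_star_algebra_def)
    let ?X = "adj S o\<^sub>L T o\<^sub>L S"
    have XV: "?X \<in> ?V" by (rule WTW [OF adjS S(1)])
    have "?X \<in> U"
    proof (rule U [rule_format], safe)
      show "?X \<in> bop" using XV Vb by blast
      fix x y assume xy: "(x, y) \<in> set ps"
      let ?x = "blinfun_apply (amplification S) x" and ?y = "blinfun_apply (amplification S) y"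
        and ?T = "amplification T"
      have dx: "norm (x - ?x) \<le> d" and dy: "norm (y - ?y) \<le> d"
        using S(2) [of x] S(2) [of y] xy by (force simp: norm_minus_commute)+
      have ny: "norm ?y \<le> norm y + 1"
        using dy norm_triangle_ineq2 [of ?y y] unfolding norm_minus_commute [of y] d_def by linarith
      have T_bound: "cmod (cinner (blinfun_apply ?T u) v) \<le> K * norm u * norm v" for u v
        using cinner_bound [of "blinfun_apply ?T u" v] mult_right_mono [OF norm_blinfun [of ?T u], of "norm v"]
        by (simp add: K_def mult_ac)
      have "amplification T = amplification (T - ?X) + amplification ?X"
        using amplification_add [of "T - ?X" ?X] by simp
      then have "cinner (blinfun_apply (amplification (T - ?X)) x) y
          = cinner (blinfun_apply ?T x) y - cinner (blinfun_apply (amplification ?X) x) y"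
        by (simp add: blinfun.add_left cinner_add_left)
      also have "cinner (blinfun_apply (amplification ?X) x) y = cinner (blinfun_apply ?T ?x) ?y"
        by (simp add: amplification_compose amplification_adj [OF Sb, symmetric] cinner_adj_left Sb)
      \<comment> \<open>The two arguments are replaced one at a time, so that each term contains one
        small difference.\<close>
      also have "cinner (blinfun_apply ?T x) y - cinner (blinfun_apply ?T ?x) ?y
          = cinner (blinfun_apply ?T x) (y - ?y) + cinner (blinfun_apply ?T (x - ?x)) ?y"
        by (simp add: cinner_diff_right cinner_diff_left blinfun.diff_right)
      finally have eq: "cinner (blinfun_apply (amplification (T - ?X)) x) y
          = cinner (blinfun_apply ?T x) (y - ?y) + cinner (blinfun_apply ?T (x - ?x)) ?y" .
      have "cmod (cinner (blinfun_apply (amplification (T - ?X)) x) y)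
          \<le> K * norm x * norm (y - ?y) + K * norm (x - ?x) * norm ?y"
        unfolding eq by (rule order_trans [OF norm_triangle_ineq add_mono [OF T_bound T_bound]])
      also have "\<dots> \<le> K * norm x * d + K * d * (norm y + 1)"
        using dx dy ny K0 \<open>d > 0\<close> by (intro add_mono mult_mono mult_left_mono) auto
      also have "\<dots> = K * (norm x + norm y + 1) * d" by (simp add: algebra_simps)
      also have "\<dots> \<le> K * (b + 1) * d"
        using b [OF xy] K0 \<open>d > 0\<close> by (intro mult_right_mono mult_left_mono) auto
      also have "\<dots> < \<epsilon>" by fact
      finally show "cmod (cinner (blinfun_apply (amplification (T - ?X)) x) y) < \<epsilon>" .
    qed
    with XV show "\<exists>y. y \<in> ?V \<and> y \<in> U" by blast
  qed
qed

lemma intertwinersD: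
  assumes "N \<in> intertwiners R \<theta>"
  shows "N \<in> bop" and "X \<in> R \<Longrightarrow> N o\<^sub>L X = \<theta> X o\<^sub>L N"
  using assms by (auto simp: intertwiners_def)

context commutant_isomorphism
begin

lemma intertwiners_adj:
  assumes N: "N \<in> intertwiners (commutant D) \<theta>" and X: "X \<in> commutant D"
  shows "X o\<^sub>L adj N = adj N o\<^sub>L \<theta> X"
proof -
  have "adj (N o\<^sub>L adj X) = adj (\<theta> (adj X) o\<^sub>L N)"
    using intertwinersD(2) [OF N commutant_adj [OF D X]] by simp
  then show ?thesis
    using intertwinersD(1) [OF N] commutantD(1) [OF X] image_bop [OF X]
    by (simp add: adj_compose hom_adj [OF X])
qed

lemma tro_intertwiners: "tro (intertwiners (commutant D) \<theta>)"
  unfolding tro_def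
proof (intro conjI subsetI)
  let ?M = "intertwiners (commutant D) \<theta>"
  show "N \<in> bop" if "N \<in> ?M" for N using that by (rule intertwinersD)
  show "op.subspace ?M"
    unfolding intertwiners_def
    by (rule op.subspaceI) (auto simp: compose_add_left compose_add_right op_scale_compose_left
        op_scale_compose_right image_bop)
  fix Z assume "Z \<in> ?M \<cdot> adj ` ?M \<cdot> ?M"
  then obtain N1 N2 N3 where N: "N1 \<in> ?M" "N2 \<in> ?M" "N3 \<in> ?M" "Z = N1 o\<^sub>L adj N2 o\<^sub>L N3"
    by (auto elim!: op_mult_tripleE)
  have "Z o\<^sub>L X = \<theta> X o\<^sub>L Z" if X: "X \<in> commutant D" for X
  proof -
    have "Z o\<^sub>L X = N1 o\<^sub>L (adj N2 o\<^sub>L \<theta> X) o\<^sub>L N3"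
      by (simp add: N(4) compose_assoc intertwinersD(2) [OF N(3) X])
    also have "\<dots> = (N1 o\<^sub>L X) o\<^sub>L (adj N2 o\<^sub>L N3)"
      by (simp only: intertwiners_adj [OF N(2) X, symmetric] compose_assoc)
    finally show ?thesis by (simp add: intertwinersD(2) [OF N(1) X] N(4) compose_assoc)
  qed
  then show "Z \<in> ?M" using N intertwinersD(1) by (auto simp: intertwiners_def)
qed

text \<open>Exchanging the roles of the two algebras thus replaces the TRO by its adjoints, and the
  second equation of TRO equivalence becomes an instance of the first.\<close>

lemma intertwiners_inverse:
  "intertwiners (commutant E) (inv_into (commutant D) \<theta>) = adj ` intertwiners (commutant D) \<theta>"
proof -
  interpret inv: commutant_isomorphism E D "inv_into (commutant D) \<theta>"
    by (rule inverse_isomorphism)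
  let ?i = "inv_into (commutant D) \<theta>"
  have inv: "?i (\<theta> X) = X" if "X \<in> commutant D" for X using inj that by simp
  show ?thesis
  proof
    show "adj ` intertwiners (commutant D) \<theta> \<subseteq> intertwiners (commutant E) ?i"
    proof (intro subsetI, elim imageE)
      fix Z N assume N: "N \<in> intertwiners (commutant D) \<theta>" "Z = adj N"
      have "adj N o\<^sub>L Y = ?i Y o\<^sub>L adj N" if "Y \<in> commutant E" for Y
      proof -
        obtain X where "X \<in> commutant D" "\<theta> X = Y" using surj \<open>Y \<in> commutant E\<close> by blast
        then show ?thesis using intertwiners_adj [OF N(1)] inv by metis
      qed
      then show "Z \<in> intertwiners (commutant E) ?i"
        using intertwinersD(1) [OF N(1)] by (simp add: intertwiners_def N(2))
    qed
    show "intertwiners (commutant E) ?i \<subseteq> adj ` intertwiners (commutant D) \<theta>"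
    proof
      fix N assume N: "N \<in> intertwiners (commutant E) ?i"
      have "adj N o\<^sub>L X = \<theta> X o\<^sub>L adj N" if X: "X \<in> commutant D" for X
        using inv.intertwiners_adj [OF N image_in [OF X]] by (simp add: inv X)
      then have "adj N \<in> intertwiners (commutant D) \<theta>"
        using intertwinersD(1) [OF N] by (simp add: intertwiners_def)
      then show "N \<in> adj ` intertwiners (commutant D) \<theta>"
        using intertwinersD(1) [OF N] by (metis adj_adj imageI)
    qed
  qed
qed

text \<open>The intertwining relations move \<open>L\<close> inwards through both outer factors and
  turn it into \<open>\<theta> L\<close>, where invariance under \<open>S\<close> applies.\<close>

lemma intertwiners_conj_Alg:
  assumes \<L>: "\<L> \<subseteq> commutant D" and N: "N1 \<in> intertwiners (commutant D) \<theta>" "N2 \<in> intertwiners (commutant D) \<theta>"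
    and S: "S \<in> Alg (\<theta> ` \<L>)"
  shows "adj N1 o\<^sub>L S o\<^sub>L N2 \<in> Alg \<L>"
proof (rule AlgI)
  have Sb: "S \<in> bop" using S by (simp add: Alg_def)
  show "adj N1 o\<^sub>L S o\<^sub>L N2 \<in> bop" using intertwinersD(1) [OF N(1)] intertwinersD(1) [OF N(2)] Sb by simp
  fix L assume "L \<in> \<L>"
  then have L: "L \<in> commutant D" and zero: "(id_blinfun - \<theta> L) o\<^sub>L S o\<^sub>L \<theta> L = 0"
    using \<L> S by (auto simp: Alg_def)
  have "(id_blinfun - L) o\<^sub>L adj N1 = adj N1 o\<^sub>L (id_blinfun - \<theta> L)"
    by (simp add: compose_diff_left compose_diff_right intertwiners_adj [OF N(1) L])
  then have "(id_blinfun - L) o\<^sub>L (adj N1 o\<^sub>L S o\<^sub>L N2) o\<^sub>L L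
      = adj N1 o\<^sub>L (id_blinfun - \<theta> L) o\<^sub>L S o\<^sub>L (N2 o\<^sub>L L)"
    by (simp add: compose_assoc [symmetric])
  also have "\<dots> = adj N1 o\<^sub>L ((id_blinfun - \<theta> L) o\<^sub>L S o\<^sub>L \<theta> L) o\<^sub>L N2"
    by (simp only: intertwinersD(2) [OF N(2) L] compose_assoc)
  also have "\<dots> = 0" by (simp add: zero)
  finally show "(id_blinfun - L) o\<^sub>L (adj N1 o\<^sub>L S o\<^sub>L N2) o\<^sub>L L = 0" .
qed

end

section \<open>Transport of the commutant of the diagonal along a TRO\<close>

section \<open>The isomorphism induced by a ternary ring of operators\<close>

text \<open>Applied to the moments \<open>b m = \<langle>S\<^sup>m u, u\<rangle>\<close> of a positive \<open>S\<close>, where the doubling inequality is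
  Cauchy--Schwarz, this replaces the functional calculus for \<open>S\<close>.\<close>

lemma geometric_growth_bound:
  fixes b :: "nat \<Rightarrow> real"
  assumes nonneg: "\<And>m. 0 \<le> b m" and double: "\<And>m. (b m)\<^sup>2 \<le> b (2 * m) * a"
    and growth: "\<And>m. b m \<le> K * s ^ m" and "0 \<le> a" "0 \<le> s"
  shows "b 1 \<le> s * a"
proof (rule ccontr)
  assume less: "\<not> ?thesis"
  have "a \<noteq> 0" using less double [of 1] by auto
  then have a: "a > 0" using \<open>0 \<le> a\<close> by simp
  have "s \<noteq> 0" using less growth [of 1] by auto
  then have s: "s > 0" using \<open>0 \<le> s\<close> by simp
  \<comment> \<open>Doubling iterated \<open>n\<close> times: with \<open>a\<close> divided out, it
    says that \<open>(b 1 / a) ^ (2 ^ n)\<close> is at most \<open>b (2 ^ n) / a\<close>.\<close>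
  have power: "b 1 ^ (2 ^ n) * a \<le> b (2 ^ n) * a ^ (2 ^ n)" for n
  proof (induction n)
    case (Suc n)
    have "(b 1 ^ (2 ^ Suc n) * a) * a = (b 1 ^ (2 ^ n) * a)\<^sup>2"
      by (simp add: power2_eq_square power_add mult_2 mult_ac)
    also have "\<dots> \<le> (b (2 ^ n) * a ^ (2 ^ n))\<^sup>2"
      by (rule power_mono [OF Suc]) (use nonneg a in simp)
    also have "\<dots> = (b (2 ^ n))\<^sup>2 * a ^ (2 ^ Suc n)"
      by (simp add: power_mult_distrib power_mult [symmetric] mult.commute)
    also have "\<dots> \<le> (b (2 ^ Suc n) * a) * a ^ (2 ^ Suc n)"
      using double [of "2 ^ n"] a by (intro mult_right_mono) auto
    finally have "(b 1 ^ (2 ^ Suc n) * a) * a \<le> (b (2 ^ Suc n) * a ^ (2 ^ Suc n)) * a"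
      by (simp add: mult_ac)
    then show ?case using a by simp
  qed simp
  \<comment> \<open>A ratio above 1 would have unbounded powers, whereas the growth hypothesis
    confines \<open>r ^ (2 ^ n)\<close> below \<open>K / a\<close> for every
    \<open>n\<close>.\<close>
  define r where "r = b 1 / (s * a)"
  have "r > 1" using less a s by (simp add: r_def)
  then obtain n where n: "K / a < r ^ n" using real_arch_pow by blast
  have "r ^ n \<le> r ^ (2 ^ n)" using \<open>r > 1\<close> by (intro power_increasing) (auto simp: less_imp_le)
  also have "r ^ (2 ^ n) \<le> K / a"
  proof -
    have "b 1 ^ (2 ^ n) * a \<le> K * s ^ (2 ^ n) * a ^ (2 ^ n)"
      by (rule order_trans [OF power mult_right_mono [OF growth]]) (use a in simp)
    then show ?thesis
      using a s by (simp add: r_def power_divide power_mult_distrib field_simps)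
  qed
  finally show False using n by simp
qed

text \<open>Lists encode formal sums, since a vector of the span has many representations. Comparing
  the values at \<open>id_blinfun\<close> and at \<open>T\<close> gives the map to be extended; that
  it is independent of the representation is known only after
  \<open>twisted_sum_bound\<close>.\<close>

definition twisted_sum :: "(('a::chilbert_space \<Rightarrow>\<^sub>L 'b::chilbert_space) \<times> 'a) list \<Rightarrow> ('a \<Rightarrow>\<^sub>L 'a) \<Rightarrow> 'b"
  where "twisted_sum ps T = (\<Sum>(N, h)\<leftarrow>ps. blinfun_apply N (blinfun_apply T h))"

lemma twisted_sum_simps [simp]:
  "twisted_sum [] T = 0"
  "twisted_sum ((N, h) # ps) T = blinfun_apply N (blinfun_apply T h) + twisted_sum ps T"
  "twisted_sum (ps @ qs) T = twisted_sum ps T + twisted_sum qs T"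
  by (simp_all add: twisted_sum_def)

text \<open>Twisting by \<open>T\<close> and by \<open>adj T\<close> are adjoint to each other
  already on formal sums: moving \<open>N'\<close> to the left creates \<open>adj N' N\<close>, with
  which \<open>T\<close> commutes. The two inductions run over the two lists.\<close>

lemma twisted_sum_move:
  assumes M: "M \<subseteq> bop" and T: "T \<in> bop"
    and comm: "\<And>N1 N2. N1 \<in> M \<Longrightarrow> N2 \<in> M \<Longrightarrow> T o\<^sub>L (adj N1 o\<^sub>L N2) = adj N1 o\<^sub>L N2 o\<^sub>L T"
    and ps: "set ps \<subseteq> M \<times> UNIV" and qs: "set qs \<subseteq> M \<times> UNIV"
  shows "cinner (twisted_sum ps (T o\<^sub>L S)) (twisted_sum qs U)
    = cinner (twisted_sum ps S) (twisted_sum qs (adj T o\<^sub>L U))"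
  using ps
proof (induction ps)
  case (Cons p ps)
  obtain N h where p: "p = (N, h)" "N \<in> M" using Cons.prems by auto
  have "cinner (blinfun_apply N (blinfun_apply (T o\<^sub>L S) h)) (twisted_sum qs U)
      = cinner (blinfun_apply N (blinfun_apply S h)) (twisted_sum qs (adj T o\<^sub>L U))"
    using qs
  proof (induction qs)
    case (Cons q qs)
    obtain N' k where q: "q = (N', k)" "N' \<in> M" using Cons.prems by auto
    have N'b: "N' \<in> bop" using q M by blast
    have comm': "blinfun_apply T (blinfun_apply (adj N') (blinfun_apply N x))
        = blinfun_apply (adj N') (blinfun_apply N (blinfun_apply T x))" for x
      using comm [OF q(2) p(2)] by (metis blinfun_apply_blinfun_compose)
    have "cinner (blinfun_apply N (blinfun_apply T (blinfun_apply S h))) (blinfun_apply N' (blinfun_apply U k))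
      = cinner (blinfun_apply N (blinfun_apply S h)) (blinfun_apply N' (blinfun_apply (adj T) (blinfun_apply U k)))"
      by (simp add: cinner_adj_left [OF N'b, symmetric] comm' [symmetric] cinner_adj_right [OF T])
    then show ?case using Cons by (simp add: q cinner_add_right)
  qed simp
  then show ?case using Cons by (simp add: p cinner_add_left)
qed simp

text \<open>With \<open>S = adj T T\<close>, the vectors \<open>u n\<close> twisted by the powers of
  \<open>S\<close> grow at most like \<open>norm S ^ n\<close>, though with a constant depending on
  the list. Since \<open>cinner (u (2 * m)) (u 0)\<close> is the squared norm of \<open>u m\<close>,
  \<open>geometric_growth_bound\<close> removes the constant, and the case of exponent 1 is the
  claim.\<close>

lemma twisted_sum_bound:
  assumes M: "M \<subseteq> bop" and T: "T \<in> bop"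
    and comm: "\<And>N1 N2. N1 \<in> M \<Longrightarrow> N2 \<in> M \<Longrightarrow> T o\<^sub>L (adj N1 o\<^sub>L N2) = adj N1 o\<^sub>L N2 o\<^sub>L T"
    and comm_adj: "\<And>N1 N2. N1 \<in> M \<Longrightarrow> N2 \<in> M \<Longrightarrow> adj T o\<^sub>L (adj N1 o\<^sub>L N2) = adj N1 o\<^sub>L N2 o\<^sub>L adj T"
    and ps: "set ps \<subseteq> M \<times> UNIV"
  shows "norm (twisted_sum ps T) \<le> sqrt (norm (adj T o\<^sub>L T)) * norm (twisted_sum ps id_blinfun)"
proof -
  define S where "S = adj T o\<^sub>L T"
  have S: "S \<in> bop" "adj S = S" using T by (auto simp: S_def adj_compose)
  have commS: "S o\<^sub>L (adj N1 o\<^sub>L N2) = adj N1 o\<^sub>L N2 o\<^sub>L S" if "N1 \<in> M" "N2 \<in> M" for N1 N2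
  proof -
    have "S o\<^sub>L (adj N1 o\<^sub>L N2) = adj T o\<^sub>L (adj N1 o\<^sub>L N2 o\<^sub>L T)"
      by (simp only: S_def compose_assoc [of "adj T"] comm [OF that])
    also have "\<dots> = (adj T o\<^sub>L (adj N1 o\<^sub>L N2)) o\<^sub>L T" by (simp only: compose_assoc)
    finally show ?thesis by (simp only: comm_adj [OF that] S_def compose_assoc)
  qed
  define pw where "pw n = ((o\<^sub>L) S ^^ n) id_blinfun" for n :: nat
  have pw_0: "pw 0 = id_blinfun" and pw_Suc: "pw (Suc n) = S o\<^sub>L pw n" for n
    by (simp_all add: pw_def)
  define u where "u n = twisted_sum ps (pw n)" for n
  have move: "cinner (u (Suc m)) (u n) = cinner (u m) (u (Suc n))" for m n
    using twisted_sum_move [OF M S(1) commS ps ps, of "pw m" "pw n"]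
    by (simp add: u_def pw_Suc S(2))
  \<comment> \<open>Powers of the self-adjoint \<open>S\<close> move freely between the two
    arguments.\<close>
  have shift: "cinner (u (m + n)) (u k) = cinner (u m) (u (n + k))" for m n k
    by (induction n arbitrary: k) (simp_all add: move)
  \<comment> \<open>The termwise estimate; its constant is the sum of the products
    \<open>norm N * norm h\<close> over the list.\<close>
  have "\<exists>K\<ge>0. \<forall>n. norm (u n) \<le> K * norm S ^ n"
    unfolding u_def using ps
  proof (induction ps)
    case (Cons p ps)
    obtain N h where p: "p = (N, h)" by (cases p)
    obtain K where K: "K \<ge> 0" "\<And>n. norm (twisted_sum ps (pw n)) \<le> K * norm S ^ n"
      using Cons by auto
    have pw_norm: "norm (blinfun_apply (pw n) h) \<le> norm S ^ n * norm h" for n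
    proof (induction n)
      case (Suc n)
      have "norm (blinfun_apply (pw (Suc n)) h) \<le> norm S * norm (blinfun_apply (pw n) h)"
        by (simp add: pw_Suc norm_blinfun)
      also have "\<dots> \<le> norm S * (norm S ^ n * norm h)" by (rule mult_left_mono [OF Suc]) simp
      finally show ?case by (simp add: mult_ac)
    qed (simp add: pw_0)
    have "norm (twisted_sum (p # ps) (pw n)) \<le> (norm N * norm h + K) * norm S ^ n" for n
    proof -
      have "norm (blinfun_apply N (blinfun_apply (pw n) h)) \<le> norm N * (norm S ^ n * norm h)"
        by (rule order_trans [OF norm_blinfun mult_left_mono [OF pw_norm]]) simp
      then have "norm (twisted_sum (p # ps) (pw n)) \<le> norm N * (norm S ^ n * norm h) + K * norm S ^ n"
        unfolding p twisted_sum_simps using K(2) by (intro norm_triangle_mono) auto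
      then show ?thesis by (simp add: algebra_simps)
    qed
    then show ?case using K(1) by (intro exI [of _ "norm N * norm h + K"]) simp
  qed (auto intro: exI [of _ 0])
  then obtain K where K: "\<And>n. norm (u n) \<le> K * norm S ^ n" by blast
  have "cmod (cinner (u 1) (u 0)) \<le> norm S * (norm (u 0))\<^sup>2"
  proof (rule geometric_growth_bound [where b = "\<lambda>m. cmod (cinner (u m) (u 0))" and K = "K * norm (u 0)"])
    fix m
    have "(cmod (cinner (u m) (u 0)))\<^sup>2 \<le> (norm (u m) * norm (u 0))\<^sup>2"
      by (rule power_mono [OF cinner_bound]) simp
    also have "(norm (u m))\<^sup>2 = cmod (cinner (u (2 * m)) (u 0))"
      using shift [of m m 0] by (simp add: mult_2 cinner_self norm_power)
    then have "(norm (u m) * norm (u 0))\<^sup>2 = cmod (cinner (u (2 * m)) (u 0)) * (norm (u 0))\<^sup>2"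
      by (simp add: power_mult_distrib)
    finally show "(cmod (cinner (u m) (u 0)))\<^sup>2 \<le> cmod (cinner (u (2 * m)) (u 0)) * (norm (u 0))\<^sup>2" .
    show "cmod (cinner (u m) (u 0)) \<le> K * norm (u 0) * norm S ^ m"
      using order_trans [OF cinner_bound mult_right_mono [OF K [of m], of "norm (u 0)"]] by (simp add: mult_ac)
  qed auto
  moreover have "cinner (u 1) (u 0) = cinner (twisted_sum ps T) (twisted_sum ps T)"
    using twisted_sum_move [OF M _ comm_adj ps ps, of T id_blinfun] T
    by (simp add: u_def pw_0 pw_Suc S_def)
  ultimately have "(norm (twisted_sum ps T))\<^sup>2 \<le> norm S * (norm (twisted_sum ps id_blinfun))\<^sup>2"
    by (simp add: cinner_self norm_power u_def pw_0)
  also have "\<dots> = (sqrt (norm S) * norm (twisted_sum ps id_blinfun))\<^sup>2"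
    by (simp add: power_mult_distrib)
  finally show ?thesis unfolding S_def by (rule power2_le_imp_le) simp
qed

text \<open>The conditions are invariant under exchanging \<open>A\<close> and \<open>B\<close>
  while passing from \<open>M\<close> to its adjoints, so by \<open>swap\<close> every statement
  here holds in both directions.\<close>

locale tro_link =
  fixes A :: "('a::chilbert_space \<Rightarrow>\<^sub>L 'a) set" and B :: "('b::chilbert_space \<Rightarrow>\<^sub>L 'b) set"
    and M :: "('a \<Rightarrow>\<^sub>L 'b) set"
  assumes M: "M \<subseteq> bop" and uA: "unital_algebra A" and uB: "unital_algebra B"
    and A_eq: "A = weak_star_topology closure_of op.span ((adj ` M) \<cdot> B \<cdot> M)"
    and B_eq: "B = weak_star_topology closure_of op.span (M \<cdot> A \<cdot> (adj ` M))"
begin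

lemma Mb: "N \<in> M \<Longrightarrow> N \<in> bop"
  using M by blast

lemma Ab: "A \<subseteq> bop" and Bb: "B \<subseteq> bop" and A_id: "id_blinfun \<in> A" and B_id: "id_blinfun \<in> B"
  using uA uB by (auto simp: unital_algebra_def)

lemma adj_adj_image: "adj ` adj ` M = M"
  using Mb by (force simp: image_image)

lemma swap: "tro_link B A (adj ` M)"
proof
  show "adj ` M \<subseteq> bop" using Mb by auto
  show "B = weak_star_topology closure_of op.span (adj ` adj ` M \<cdot> A \<cdot> adj ` M)"
    unfolding adj_adj_image by (rule B_eq)
  show "A = weak_star_topology closure_of op.span (adj ` M \<cdot> B \<cdot> adj ` adj ` M)"
    unfolding adj_adj_image by (rule A_eq)
qed (fact uA uB)+

lemma conj_in_A:
  assumes "N1 \<in> M" "N2 \<in> M" "T \<in> B"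
  shows "adj N1 o\<^sub>L T o\<^sub>L N2 \<in> A"
proof -
  have "adj ` M \<cdot> B \<cdot> M \<subseteq> bop" using Mb Bb by (auto simp: op_mult_def subset_iff)
  then have "op.span (adj ` M \<cdot> B \<cdot> M) \<subseteq> bop" by (rule op.span_minimal [OF _ op_subspace_bop])
  then have "op.span (adj ` M \<cdot> B \<cdot> M) \<subseteq> A"
    by (subst A_eq) (simp add: closure_of_subset)
  moreover have "adj N1 o\<^sub>L T o\<^sub>L N2 \<in> op.span (adj ` M \<cdot> B \<cdot> M)"
    by (intro op.span_base op_mult_tripleI imageI assms)
  ultimately show ?thesis by blast
qed

text \<open>A vector \<open>y\<close> orthogonal to all \<open>N h\<close> is orthogonal to the
  range of every operator in the span of \<open>M A (adj M)\<close>. The weak-* closure of that span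
  is \<open>B\<close> and contains the identity, so \<open>y\<close> is orthogonal to
  itself.\<close>

lemma total:
  assumes "\<And>N h. N \<in> M \<Longrightarrow> cinner (blinfun_apply N h) y = 0"
  shows "y = 0"
proof -
  have id: "id_blinfun \<in> weak_star_topology closure_of op.span (M \<cdot> A \<cdot> adj ` M)"
    using B_id B_eq by simp
  have "op.subspace {X. \<forall>v. cinner (blinfun_apply X v) y = 0}"
    by (rule op.subspaceI) (auto simp: blinfun.add_left cinner_add_left cinner_scaleC_left)
  then have "op.span (M \<cdot> A \<cdot> adj ` M) \<subseteq> {X. \<forall>v. cinner (blinfun_apply X v) y = 0}"
    by (rule op.span_minimal [rotated]) (auto elim!: op_mult_tripleE simp: assms)
  then have "cinner (blinfun_apply id_blinfun y) y = 0"
    by (intro weak_star_closure_vector_functional [OF id]) blast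
  then show ?thesis by (simp add: cinner_self)
qed

lemma blinfun_eqI_total:
  assumes "X \<in> bop" "Y \<in> bop" and eq: "\<And>N. N \<in> M \<Longrightarrow> X o\<^sub>L N = Y o\<^sub>L N"
  shows "X = Y"
proof -
  have "blinfun_apply (adj (X - Y)) z = 0" for z
  proof (rule total)
    fix N h assume "N \<in> M"
    have "blinfun_apply X (blinfun_apply N h) = blinfun_apply Y (blinfun_apply N h)"
      using eq [OF \<open>N \<in> M\<close>] by (metis blinfun_apply_blinfun_compose)
    then show "cinner (blinfun_apply N h) (blinfun_apply (adj (X - Y)) z) = 0"
      by (simp add: cinner_adj_right assms blinfun.diff_left)
  qed
  then have "adj (X - Y) = 0" by (intro blinfun_eqI) simp
  then have "adj (adj (X - Y)) = 0" by simp
  then show ?thesis using assms(1,2) by simp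
qed

text \<open>With \<open>T\<close> the identity this puts every \<open>adj N1 N2\<close> into the
  diagonal of \<open>A\<close>, which is why operators of its commutant can be transported; general
  \<open>T\<close> is used to see where the transported operators commute.\<close>

lemma adj_compose_diagonal:
  assumes "N1 \<in> M" "N2 \<in> M" "T \<in> diagonal B"
  shows "adj N1 o\<^sub>L T o\<^sub>L N2 \<in> diagonal A"
proof (rule diagonalI)
  have T: "T \<in> B" "adj T \<in> B" "T \<in> bop"
    using assms(3) Bb by (auto simp: diagonal_def subset_iff)
  show "adj N1 o\<^sub>L T o\<^sub>L N2 \<in> A" by (rule conj_in_A [OF assms(1,2) T(1)])
  show "adj N1 o\<^sub>L T o\<^sub>L N2 \<in> bop" using assms Mb T by simp
  have "adj (adj N1 o\<^sub>L T o\<^sub>L N2) = adj N2 o\<^sub>L adj T o\<^sub>L N1"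
    using assms Mb T by (simp add: adj_compose compose_assoc)
  then show "adj (adj N1 o\<^sub>L T o\<^sub>L N2) \<in> A" using conj_in_A [OF assms(2,1) T(2)] by simp
qed

lemma adj_compose_commutes:
  assumes "T \<in> commutant (diagonal A)" "N1 \<in> M" "N2 \<in> M" "S \<in> diagonal B"
  shows "T o\<^sub>L (adj N1 o\<^sub>L S o\<^sub>L N2) = adj N1 o\<^sub>L S o\<^sub>L N2 o\<^sub>L T"
  by (rule commutantD(2) [OF assms(1) adj_compose_diagonal [OF assms(2-4)]])

lemma id_diagonal: "id_blinfun \<in> diagonal B"
  using B_id by (intro diagonalI) auto

lemma induced_operator_ex:
  assumes T: "T \<in> commutant (diagonal A)"
  shows "\<exists>X. X \<in> bop \<and> (\<forall>N\<in>M. X o\<^sub>L N = N o\<^sub>L T)"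
proof -
  have Tb: "T \<in> bop" using T by (rule commutantD)
  have comm: "T' o\<^sub>L (adj N1 o\<^sub>L N2) = adj N1 o\<^sub>L N2 o\<^sub>L T'"
    if "T' \<in> commutant (diagonal A)" "N1 \<in> M" "N2 \<in> M" for T' N1 N2
    using adj_compose_commutes [OF that id_diagonal] by simp
  have adjT: "adj T \<in> commutant (diagonal A)"
    by (rule commutant_adj [OF diagonal_bop [OF Ab] diagonal_adj [OF Ab] T])
  let ?G = "(\<lambda>ps. (twisted_sum ps id_blinfun, twisted_sum ps T)) ` {ps. set ps \<subseteq> M \<times> UNIV}"
  have G_scale: "(c *\<^sub>C x, c *\<^sub>C y) \<in> ?G" if "(x, y) \<in> ?G" for c x y
  proof -
    obtain ps where ps: "set ps \<subseteq> M \<times> UNIV" "x = twisted_sum ps id_blinfun" "y = twisted_sum ps T"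
      using \<open>(x, y) \<in> ?G\<close> by blast
    have "twisted_sum (map (\<lambda>(N, h). (N, c *\<^sub>C h)) ps) S = c *\<^sub>C twisted_sum ps S" if "S \<in> bop" for S
      using ps(1) by (induction ps) (auto simp: scaleC_zero_right scaleC_add_right bopD Mb that)
    then show ?thesis
      using ps Tb by (intro image_eqI [of _ _ "map (\<lambda>(N, h). (N, c *\<^sub>C h)) ps"]) auto
  qed
  have G_add: "(x + x', y + y') \<in> ?G" if "(x, y) \<in> ?G" "(x', y') \<in> ?G" for x y x' y'
  proof -
    obtain ps qs where "set ps \<subseteq> M \<times> UNIV" "x = twisted_sum ps id_blinfun" "y = twisted_sum ps T"
      "set qs \<subseteq> M \<times> UNIV" "x' = twisted_sum qs id_blinfun" "y' = twisted_sum qs T"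
      using \<open>(x, y) \<in> ?G\<close> \<open>(x', y') \<in> ?G\<close> by blast
    then show ?thesis by (intro image_eqI [of _ _ "ps @ qs"]) auto
  qed
  have G_zero: "(0, 0) \<in> ?G" by (rule image_eqI [of _ _ "[]"]) auto
  have G_bound: "norm y \<le> sqrt (norm (adj T o\<^sub>L T)) * norm x" if "(x, y) \<in> ?G" for x y
    using that twisted_sum_bound [OF M Tb comm [OF T] comm [OF adjT]] by auto
  obtain X :: "'b \<Rightarrow>\<^sub>L 'b" where X: "X \<in> bop" "\<And>x y. (x, y) \<in> ?G \<Longrightarrow> blinfun_apply X x = y"
    by (rule operator_of_relation [OF G_zero G_add G_scale G_bound]) auto
  have "X o\<^sub>L N = N o\<^sub>L T" if "N \<in> M" for N
  proof (rule blinfun_eqI)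
    fix h
    have "(blinfun_apply N h, blinfun_apply N (blinfun_apply T h)) \<in> ?G"
      by (rule image_eqI [of _ _ "[(N, h)]"]) (use that in auto)
    then show "blinfun_apply (X o\<^sub>L N) h = blinfun_apply (N o\<^sub>L T) h" using X(2) by simp
  qed
  with X(1) show ?thesis by blast
qed

text \<open>For \<open>T\<close> in the commutant of the diagonal the choice is canonical: by
  totality of the vectors \<open>N h\<close> at most one operator qualifies, as
  \<open>induced_eqI\<close> records.\<close>

definition induced :: "('a \<Rightarrow>\<^sub>L 'a) \<Rightarrow> ('b \<Rightarrow>\<^sub>L 'b)"
  where "induced T = (SOME X. X \<in> bop \<and> (\<forall>N\<in>M. X o\<^sub>L N = N o\<^sub>L T))"

lemma induced_bop: "T \<in> commutant (diagonal A) \<Longrightarrow> induced T \<in> bop"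
  and induced_compose: "T \<in> commutant (diagonal A) \<Longrightarrow> N \<in> M \<Longrightarrow> induced T o\<^sub>L N = N o\<^sub>L T"
  using someI_ex [OF induced_operator_ex] unfolding induced_def by blast+

lemma induced_eqI:
  assumes "T \<in> commutant (diagonal A)" "X \<in> bop" "\<And>N. N \<in> M \<Longrightarrow> X o\<^sub>L N = N o\<^sub>L T"
  shows "induced T = X"
  using assms by (intro blinfun_eqI_total) (auto simp: induced_bop induced_compose)

lemma commutant_diagonal_adj: "T \<in> commutant (diagonal A) \<Longrightarrow> adj T \<in> commutant (diagonal A)"
  by (rule commutant_adj [OF diagonal_bop [OF Ab] diagonal_adj [OF Ab]])

text \<open>\<open>T\<close> commutes with \<open>adj N2 S N1\<close>. With \<open>S\<close> the
  identity this identifies the adjoint of the induced operator; general \<open>S\<close> gives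
  commutation with the diagonal of \<open>B\<close>.\<close>

lemma cinner_induced:
  assumes T: "T \<in> commutant (diagonal A)" and N: "N1 \<in> M" "N2 \<in> M" and S: "S \<in> diagonal B"
  shows "cinner (blinfun_apply S (blinfun_apply N1 (blinfun_apply T h))) (blinfun_apply N2 k)
    = cinner (blinfun_apply S (blinfun_apply N1 h)) (blinfun_apply N2 (blinfun_apply (adj T) k))"
proof -
  have "blinfun_apply (adj N2) (blinfun_apply S (blinfun_apply N1 (blinfun_apply T h)))
      = blinfun_apply T (blinfun_apply (adj N2) (blinfun_apply S (blinfun_apply N1 h)))"
    using adj_compose_commutes [OF T N(2,1) S] by (metis blinfun_apply_blinfun_compose)
  then have "cinner (blinfun_apply (adj N2) (blinfun_apply S (blinfun_apply N1 (blinfun_apply T h)))) k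
      = cinner (blinfun_apply (adj N2) (blinfun_apply S (blinfun_apply N1 h))) (blinfun_apply (adj T) k)"
    using commutantD(1) [OF T] by (simp add: cinner_adj_right)
  then show ?thesis using Mb N by (simp add: cinner_adj_left)
qed

lemma induced_adj:
  assumes T: "T \<in> commutant (diagonal A)"
  shows "induced (adj T) = adj (induced T)"
proof (rule induced_eqI [OF commutant_diagonal_adj [OF T]])
  fix N assume N: "N \<in> M"
  show "adj (induced T) o\<^sub>L N = N o\<^sub>L adj T"
  proof (rule blinfun_eqI)
    fix k
    have "blinfun_apply (adj (induced T)) (blinfun_apply N k) - blinfun_apply N (blinfun_apply (adj T) k) = 0"
    proof (rule total)
      fix N1 h assume N1: "N1 \<in> M"
      have "blinfun_apply (induced T) (blinfun_apply N1 h) = blinfun_apply N1 (blinfun_apply T h)"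
        using induced_compose [OF T N1] by (metis blinfun_apply_blinfun_compose)
      then show "cinner (blinfun_apply N1 h) (blinfun_apply (adj (induced T)) (blinfun_apply N k)
          - blinfun_apply N (blinfun_apply (adj T) k)) = 0"
        using cinner_induced [OF T N1 N id_diagonal, of h k]
        by (simp add: cinner_diff_right cinner_adj_right induced_bop T)
    qed
    then show "blinfun_apply (adj (induced T) o\<^sub>L N) k = blinfun_apply (N o\<^sub>L adj T) k" by simp
  qed
qed (simp add: induced_bop T)

lemma induced_commutant:
  assumes T: "T \<in> commutant (diagonal A)"
  shows "induced T \<in> commutant (diagonal B)"
proof (rule commutantI [OF induced_bop [OF T]])
  fix S assume S: "S \<in> diagonal B"
  have Sb: "S \<in> bop" using S diagonal_bop [OF Bb] by blast
  show "induced T o\<^sub>L S = S o\<^sub>L induced T"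
  proof (rule blinfun_eqI_total)
    fix N assume N: "N \<in> M"
    show "induced T o\<^sub>L S o\<^sub>L N = S o\<^sub>L induced T o\<^sub>L N"
    proof (rule blinfun_eqI)
      fix h
      have "blinfun_apply (induced T) (blinfun_apply S (blinfun_apply N h))
          - blinfun_apply S (blinfun_apply N (blinfun_apply T h)) = 0" (is "?d = 0")
      proof (rule total)
        fix N2 k assume N2: "N2 \<in> M"
        have "blinfun_apply (adj (induced T)) (blinfun_apply N2 k) = blinfun_apply N2 (blinfun_apply (adj T) k)"
          using induced_compose [OF commutant_diagonal_adj [OF T] N2]
          by (metis blinfun_apply_blinfun_compose induced_adj [OF T])
        then have "cinner (blinfun_apply (induced T) (blinfun_apply S (blinfun_apply N h))) (blinfun_apply N2 k)
            = cinner (blinfun_apply S (blinfun_apply N h)) (blinfun_apply N2 (blinfun_apply (adj T) k))"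
          by (simp add: cinner_adj_right [OF induced_bop [OF T], symmetric])
        then have "cinner ?d (blinfun_apply N2 k) = 0"
          using cinner_induced [OF T N N2 S, of h k] by (simp add: cinner_diff_left)
        then show "cinner (blinfun_apply N2 k) ?d = 0" by (metis cinner_commute complex_cnj_zero)
      qed
      moreover have "blinfun_apply (induced T) (blinfun_apply N h) = blinfun_apply N (blinfun_apply T h)"
        using induced_compose [OF T N] by (metis blinfun_apply_blinfun_compose)
      ultimately show "blinfun_apply (induced T o\<^sub>L S o\<^sub>L N) h = blinfun_apply (S o\<^sub>L induced T o\<^sub>L N) h"
        by simp
    qed
  qed (simp_all add: Sb induced_bop T)
qed

lemma induced_add:
  assumes "S \<in> commutant (diagonal A)" "T \<in> commutant (diagonal A)"
  shows "induced (S + T) = induced S + induced T"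
  using assms by (intro induced_eqI)
    (auto simp: commutant_add induced_bop compose_add_left compose_add_right induced_compose)

lemma induced_op_scale:
  assumes "T \<in> commutant (diagonal A)"
  shows "induced (op_scale c T) = op_scale c (induced T)"
  using assms by (intro induced_eqI)
    (auto simp: commutant_op_scale [OF diagonal_bop [OF Ab]] induced_bop op_scale_compose_left
      op_scale_compose_right induced_compose Mb)

lemma induced_mult:
  assumes "S \<in> commutant (diagonal A)" "T \<in> commutant (diagonal A)"
  shows "induced (S o\<^sub>L T) = induced S o\<^sub>L induced T"
proof (rule induced_eqI [OF commutant_compose [OF assms]])
  fix N assume "N \<in> M"
  then show "induced S o\<^sub>L induced T o\<^sub>L N = N o\<^sub>L (S o\<^sub>L T)"
    by (simp only: compose_assoc induced_compose [OF assms(2)])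
      (simp only: compose_assoc [symmetric] induced_compose [OF assms(1)])
qed (simp add: induced_bop assms)

text \<open>The adjoint of the relation that defines \<open>induced (adj T)\<close> is the relation
  saying that \<open>T\<close> is induced by \<open>induced T\<close> along the adjoints of
  \<open>M\<close>. Bijectivity follows by symmetry.\<close>

lemma induced_inverse:
  assumes T: "T \<in> commutant (diagonal A)"
  shows "tro_link.induced (adj ` M) (induced T) = T"
proof -
  interpret swap: tro_link B A "adj ` M" by (rule swap)
  show ?thesis
  proof (rule swap.induced_eqI [OF induced_commutant [OF T] commutantD(1) [OF T]])
    fix N assume "N \<in> adj ` M"
    then obtain N' where N': "N' \<in> M" "N = adj N'" by blast
    have "adj (induced (adj T) o\<^sub>L N') = adj (N' o\<^sub>L adj T)"
      by (simp add: induced_compose [OF commutant_diagonal_adj [OF T] N'(1)])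
    then show "T o\<^sub>L N = N o\<^sub>L induced T"
      using N' Mb commutantD(1) [OF T] by (simp add: induced_adj [OF T] adj_compose induced_bop T)
  qed
qed

lemma induced_star_isomorphism:
  "star_isomorphism induced (commutant (diagonal A)) (commutant (diagonal B))"
proof -
  interpret swap: tro_link B A "adj ` M" by (rule swap)
  have "bij_betw induced (commutant (diagonal A)) (commutant (diagonal B))"
  proof (rule bij_betw_byWitness [where f' = swap.induced])
    show "\<forall>T\<in>commutant (diagonal A). swap.induced (induced T) = T" by (simp add: induced_inverse)
    show "\<forall>T\<in>commutant (diagonal B). induced (swap.induced T) = T"
      using swap.induced_inverse by (simp add: adj_adj_image)
  qed (use induced_commutant swap.induced_commutant in auto)
  then show ?thesis
    by (simp add: star_isomorphism_def induced_add induced_op_scale induced_mult induced_adj)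
qed

text \<open>On generators \<open>N1 T (adj N2)\<close> of \<open>B\<close> the induced projection
  moves inwards to \<open>L\<close>, where invariance under \<open>T\<close> applies. The algebra of
  all operators leaving the induced projections invariant is weak-* closed, so it contains
  \<open>B\<close>.\<close>

lemma induced_Lat: "induced ` Lat A \<subseteq> Lat B"
proof -
  have proj: "induced ` Lat A \<subseteq> projections"
  proof
    fix P assume "P \<in> induced ` Lat A"
    then obtain L where L: "L \<in> Lat A" "P = induced L" by blast
    then have "L \<in> commutant (diagonal A)" "L o\<^sub>L L = L" "adj L = L"
      using Lat_subset_commutant_diagonal [OF Ab] by (auto simp: Lat_def projections_def)
    then show "P \<in> projections"
      unfolding L(2) projections_def
      using induced_mult [of L L] induced_adj [of L] by (simp add: induced_bop)
  qed
  have gen: "N1 o\<^sub>L T o\<^sub>L adj N2 \<in> Alg (induced ` Lat A)" if N: "N1 \<in> M" "N2 \<in> M" and T: "T \<in> A" for N1 N2 T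
  proof (rule AlgI)
    show "N1 o\<^sub>L T o\<^sub>L adj N2 \<in> bop" using N T Mb Ab by auto
    fix P assume "P \<in> induced ` Lat A"
    then obtain L where L: "L \<in> Lat A" "P = induced L" by blast
    have Lc: "L \<in> commutant (diagonal A)" using L Lat_subset_commutant_diagonal [OF Ab] by blast
    have zero: "(id_blinfun - L) o\<^sub>L T o\<^sub>L L = 0" and Ladj: "adj L = L"
      using L T by (auto simp: Lat_def projections_def)
    have "adj (induced L o\<^sub>L N2) = adj (N2 o\<^sub>L L)" by (simp add: induced_compose Lc N)
    then have right: "adj N2 o\<^sub>L induced L = L o\<^sub>L adj N2"
      using N Mb commutantD(1) [OF Lc] induced_adj [OF Lc] Ladj
      by (simp add: adj_compose induced_bop Lc)
    have left: "(id_blinfun - induced L) o\<^sub>L N1 = N1 o\<^sub>L (id_blinfun - L)"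
      by (simp add: compose_diff_left compose_diff_right induced_compose Lc N)
    have "(id_blinfun - P) o\<^sub>L (N1 o\<^sub>L T o\<^sub>L adj N2) o\<^sub>L P
        = ((id_blinfun - induced L) o\<^sub>L N1) o\<^sub>L T o\<^sub>L (adj N2 o\<^sub>L induced L)"
      by (simp only: L(2) compose_assoc)
    also have "\<dots> = N1 o\<^sub>L ((id_blinfun - L) o\<^sub>L T o\<^sub>L L) o\<^sub>L adj N2"
      by (simp only: left right compose_assoc)
    also have "\<dots> = 0" by (simp add: zero)
    finally show "(id_blinfun - P) o\<^sub>L (N1 o\<^sub>L T o\<^sub>L adj N2) o\<^sub>L P = 0" .
  qed
  have "op.span (M \<cdot> A \<cdot> adj ` M) \<subseteq> Alg (induced ` Lat A)"
    using proj by (intro op.span_minimal op_subspace_Alg)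
      (auto elim!: op_mult_tripleE simp: projections_bop subset_iff gen)
  then have "B \<subseteq> Alg (induced ` Lat A)"
    by (subst B_eq) (rule weak_star_closure_Alg [OF _ proj])
  then show ?thesis
    using proj Alg_compl unfolding Lat_def by blast
qed

lemma induced_Lat_eq: "induced ` Lat A = Lat B"
proof
  show "induced ` Lat A \<subseteq> Lat B" by (rule induced_Lat)
  interpret swap: tro_link B A "adj ` M" by (rule swap)
  show "Lat B \<subseteq> induced ` Lat A"
  proof
    fix L assume L: "L \<in> Lat B"
    then have "L \<in> commutant (diagonal B)" using Lat_subset_commutant_diagonal [OF Bb] by blast
    then have "L = induced (swap.induced L)" using swap.induced_inverse by (simp add: adj_adj_image)
    then show "L \<in> induced ` Lat A" using swap.induced_Lat L by blast
  qed
qed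

end

section \<open>The two directions combined\<close>

section \<open>TRO equivalence\<close>

text \<open>Conjugation by intertwiners preserves invariance of corresponding projections, and
  reflexivity turns this into membership in \<open>A\<close> or \<open>B\<close>. One inclusion then
  comes from the approximation argument, the other from weak-* closedness of
  \<open>Alg\<close>.\<close>

lemma star_isomorphism_imp_closure:
  fixes A :: "('a::chilbert_space \<Rightarrow>\<^sub>L 'a) set" and B :: "('b::chilbert_space \<Rightarrow>\<^sub>L 'b) set"
  assumes "commutant_isomorphism (diagonal A) (diagonal B) \<theta>"
    and A: "A \<subseteq> bop" "reflexive A" and B: "B \<subseteq> bop" "reflexive B"
    and Lat: "\<theta> ` Lat A = Lat B"
  shows "A = weak_star_topology closure_of
    op.span (adj ` intertwiners (commutant (diagonal A)) \<theta> \<cdot> B \<cdot> intertwiners (commutant (diagonal A)) \<theta>)"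
proof -
  interpret commutant_isomorphism "diagonal A" "diagonal B" \<theta> by fact
  interpret inv: commutant_isomorphism "diagonal B" "diagonal A" "inv_into (commutant (diagonal A)) \<theta>"
    by (rule inverse_isomorphism)
  let ?M = "intertwiners (commutant (diagonal A)) \<theta>" and ?i = "inv_into (commutant (diagonal A)) \<theta>"
  have LatA: "Lat A \<subseteq> commutant (diagonal A)" and LatB: "Lat B \<subseteq> commutant (diagonal B)"
    using A B by (auto dest!: Lat_subset_commutant_diagonal)
  have A_eq: "A = Alg (Lat A)" and B_eq: "B = Alg (Lat B)" using A B by (auto simp: reflexive_def)
  have Lat_inv: "?i ` Lat B = Lat A"
    unfolding Lat [symmetric] by (rule inv_into_image_cancel [OF inj LatA])
  have Mb: "N \<in> bop" if "N \<in> ?M" for N using that by (rule intertwinersD)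
  have MBM: "adj N1 o\<^sub>L S o\<^sub>L N2 \<in> A" if "N1 \<in> ?M" "N2 \<in> ?M" "S \<in> B" for N1 N2 S
    using intertwiners_conj_Alg [OF LatA that(1,2)] that(3) Lat A_eq B_eq by simp
  have MAM: "N1 o\<^sub>L T o\<^sub>L adj N2 \<in> B" if N: "N1 \<in> ?M" "N2 \<in> ?M" and "T \<in> A" for N1 N2 T
  proof -
    \<comment> \<open>Writing \<open>N1\<close> as a double adjoint presents the operator as a
      conjugation by intertwiners of the inverse isomorphism.\<close>
    have "adj (adj N1) o\<^sub>L T o\<^sub>L adj N2 \<in> Alg (Lat B)"
      by (rule inv.intertwiners_conj_Alg [OF LatB])
        (use that A_eq Lat_inv intertwiners_inverse in auto)
    then show ?thesis using Mb [OF N(1)] B_eq by simp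
  qed
  show ?thesis
  proof
    show "A \<subseteq> weak_star_topology closure_of op.span (adj ` ?M \<cdot> B \<cdot> ?M)"
    proof (rule subset_weak_star_closure_tro [OF tro_intertwiners _ A(1) B(1) MAM])
      show "h = 0" if "\<And>N. N \<in> ?M \<Longrightarrow> blinfun_apply N h = 0" for h
        using that intertwiners_separating [of h] by blast
    qed
    have Lat_proj: "Lat A \<subseteq> bop" using Lat_subset_projections projections_bop by blast
    have "op.span (adj ` ?M \<cdot> B \<cdot> ?M) \<subseteq> Alg (Lat A)"
      by (intro op.span_minimal op_subspace_Alg [OF Lat_proj])
        (use MBM A_eq in \<open>auto elim!: op_mult_tripleE\<close>)
    then show "weak_star_topology closure_of op.span (adj ` ?M \<cdot> B \<cdot> ?M) \<subseteq> A"
      using weak_star_closure_Alg [OF _ Lat_subset_projections] A_eq by metis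
  qed
qed

theorem theorem3p3:
  fixes A :: "('a::chilbert_space \<Rightarrow>\<^sub>L 'a) set"
    and B :: "('b::chilbert_space \<Rightarrow>\<^sub>L 'b) set"
  assumes "unital_algebra A" and "reflexive A"
    and "unital_algebra B" and "reflexive B"
  shows "tro_equivalent A B \<longleftrightarrow>
    (\<exists>\<theta>. star_isomorphism \<theta> (commutant (diagonal A)) (commutant (diagonal B)) \<and>
      \<theta> ` Lat A = Lat B)"
proof
  assume "tro_equivalent A B"
  then obtain M where "tro_link A B M"
    using assms unfolding tro_equivalent_def tro_link_def tro_def by blast
  then interpret tro_link A B M .
  show "\<exists>\<theta>. star_isomorphism \<theta> (commutant (diagonal A)) (commutant (diagonal B)) \<and> \<theta> ` Lat A = Lat B"
    using induced_star_isomorphism induced_Lat_eq by blast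
next
  have bop: "A \<subseteq> bop" "B \<subseteq> bop" using assms by (auto simp: unital_algebra_def)
  assume "\<exists>\<theta>. star_isomorphism \<theta> (commutant (diagonal A)) (commutant (diagonal B)) \<and> \<theta> ` Lat A = Lat B"
  then obtain \<theta> where iso: "star_isomorphism \<theta> (commutant (diagonal A)) (commutant (diagonal B))"
    and Lat: "\<theta> ` Lat A = Lat B" by blast
  have ci: "commutant_isomorphism (diagonal A) (diagonal B) \<theta>"
    using iso bop by (simp add: commutant_isomorphism_def diagonal_bop diagonal_adj)
  interpret commutant_isomorphism "diagonal A" "diagonal B" \<theta> by (rule ci)
  let ?M = "intertwiners (commutant (diagonal A)) \<theta>" and ?i = "inv_into (commutant (diagonal A)) \<theta>"
  have "?i ` Lat B = Lat A"
    unfolding Lat [symmetric] by (rule inv_into_image_cancel [OF inj Lat_subset_commutant_diagonal [OF bop(1)]])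
  \<comment> \<open>The second equation of TRO equivalence is the first one for the inverse
    isomorphism, whose intertwiners are the adjoints of \<open>?M\<close>.\<close>
  from star_isomorphism_imp_closure [OF inverse_isomorphism bop(2) assms(4) bop(1) assms(2) this]
  have "B = weak_star_topology closure_of op.span (adj ` adj ` ?M \<cdot> A \<cdot> adj ` ?M)"
    by (simp only: intertwiners_inverse)
  moreover have "adj ` adj ` ?M = ?M" using intertwinersD(1) by (force simp: image_image)
  ultimately show "tro_equivalent A B"
    unfolding tro_equivalent_def
    using tro_intertwiners star_isomorphism_imp_closure [OF ci bop(1) assms(2) bop(2) assms(4) Lat]
    by (intro exI [of _ ?M]) simp
qed

end
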